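(* For any fixed constant $p \ge 1$, \[ \mathbb{E}\left[\left( \frac{\mathrm{H}(\mathsf{T}_n^\Omega)}{\log n } \right)^{p}\right] \to \left(\log(1/\mathbb{E}[\xi]) \right)^{-p} \] as $n\to\infty$.
   Context: Setting. $\xi$ is a random variable with values in $\mathbb{N}_0=\{0,1,2,\dots\}$ such that $\mathbb{P}(\xi=0)>0$, $\mathbb{P}(\xi\le 1)<1$, $\mathbb{E}[\xi]<1$, and there are a slowly varying function $f$ and a constant $\alpha>1$ with $\mathbb{P}(\xi=n)=f(n)n^{-1-\alpha}$ for all large enough integers $n$. $\Omega\subset\mathbb{N}_0$ is a fixed non-empty set with $\mathbb{P}(\xi\in\Omega)>0$ such that $\Omega$ or its complement $\mathbb{N}_0\setminus\Omega$ is finite. $\mathsf{T}$ is a Galton--Watson tree with offspring distribution $\xi$. The outdegree of a vertex is its number of children. For $n$ large enough, $\mathsf{T}_n^\Omega$ denotes $\mathsf{T}$ conditioned on having exactly $n$ vertices with outdegree in $\Omega$. $\mathrm{H}(\cdot)$ denotes the height of a finite rooted tree, i.e. the maximal graph distance of a vertex from the root. *)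

theory Defs
  imports "HOL-Probability.Probability"
begin

(* f only matters near infinity: it is positive and measurable on some half-line [X, \<infinity>). *)
definition slowly_varying :: "(real \<Rightarrow> real) \<Rightarrow> bool" where
  "slowly_varying f \<longleftrightarrow>
     (\<exists>X. (\<forall>x\<ge>X. f x > 0) \<and> f \<in> borel_measurable (restrict_space borel {X..})) \<and>
     (\<forall>t>0. ((\<lambda>x. f (t * x) / f x) \<longlongrightarrow> 1) at_top)"

(* Rooted plane trees in the Ulam-Harris encoding: a tree is a set of words over the naturals,
   the root is the empty word, and the children of u are the words u @ [i] in the tree. *)
type_synonym plane_tree = "nat list set"

definition outdegree :: "plane_tree \<Rightarrow> nat list \<Rightarrow> nat" where
  "outdegree T u = card {i. u @ [i] \<in> T}"

(* The graph distance of a vertex from the root is the length of the word.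
   Only meaningful for finite non-empty trees. *)
definition tree_height :: "plane_tree \<Rightarrow> nat" where
  "tree_height T = Max (length ` T)"

(* The tree in which every vertex u has exactly c u children; c u is ignored
   for words u that do not belong to the tree. *)
inductive_set tree_of :: "(nat list \<Rightarrow> nat) \<Rightarrow> plane_tree" for c :: "nat list \<Rightarrow> nat" where
  root: "[] \<in> tree_of c"
| child: "u \<in> tree_of c \<Longrightarrow> i < c u \<Longrightarrow> u @ [i] \<in> tree_of c"

(* Independent copies of the offspring variable, one for each potential vertex. The random
   set tree_of c, with c drawn from this space, is the Galton-Watson tree. *)
definition GW_space :: "nat pmf \<Rightarrow> (nat list \<Rightarrow> nat) measure" where
  "GW_space \<xi> = (\<Pi>\<^sub>M u\<in>UNIV. measure_pmf \<xi>)"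

definition outdegree_event :: "nat set \<Rightarrow> nat \<Rightarrow> (nat list \<Rightarrow> nat) set" where
  "outdegree_event \<Omega> n =
     {c. finite {u \<in> tree_of c. outdegree (tree_of c) u \<in> \<Omega>} \<and>
         card {u \<in> tree_of c. outdegree (tree_of c) u \<in> \<Omega>} = n}"

(* uniform_measure M A is the conditional law B \<mapsto> M (A \<inter> B) / M A, so tree_of c with c drawn
   from this space is the conditioned tree, provided that the event has positive probability. *)
definition conditioned_GW_space :: "nat pmf \<Rightarrow> nat set \<Rightarrow> nat \<Rightarrow> (nat list \<Rightarrow> nat) measure" where
  "conditioned_GW_space \<xi> \<Omega> n = uniform_measure (GW_space \<xi>) (outdegree_event \<Omega> n)"

end

theory Submission
  imports Defs "HOL-Real_Asymp.Real_Asymp"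
begin

text \<open>
  Let \<open>\<mu> < 1\<close> be the mean offspring number, \<open>L = ln (1 / \<mu>)\<close> (called \<open>decay\<close> in the proofs), \<open>T\<close>
  the unconditioned tree and \<open>cnt\<close> its number of vertices with outdegree in \<open>\<Omega>\<close>. The conditioned tree is governed by a
  \<^emph>\<open>condensation\<close> phenomenon: it contains a vertex of outdegree close to linear in \<open>n\<close>, below which hang
  independent copies of \<open>T\<close>. The height of \<open>T\<close> has an exponential tail of rate \<open>L\<close>, so the maximal
  height among roughly \<open>n\<close> independent copies is close to \<open>ln n / L\<close>. The proof makes this precise up
  to factors \<open>n powr o(1)\<close>, which is all that the first-order behaviour of the height requires.

  Conditioning is cheap: \<open>P (cnt = n)\<close> is at least \<open>n powr (-1 - \<alpha> - o(1))\<close>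
  (\<open>prob_cnt_powr_ge\<close>), because the root may have \<open>k\<close> children for any \<open>k\<close> up to a multiple of \<open>n\<close>, and
  the random walk whose steps are distributed as \<open>cnt\<close> visits a high level within so many steps with
  probability bounded away from 0. Hence superpolynomially small
  events can be ignored. One of them is that a tree has at least \<open>n\<close> vertices but no outdegree
  above \<open>m = n powr (1 - \<eta>)\<close> (\<open>prob_light_large\<close>): the offspring law truncated at \<open>m\<close> has an
  exponential moment of order \<open>1 / m\<close>, and subcriticality passes it on to the tree size.

  \<^emph>\<open>Lower bound.\<close> If some vertex has \<open>m\<close> children and the height is below \<open>h\<close>, all \<open>m\<close> subtrees
  are lower than \<open>h\<close>, which has probability at most \<open>(1 - P (ht \<ge> h)) ^ m\<close>. As
  \<open>P (ht \<ge> h) \<ge> c \<nu> ^ h\<close> for every \<open>\<nu> < \<mu>\<close> (\<open>height_tail_ge\<close>), this is superpolynomially small for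
  \<open>h = (1 - \<epsilon>) ln n / L\<close> (\<open>prob_heavy_low\<close>).

  \<^emph>\<open>Upper bound.\<close> The plain estimate \<open>P (ht \<ge> h) \<le> \<mu> ^ h\<close> does not beat \<open>P (cnt = n)\<close> for
  \<open>h = (1 + \<epsilon>) ln n / L\<close>; the price of the large outdegree has to be kept. Given the
  subtrees that may hang below the heavy vertex, \<open>cnt = n\<close> forces its outdegree to be one of the times
  at which a random walk visits a prescribed level. There are boundedly many such times on average, and
  each is the outdegree with probability at most \<open>sup {P (\<xi> = k) | k \<ge> m}\<close>, of order
  \<open>n powr (-1 - \<alpha> + o(1))\<close>. Requiring in addition that one of the subtrees be high costs a further
  factor of about \<open>n \<mu> ^ h\<close> (\<open>prob_heavy_high\<close>), which makes the conditional probability at most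
  \<open>n powr (- c)\<close> with some \<open>c > 0\<close>.

  The estimates come from the decomposition of a tree at its root into independent subtrees, which in
  most cases yields inequalities \<open>u \<le> r + \<mu> u\<close>, hence \<open>u \<le> r / (1 - \<mu>)\<close>. The slowly varying factor is only
  used through \<open>f x = x powr o(1)\<close> (\<open>slowly_varying_powr_bounds\<close>). Convergence in probability becomes
  convergence of moments because heights above a large multiple of \<open>ln n\<close> are
  so unlikely for \<open>T\<close> that they contribute negligibly even after division by \<open>P (cnt = n)\<close>
  (\<open>moment_large_height_ratio\<close>).
\<close>

section \<open>Slowly varying functions\<close>

text \<open>
  The first step towards a uniform version of pointwise convergence: dominated convergence turns it
  into convergence in measure along every sequence of base points.
\<close>

lemma translation_increment_small_measure:
  fixes g :: "real \<Rightarrow> real" and a :: "nat \<Rightarrow> real"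
  assumes g: "g \<in> borel_measurable borel"
    and lim: "\<And>u. ((\<lambda>x. g (x + u) - g x) \<longlongrightarrow> 0) at_top"
    and a: "filterlim a at_top sequentially"
  shows "(\<lambda>n. measure lborel {v \<in> {0..2}. 1/2 < \<bar>g (a n + v) - g (a n)\<bar>}) \<longlonglongrightarrow> 0"
proof -
  note [measurable] = g
  let ?B = "\<lambda>n. {v \<in> {0..2}. 1/2 < \<bar>g (a n + v) - g (a n)\<bar>}"
  have B[measurable]: "?B n \<in> sets lborel" for n
    by measurable
  have "(\<lambda>n. integral\<^sup>L lborel (indicat_real (?B n))) \<longlonglongrightarrow> integral\<^sup>L lborel (\<lambda>_::real. 0::real)"
  proof (rule integral_dominated_convergence[where w = "indicat_real {0..2}"])
    show "AE v in lborel. (\<lambda>n. indicat_real (?B n) v) \<longlonglongrightarrow> 0"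
    proof (intro always_eventually allI)
      fix v :: real
      have "(\<lambda>n. g (a n + v) - g (a n)) \<longlonglongrightarrow> 0"
        using filterlim_compose[OF lim a, of v] by simp
      then have "\<forall>\<^sub>F n in sequentially. \<bar>g (a n + v) - g (a n)\<bar> < 1/2"
        by (auto dest!: tendstoD[where e = "1/2"])
      then have "\<forall>\<^sub>F n in sequentially. indicat_real (?B n) v = 0"
        by eventually_elim (auto simp: indicator_def)
      then show "(\<lambda>n. indicat_real (?B n) v) \<longlonglongrightarrow> 0"
        by (rule tendsto_eventually)
    qed
    show "integrable lborel (indicat_real {0..2::real})"
      by (simp add: integrable_indicator_iff)
    show "AE v in lborel. norm (indicat_real (?B n) v) \<le> indicat_real {0..2} v" for n
      by (auto simp: indicator_def)
  qed (auto)
  then show ?thesis by simp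
qed

lemma translation_image_eq: "(\<lambda>v. c + v) ` S = (\<lambda>v. v - c) -` S" for c :: real
proof (intro set_eqI iffI)
  fix v assume "v \<in> (\<lambda>v. v - c) -` S"
  then show "v \<in> (\<lambda>v. c + v) ` S" by (intro image_eqI[of _ _ "v - c"]) auto
qed auto

text \<open>
  This is the core of Karamata's uniform convergence theorem. An increment larger than 1 from \<open>a n\<close> to
  \<open>b n = a n + u n\<close> is impossible, because the two sets of intermediate points at which the increment
  from \<open>a n\<close>, respectively from \<open>b n\<close>, exceeds 1/2 are too small to cover the
  interval from \<open>a n + 1\<close> to \<open>a n + 2\<close>.
\<close>

lemma increment_locally_bounded:
  fixes g :: "real \<Rightarrow> real"
  assumes g: "g \<in> borel_measurable borel"
    and lim: "\<And>u. ((\<lambda>x. g (x + u) - g x) \<longlongrightarrow> 0) at_top"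
  shows "\<exists>x1. \<forall>x\<ge>x1. \<forall>u\<in>{0..1}. \<bar>g (x + u) - g x\<bar> \<le> 1"
proof (rule ccontr)
  note [measurable] = g
  assume "\<not> ?thesis"
  then have "\<forall>n::nat. \<exists>x u. x \<ge> real n \<and> u \<in> {0..1} \<and> \<bar>g (x + u) - g x\<bar> > 1"
    by (meson not_le)
  then obtain a u where au: "\<And>n. a n \<ge> real n" "\<And>n. u n \<in> {0..1}"
    "\<And>n. \<bar>g (a n + u n) - g (a n)\<bar> > 1" by metis
  define b where "b n = a n + u n" for n
  have a: "filterlim a at_top sequentially"
    by (rule filterlim_at_top_mono[OF filterlim_real_sequentially]) (use au in auto)
  have b: "filterlim b at_top sequentially"
    by (rule filterlim_at_top_mono[OF filterlim_real_sequentially], rule always_eventually)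
       (use au in \<open>auto simp: b_def intro: add_increasing2\<close>)
  let ?B = "\<lambda>a n. {v \<in> {0..2}. 1/2 < \<bar>g (a n + v) - g (a n :: real)\<bar>}"
  have "\<forall>\<^sub>F n in sequentially. measure lborel (?B a n) < 1/2"
       "\<forall>\<^sub>F n in sequentially. measure lborel (?B b n) < 1/2"
    using order_tendstoD(2)[OF translation_increment_small_measure[OF g lim a], of "1/2"]
      order_tendstoD(2)[OF translation_increment_small_measure[OF g lim b], of "1/2"] by auto
  then have "\<forall>\<^sub>F n in sequentially. measure lborel (?B a n) < 1/2 \<and> measure lborel (?B b n) < 1/2"
    by eventually_elim simp
  from eventually_happens'[OF sequentially_bot this]
  obtain n where n: "measure lborel (?B a n) < 1/2" "measure lborel (?B b n) < 1/2"
    by (elim exE conjE)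
  let ?C = "(\<lambda>v. u n + v) ` ?B b n"
  have Bs: "?B d n \<in> sets lborel" for d by measurable
  have fin: "?B d n \<in> fmeasurable lborel" for d
    by (rule fmeasurableI2[OF _ _ Bs, of "{0..2}"]) (auto simp: fmeasurable_def)
  have C: "?C = (\<lambda>v. v - u n) -` ?B b n"
    by (rule translation_image_eq)
  have "(\<lambda>v. v - u n) \<in> measurable lborel lborel" by measurable
  from measurable_sets[OF this Bs, of b] have Cs: "?C \<in> sets lborel" unfolding C by (simp only: space_lborel space_borel Int_UNIV_right)
  have Csub: "?C \<subseteq> {0..3}" using au(2)[of n] by auto
  have "{0..3::real} \<in> fmeasurable lborel" by (simp add: fmeasurable_def)
  from fmeasurableI2[OF this Csub Cs] have finC: "?C \<in> fmeasurable lborel" .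
  have "measure lborel ?C = measure lebesgue ?C" using Cs by (simp add: measure_completion)
  also have "\<dots> = measure lebesgue (?B b n)" by (rule measure_translation)
  also have "\<dots> = measure lborel (?B b n)" by (rule measure_completion[OF Bs])
  finally have mC: "measure lborel ?C < 1/2" using n by simp
  \<comment> \<open>offsets in \<open>{1..2}\<close> are in \<open>{0..2}\<close> as seen from \<open>a n\<close> and, since \<open>u n \<le> 1\<close>, also as seen from \<open>b n\<close>\<close>
  have "{1..2} \<subseteq> ?B a n \<union> ?C"
  proof
    fix v :: real assume v: "v \<in> {1..2}"
    show "v \<in> ?B a n \<union> ?C"
    proof (rule ccontr)
      assume neg: "v \<notin> ?B a n \<union> ?C"
      have 1: "\<bar>g (a n + v) - g (a n)\<bar> \<le> 1/2" using neg v by auto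
      have "v - u n \<notin> ?B b n" using neg C by auto
      moreover have "v - u n \<in> {0..2}" using v au(2)[of n] by auto
      ultimately have "\<bar>g (b n + (v - u n)) - g (b n)\<bar> \<le> 1/2" by auto
      then have 2: "\<bar>g (a n + v) - g (a n + u n)\<bar> \<le> 1/2" by (simp add: b_def)
      show False using 1 2 au(3)[of n] by linarith
    qed
  qed
  then have "measure lborel {1..2::real} \<le> measure lborel (?B a n \<union> ?C)"
    by (rule measure_mono_fmeasurable) (use finC fin in auto)
  also have "\<dots> \<le> measure lborel (?B a n) + measure lborel ?C"
    by (rule measure_Un_le) (use Cs in auto)
  also have "\<dots> < 1" using n mC by simp
  finally show False by simp
qed

text \<open>
  Summing unit steps, each of which is eventually at most \<open>\<delta> / 2\<close>, controls \<open>g\<close> at integer distance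
  from a base point; the preceding lemma bounds the rest by a constant.
\<close>

lemma increment_sublinear:
  fixes g :: "real \<Rightarrow> real"
  assumes g: "g \<in> borel_measurable borel"
    and lim: "\<And>u. ((\<lambda>x. g (x + u) - g x) \<longlongrightarrow> 0) at_top"
    and \<delta>: "\<delta> > 0"
  shows "\<forall>\<^sub>F x in at_top. \<bar>g x\<bar> \<le> \<delta> * x"
proof -
  obtain x1 where x1: "\<And>x u. x \<ge> x1 \<Longrightarrow> u \<in> {0..1} \<Longrightarrow> \<bar>g (x + u) - g x\<bar> \<le> 1"
    using increment_locally_bounded[OF g lim] by blast
  have "\<forall>\<^sub>F x in at_top. \<bar>g (x + 1) - g x\<bar> < \<delta>/2"
    using lim[of 1] \<delta> by (auto dest!: tendstoD[where e = "\<delta>/2"])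
  then obtain x2 where x2: "\<And>x. x \<ge> x2 \<Longrightarrow> \<bar>g (x + 1) - g x\<bar> < \<delta>/2"
    by (auto simp: eventually_at_top_linorder)
  define y where "y = max 0 (max x1 x2)"
  have step: "\<bar>g (y + real n)\<bar> \<le> \<bar>g y\<bar> + \<delta>/2 * real n" for n
  proof (induction n)
    case (Suc n)
    have "\<bar>g (y + real n + 1) - g (y + real n)\<bar> < \<delta>/2" by (rule x2) (auto simp: y_def)
    moreover have "g (y + real (Suc n)) = g (y + real n + 1)" by (simp add: algebra_simps)
    moreover have "\<delta>/2 * real (Suc n) = \<delta>/2 * real n + \<delta>/2" by (simp add: field_simps)
    ultimately show ?case using Suc by linarith
  qed simp
  have bound: "\<bar>g x\<bar> \<le> \<bar>g y\<bar> + 1 + \<delta>/2 * x" if x: "x \<ge> y" for x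
  proof -
    define n where "n = nat \<lfloor>x - y\<rfloor>"
    have n: "real n \<le> x - y" "x - y < real n + 1" unfolding n_def using x by linarith+
    have "\<bar>g (y + real n + (x - y - real n)) - g (y + real n)\<bar> \<le> 1"
      by (rule x1) (use n in \<open>auto simp: y_def\<close>)
    then have "\<bar>g x\<bar> \<le> \<bar>g y\<bar> + 1 + \<delta>/2 * real n" using step[of n] by simp
    also have "real n \<le> x" using n by (simp add: y_def)
    finally show ?thesis using \<delta> by simp
  qed
  have "\<forall>\<^sub>F x in at_top. x \<ge> max y (2 * (\<bar>g y\<bar> + 1) / \<delta>)" by (rule eventually_ge_at_top)
  then show ?thesis
  proof eventually_elim
    case (elim x)
    then have "\<bar>g y\<bar> + 1 \<le> \<delta>/2 * x" using \<delta> by (simp add: field_simps)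
    then show ?case using bound[of x] elim by (simp add: field_simps)
  qed
qed

text \<open>
  In logarithmic coordinates a slowly varying function has vanishing increments.
\<close>

lemma slowly_varying_powr_bounds:
  assumes sv: "slowly_varying f" and \<delta>: "\<delta> > 0"
  shows "\<forall>\<^sub>F x in at_top. x powr (-\<delta>) \<le> f x \<and> f x \<le> x powr \<delta>"
proof -
  from sv obtain X0 where X0: "\<And>x. x \<ge> X0 \<Longrightarrow> f x > 0"
      and fm: "f \<in> borel_measurable (restrict_space borel {X0..})"
      and lim: "\<And>t. t > 0 \<Longrightarrow> ((\<lambda>x. f (t * x) / f x) \<longlongrightarrow> 1) at_top"
    unfolding slowly_varying_def by blast
  define X where "X = max X0 1"
  define g where "g x = (if x \<ge> ln X then ln (f (exp x)) else 0)" for x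
  have X: "X > 0" "X \<ge> X0" by (auto simp: X_def)
  have exp_ge: "exp x \<ge> X" if "x \<ge> ln X" for x
    using that X by (metis exp_le_cancel_iff exp_ln)
  have [measurable]: "(\<lambda>x. indicator {X0..} x *\<^sub>R f x) \<in> borel_measurable borel"
    using fm by (subst (asm) borel_measurable_restrict_space_iff) auto
  have g_eq: "g = (\<lambda>x. if x \<ge> ln X then ln (indicator {X0..} (exp x) *\<^sub>R f (exp x)) else 0)"
    using X exp_ge by (fastforce simp: g_def fun_eq_iff indicator_def)
  have gm: "g \<in> borel_measurable borel" unfolding g_eq by measurable
  have glim: "((\<lambda>x. g (x + u) - g x) \<longlongrightarrow> 0) at_top" for u
  proof -
    have "((\<lambda>x. ln (f (exp u * exp x) / f (exp x))) \<longlongrightarrow> ln 1) at_top"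
      using filterlim_compose[OF lim[of "exp u"] exp_at_top] by (intro tendsto_ln) auto
    moreover have "\<forall>\<^sub>F x in at_top. ln (f (exp u * exp x) / f (exp x)) = g (x + u) - g x"
      using eventually_ge_at_top[of "ln X"] eventually_ge_at_top[of "ln X - u"]
    proof eventually_elim
      case (elim x)
      have "exp x \<ge> X" "exp (x + u) \<ge> X"
        using elim by (auto intro: exp_ge)
      then have "f (exp x) > 0" "f (exp (x + u)) > 0" using X0 X by (meson order_trans)+
      then show ?case using elim by (simp add: g_def ln_div exp_add mult.commute)
    qed
    ultimately show ?thesis by (simp add: tendsto_cong)
  qed
  have "\<forall>\<^sub>F x in at_top. \<bar>g (ln x)\<bar> \<le> \<delta> * ln x"
    using increment_sublinear[OF gm glim \<delta>] by (rule eventually_compose_filterlim[OF _ ln_at_top])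
  then show ?thesis using eventually_ge_at_top[of X]
  proof eventually_elim
    case (elim x)
    then have x: "x > 0" "f x > 0" using X X0[of x] by auto
    then have gl: "g (ln x) = ln (f x)" using elim X by (simp add: g_def)
    have "- \<delta> * ln x \<le> ln (f x)" "ln (f x) \<le> \<delta> * ln x" using elim gl by auto
    then have "exp (- \<delta> * ln x) \<le> f x" "f x \<le> exp (\<delta> * ln x)"
      using x by (metis exp_le_cancel_iff exp_ln)+
    then show ?case using x by (simp add: powr_def)
  qed
qed

section \<open>Renewal sequences\<close>

text \<open>
  The probability that a random walk with step law \<open>\<nu>\<close> started in 0 is at \<open>x\<close> after \<open>k\<close> steps.
\<close>

primrec conv_pow :: "(nat \<Rightarrow> real) \<Rightarrow> nat \<Rightarrow> nat \<Rightarrow> real" where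
  "conv_pow \<nu> 0 x = (if x = 0 then 1 else 0)"
| "conv_pow \<nu> (Suc k) x = (\<Sum>j\<le>x. \<nu> j * conv_pow \<nu> k (x - j))"

locale renewal =
  fixes \<nu> :: "nat \<Rightarrow> real"
  assumes nonneg: "\<nu> j \<ge> 0" and sums_one: "\<nu> sums 1" and one_pos: "\<nu> 1 > 0"
    and summable_tail: "summable (\<lambda>x. 1 - (\<Sum>j\<le>x. \<nu> j))"
begin

definition tail :: "nat \<Rightarrow> real" where "tail x = 1 - (\<Sum>j\<le>x. \<nu> j)"

text \<open>
  The expected number of visits of the walk to \<open>x\<close>. Its variant, in which a visit at time \<open>k\<close> counts
  \<open>k + 1\<close> times, takes care of the choice of one among \<open>k + 1\<close> subtrees.
\<close>

definition green :: "nat \<Rightarrow> real" where "green x = (\<Sum>k. conv_pow \<nu> k x)"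

definition weighted_green :: "nat \<Rightarrow> real" where "weighted_green x = (\<Sum>k. real (Suc k) * conv_pow \<nu> k x)"

lemma tail_nonneg: "tail x \<ge> 0"
  unfolding tail_def using sum_le_suminf[of \<nu> "{..x}"] sums_one nonneg
  by (simp add: sums_iff)

lemma mass_zero_less_one: "\<nu> 0 < 1"
proof -
  have "\<nu> 0 + \<nu> 1 \<le> 1" using tail_nonneg[of 1] by (simp add: tail_def)
  then show ?thesis using one_pos by simp
qed

lemma conv_pow_nonneg: "conv_pow \<nu> k x \<ge> 0"
  by (induction k arbitrary: x) (auto intro!: sum_nonneg mult_nonneg_nonneg nonneg)

text \<open>
  The generating function of \<open>\<nu>\<close> at 1/2 is less than 1, because \<open>\<nu>\<close> is not concentrated in 0.
\<close>

lemma conv_pow_geometric: "\<exists>\<rho>. 0 < \<rho> \<and> \<rho> < 1 \<and> (\<forall>k x. conv_pow \<nu> k x \<le> 2 ^ x * \<rho> ^ k)"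
proof -
  define \<rho> where "\<rho> = (1 + \<nu> 0) / 2"
  have \<rho>: "0 < \<rho>" "\<rho> < 1" using mass_zero_less_one nonneg[of 0] by (auto simp: \<rho>_def)
  \<comment> \<open>all mass outside 0 is at least halved\<close>
  have gen: "(\<Sum>j\<le>x. \<nu> j * (1/2) ^ j) \<le> \<rho>" for x
  proof -
    have "(\<Sum>j\<le>x. \<nu> j * (1/2) ^ j) \<le> (\<Sum>j\<le>x. \<nu> j * (1/2) + (if j = 0 then \<nu> 0 / 2 else 0))"
    proof (rule sum_mono)
      fix j
      show "\<nu> j * (1/2) ^ j \<le> \<nu> j * (1/2) + (if j = 0 then \<nu> 0 / 2 else 0)"
        using mult_left_mono[OF power_decreasing[of 1 j "1/2::real"] nonneg[of j]]
        by (cases "j = 0") auto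
    qed
    also have "\<dots> = (\<Sum>j\<le>x. \<nu> j) / 2 + \<nu> 0 / 2"
      by (simp add: sum.distrib sum_divide_distrib)
    also have "\<dots> \<le> \<rho>" using tail_nonneg[of x] by (simp add: \<rho>_def tail_def)
    finally show ?thesis .
  qed
  have "conv_pow \<nu> k x \<le> 2 ^ x * \<rho> ^ k" for k x
  proof (induction k arbitrary: x)
    case (Suc k)
    have "conv_pow \<nu> (Suc k) x \<le> (\<Sum>j\<le>x. \<nu> j * (2 ^ (x - j) * \<rho> ^ k))"
      unfolding conv_pow.simps by (intro sum_mono mult_left_mono Suc nonneg)
    also have "\<dots> = 2 ^ x * \<rho> ^ k * (\<Sum>j\<le>x. \<nu> j * (1/2) ^ j)"
      unfolding sum_distrib_left by (intro sum.cong) (auto simp: power_diff field_simps)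
    also have "\<dots> \<le> 2 ^ x * \<rho> ^ k * \<rho>"
      using gen[of x] \<rho> by (intro mult_left_mono) auto
    finally show ?case by (simp add: mult_ac)
  qed auto
  then show ?thesis using \<rho> by blast
qed

lemma summable_weighted_green: "summable (\<lambda>k. real (Suc k) * conv_pow \<nu> k x)"
proof -
  obtain \<rho> where \<rho>: "0 < \<rho>" "\<rho> < 1" "\<And>k x. conv_pow \<nu> k x \<le> 2 ^ x * \<rho> ^ k"
    using conv_pow_geometric by blast
  have "summable (\<lambda>k. of_nat (Suc k) * \<rho> ^ k)"
    using \<rho> geometric_deriv_sums[of \<rho>] by (auto simp: sums_iff)
  then have "summable (\<lambda>k. 2 ^ x * (of_nat (Suc k) * \<rho> ^ k))" by (rule summable_mult)
  then show ?thesis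
  proof (rule summable_comparison_test[rotated], intro exI allI impI)
    fix k show "norm (real (Suc k) * conv_pow \<nu> k x) \<le> 2 ^ x * (of_nat (Suc k) * \<rho> ^ k)"
      using mult_left_mono[OF \<rho>(3)[of k x], of "real (Suc k)"] conv_pow_nonneg[of k x]
      by (simp add: mult_ac abs_mult)
  qed
qed

lemma summable_green: "summable (\<lambda>k. conv_pow \<nu> k x)"
proof (rule summable_comparison_test[OF _ summable_weighted_green[of x]], intro exI allI impI)
  fix k show "norm (conv_pow \<nu> k x) \<le> real (Suc k) * conv_pow \<nu> k x"
    using mult_right_mono[of 1 "real (Suc k)", OF _ conv_pow_nonneg[of k x]]
    by (simp add: conv_pow_nonneg)
qed

lemma green_nonneg: "green x \<ge> 0" and weighted_green_nonneg: "weighted_green x \<ge> 0"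
  unfolding green_def weighted_green_def
  by (intro suminf_nonneg summable_green summable_weighted_green mult_nonneg_nonneg conv_pow_nonneg of_nat_0_le_iff)+

lemma green_rec: "green x = (if x = 0 then 1 else 0) + (\<Sum>j\<le>x. \<nu> j * green (x - j))"
proof -
  have "green x = conv_pow \<nu> 0 x + (\<Sum>k. conv_pow \<nu> (Suc k) x)"
    unfolding green_def using suminf_split_head[OF summable_green] by simp
  also have "(\<Sum>k. conv_pow \<nu> (Suc k) x) = (\<Sum>j\<le>x. (\<Sum>k. \<nu> j * conv_pow \<nu> k (x - j)))"
    unfolding conv_pow.simps by (rule suminf_sum) (intro summable_mult summable_green)
  also have "\<dots> = (\<Sum>j\<le>x. \<nu> j * green (x - j))"
    unfolding green_def by (intro sum.cong suminf_mult refl summable_green)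
  finally show ?thesis by simp
qed

lemma weighted_green_rec: "weighted_green x = green x + (\<Sum>j\<le>x. \<nu> j * weighted_green (x - j))"
proof -
  have s: "summable (\<lambda>k. real k * conv_pow \<nu> k x)"
    using summable_diff[OF summable_weighted_green[of x] summable_green[of x]] by (simp add: algebra_simps)
  have "weighted_green x = (\<Sum>k. conv_pow \<nu> k x + real k * conv_pow \<nu> k x)"
    unfolding weighted_green_def by (simp add: algebra_simps)
  also have "\<dots> = green x + (\<Sum>k. real k * conv_pow \<nu> k x)"
    unfolding green_def by (rule suminf_add[symmetric, OF summable_green s])
  also have "(\<Sum>k. real k * conv_pow \<nu> k x) = (\<Sum>k. real (Suc k) * conv_pow \<nu> (Suc k) x)"
    using suminf_split_head[OF s] by simp
  also have "\<dots> = (\<Sum>k. \<Sum>j\<le>x. \<nu> j * (real (Suc k) * conv_pow \<nu> k (x - j)))"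
    by (simp add: sum_distrib_left mult_ac)
  also have "\<dots> = (\<Sum>j\<le>x. (\<Sum>k. \<nu> j * (real (Suc k) * conv_pow \<nu> k (x - j))))"
    by (rule suminf_sum) (intro summable_mult summable_weighted_green)
  also have "\<dots> = (\<Sum>j\<le>x. \<nu> j * weighted_green (x - j))"
    unfolding weighted_green_def by (intro sum.cong suminf_mult refl summable_weighted_green)
  finally show ?thesis .
qed

text \<open>
  For \<open>W = green\<close> the right-hand side is 1, and the identity says that there is exactly
  one time at which the walk leaves \<open>{..x}\<close>. In general it is the summation of the renewal equation over an initial segment.
\<close>

lemma renewal_identity:
  assumes W: "\<And>x. W x = g x + (\<Sum>j\<le>x. \<nu> j * W (x - j))"
  shows "(\<Sum>z\<le>x. W z * tail (x - z)) = (\<Sum>z\<le>x. g z)"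
proof (induction x)
  case 0
  then show ?case using W[of 0] by (simp add: tail_def algebra_simps)
next
  case (Suc x)
  have "tail (Suc x - z) = tail (x - z) - \<nu> (Suc x - z)" if "z \<le> x" for z
    using that by (simp add: tail_def Suc_diff_le)
  then have "(\<Sum>z\<le>x. W z * tail (Suc x - z)) = (\<Sum>z\<le>x. W z * tail (x - z) - W z * \<nu> (Suc x - z))"
    by (intro sum.cong) (auto simp: right_diff_distrib)
  then have "(\<Sum>z\<le>Suc x. W z * tail (Suc x - z))
      = (\<Sum>z\<le>x. W z * tail (x - z)) - (\<Sum>z\<le>x. W z * \<nu> (Suc x - z)) + W (Suc x) * tail 0"
    by (simp add: sum_subtractf)
  also have "W (Suc x) * tail 0 = W (Suc x) - W (Suc x) * \<nu> 0" by (simp add: tail_def algebra_simps)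
  also have "(\<Sum>z\<le>x. W z * tail (x - z)) - (\<Sum>z\<le>x. W z * \<nu> (Suc x - z)) + \<dots>
     = (\<Sum>z\<le>x. g z) + W (Suc x) - (\<Sum>z\<le>Suc x. W z * \<nu> (Suc x - z))" using Suc by simp
  also have "(\<Sum>z\<le>Suc x. W z * \<nu> (Suc x - z)) = (\<Sum>j\<le>Suc x. \<nu> j * W (Suc x - j))"
    by (rule sum.reindex_bij_witness[of _ "\<lambda>j. Suc x - j" "\<lambda>j. Suc x - j"]) auto
  also have "(\<Sum>z\<le>x. g z) + W (Suc x) - \<dots> = (\<Sum>z\<le>Suc x. g z)" using W[of "Suc x"] by simp
  finally show ?case .
qed

lemma green_identity: "(\<Sum>z\<le>x. green z * tail (x - z)) = 1"
  using renewal_identity[OF green_rec, of x] by simp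

lemma green_bounded: "green x \<le> 1 / tail 0"
proof -
  have "green x * tail (x - x) \<le> (\<Sum>z\<le>x. green z * tail (x - z))"
    by (rule member_le_sum) (auto intro: green_nonneg tail_nonneg mult_nonneg_nonneg)
  then show ?thesis using green_identity[of x] mass_zero_less_one by (simp add: field_simps tail_def)
qed

lemma weighted_green_bounded: "weighted_green x \<le> real (Suc x) / (tail 0)\<^sup>2"
proof -
  have t: "tail 0 > 0" using mass_zero_less_one by (simp add: tail_def)
  have "weighted_green x * tail (x - x) \<le> (\<Sum>z\<le>x. weighted_green z * tail (x - z))"
    by (rule member_le_sum) (auto intro: weighted_green_nonneg tail_nonneg mult_nonneg_nonneg)
  also have "\<dots> = (\<Sum>z\<le>x. green z)" by (rule renewal_identity[OF weighted_green_rec])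
  also have "\<dots> \<le> (\<Sum>z\<le>x. 1 / tail 0)" by (intro sum_mono green_bounded)
  finally show ?thesis using t by (simp add: field_simps power2_eq_square)
qed

text \<open>
  By the renewal identity, the positions from which a step longer than \<open>a\<close> leaves \<open>{..x}\<close> account for
  at most half of the total mass if \<open>a\<close> is large. So the walk has a fair chance of visiting
  the window \<open>{x - a..x}\<close>, and it reaches \<open>x\<close> from there by at most \<open>a\<close> unit steps.
\<close>

lemma green_bounded_below: "\<exists>c>0. \<forall>x. green x \<ge> c"
proof -
  define C where "C = 1 / tail 0"
  have t: "tail 0 > 0" using mass_zero_less_one by (simp add: tail_def)
  then have C: "C > 0" by (simp add: C_def)
  have "tail = (\<lambda>x. 1 - (\<Sum>j\<le>x. \<nu> j))" by (rule ext) (rule tail_def)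
  with summable_tail have st: "summable tail" by metis
  have "\<forall>\<^sub>F a in sequentially. (\<Sum>j. tail (j + a)) < 1 / (2 * C)"
    using suminf_exist_split2[OF st] C by (auto dest!: order_tendstoD(2)[where a = "1/(2*C)"])
  from eventually_happens'[OF sequentially_bot this]
  obtain a where a: "(\<Sum>j. tail (j + a)) < 1 / (2 * C)" by (elim exE)
  define \<beta> where "\<beta> = \<nu> 1"
  have \<beta>: "0 < \<beta>" "\<beta> \<le> 1" using one_pos tail_nonneg[of 1] nonneg[of 0] by (auto simp: \<beta>_def tail_def)
  have up: "green (z + i) \<ge> \<beta> ^ i * green z" for z i
  proof (induction i)
    case (Suc i)
    have "\<nu> 1 * green (Suc (z + i) - 1) \<le> (\<Sum>j\<le>Suc (z+i). \<nu> j * green (Suc (z+i) - j))"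
      by (rule member_le_sum) (auto intro: green_nonneg nonneg mult_nonneg_nonneg)
    also have "\<dots> \<le> green (Suc (z + i))" using green_rec[of "Suc (z + i)"] by simp
    finally have "\<beta> * green (z + i) \<le> green (z + Suc i)" by (simp add: \<beta>_def)
    moreover have "\<beta> * (\<beta> ^ i * green z) \<le> \<beta> * green (z + i)"
      using Suc \<beta> by (intro mult_left_mono) auto
    ultimately show ?case by (simp add: mult_ac)
  qed simp
  have main: "green x \<ge> \<beta> ^ a / (2 * real (Suc a))" for x
  proof -
    let ?A = "{z. z \<le> x \<and> x - z \<ge> a}" and ?B = "{z. z \<le> x \<and> x - z < a}"
    have un: "{..x} = ?A \<union> ?B" by auto
    have fin: "finite ?A" "finite ?B" by (auto intro: finite_subset[of _ "{..x}"])
    have "(\<Sum>z\<in>?A. green z * tail (x - z)) \<le> (\<Sum>z\<in>?A. C * tail (x - z))"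
      by (intro sum_mono mult_right_mono) (auto simp: C_def intro: green_bounded tail_nonneg)
    also have "\<dots> = C * (\<Sum>z\<in>?A. tail (x - z))" by (simp add: sum_distrib_left)
    also have "(\<Sum>z\<in>?A. tail (x - z)) = (\<Sum>j\<in>(\<lambda>z. x - z - a) ` ?A. tail (j + a))"
      by (subst sum.reindex) (auto simp: inj_on_def intro!: sum.cong)
    also have "\<dots> \<le> (\<Sum>j. tail (j + a))"
      by (rule sum_le_suminf) (auto intro: tail_nonneg fin summable_ignore_initial_segment[OF st, of a] simp: st)
    also have "C * \<dots> \<le> 1/2" using a C by (simp add: field_simps)
    finally have "(\<Sum>z\<in>?A. green z * tail (x - z)) \<le> 1/2" using C by simp
    moreover have "(\<Sum>z\<le>x. green z * tail (x - z))
        = (\<Sum>z\<in>?A. green z * tail (x - z)) + (\<Sum>z\<in>?B. green z * tail (x - z))"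
      unfolding un by (rule sum.union_disjoint) (auto intro: fin)
    ultimately have B: "(\<Sum>z\<in>?B. green z * tail (x - z)) \<ge> 1/2"
      using green_identity[of x] by simp
    have *: "green z * tail (x - z) \<le> green x / \<beta> ^ a" if z: "z \<in> ?B" for z
    proof -
      have "tail (x - z) \<le> 1" using nonneg by (auto simp: tail_def intro: sum_nonneg)
      then have "green z * tail (x - z) \<le> green z" 
        using green_nonneg[of z] by (simp add: mult_left_le)
      also have "\<beta> ^ a * green z \<le> \<beta> ^ (x - z) * green z"
        using z \<beta> by (intro mult_right_mono power_decreasing green_nonneg) auto
      then have "green z \<le> green x / \<beta> ^ a" using up[of "x - z" z] z \<beta> by (simp add: field_simps)
      finally show ?thesis .
    qed
    have "?B \<subseteq> {x - a..x}" by auto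
    then have cardB: "card ?B \<le> Suc a" using card_mono[of "{x-a..x}" ?B] by simp
    have "(\<Sum>z\<in>?B. green z * tail (x - z)) \<le> real (card ?B) * (green x / \<beta> ^ a)"
      by (rule sum_bounded_above) (rule *)
    then have "1/2 \<le> real (card ?B) * (green x / \<beta> ^ a)" using B by linarith
    also have "\<dots> \<le> real (Suc a) * (green x / \<beta> ^ a)"
      using cardB green_nonneg[of x] \<beta> by (intro mult_right_mono) auto
    finally show ?thesis using \<beta> by (simp add: field_simps)
  qed
  show ?thesis by (rule exI[of _ "\<beta> ^ a / (2 * real (Suc a))"]) (use main \<beta> in auto)
qed

lemma conv_pow_tendsto_0: "conv_pow \<nu> k \<longlonglongrightarrow> 0"
proof (cases k)
  case 0
  have "\<forall>\<^sub>F x in sequentially. conv_pow \<nu> 0 x = 0"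
    using eventually_gt_at_top[of 0] by eventually_elim simp
  then show ?thesis unfolding 0 by (rule tendsto_eventually)
next
  case (Suc i)
  have sum_le: "(\<Sum>x\<le>X. conv_pow \<nu> k x) \<le> 1" for k X
  proof (induction k arbitrary: X)
    case (Suc k)
    have "(\<Sum>x\<le>X. conv_pow \<nu> (Suc k) x) = (\<Sum>j\<le>X. \<Sum>y\<le>X - j. \<nu> j * conv_pow \<nu> k y)"
      unfolding conv_pow.simps sum.Sigma[OF finite_atMost ballI[OF finite_atMost]]
      by (rule sum.reindex_bij_witness[of _ "\<lambda>(j, y). (j + y, j)" "\<lambda>(x, j). (j, x - j)"]) auto
    also have "\<dots> = (\<Sum>j\<le>X. \<nu> j * (\<Sum>y\<le>X - j. conv_pow \<nu> k y))" by (simp add: sum_distrib_left)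
    also have "\<dots> \<le> (\<Sum>j\<le>X. \<nu> j * 1)" by (intro sum_mono mult_left_mono Suc nonneg)
    also have "\<dots> \<le> 1" using tail_nonneg[of X] by (simp add: tail_def)
    finally show ?case .
  qed simp
  have "(\<Sum>x<X. conv_pow \<nu> k x) \<le> 1" for X
    by (rule order_trans[OF sum_mono2 sum_le[of k X]]) (auto simp: conv_pow_nonneg)
  then have "summable (conv_pow \<nu> k)"
    by (intro summableI_nonneg_bounded[where x = 1]) (auto simp: conv_pow_nonneg)
  then show ?thesis by (rule summable_LIMSEQ_zero)
qed

text \<open>
  Visits to \<open>x\<close> at bounded times are rare since the walk is still far from \<open>x\<close>, and visits after
  time \<open>K * x\<close> are rare by the geometric bound; so the visits in between carry the Green function.
\<close>

lemma green_window_bounded_below: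
  "\<exists>c>0. \<exists>K. \<forall>\<^sub>F x in sequentially. (\<Sum>k=k0..K * x. conv_pow \<nu> k x) \<ge> c"
proof -
  obtain c where c: "c > 0" "\<And>x. green x \<ge> c" using green_bounded_below by blast
  obtain \<rho> where \<rho>: "0 < \<rho>" "\<rho> < 1" "\<And>k x. conv_pow \<nu> k x \<le> 2 ^ x * \<rho> ^ k"
    using conv_pow_geometric by blast
  obtain K where K: "\<rho> ^ K < 1/4" using real_arch_pow_inv[of "1/4" \<rho>] \<rho> by auto
  have "(\<lambda>x. \<Sum>k<k0. conv_pow \<nu> k x) \<longlonglongrightarrow> (\<Sum>k<k0. 0)"
    by (intro tendsto_sum conv_pow_tendsto_0)
  then have e1: "\<forall>\<^sub>F x in sequentially. (\<Sum>k<k0. conv_pow \<nu> k x) < c/3"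
    using c by (intro order_tendstoD(2)) auto
  have "(\<lambda>x. (1/2::real) ^ x * (1 / (1 - \<rho>))) \<longlonglongrightarrow> 0 * (1 / (1 - \<rho>))"
    by (intro tendsto_intros LIMSEQ_realpow_zero) auto
  then have e2: "\<forall>\<^sub>F x in sequentially. (1/2::real) ^ x * (1 / (1 - \<rho>)) < c/3"
    using c by (intro order_tendstoD(2)) auto
  have "\<forall>\<^sub>F x in sequentially. (\<Sum>k=k0..K * x. conv_pow \<nu> k x) \<ge> c/3"
    using e1 e2
  proof eventually_elim
    case (elim x)
    have "(\<Sum>k. conv_pow \<nu> (k + Suc (K * x)) x) \<le> (\<Sum>k. (1/2) ^ x * \<rho> ^ k)"
    proof (rule suminf_le)
      show "summable (\<lambda>k. conv_pow \<nu> (k + Suc (K * x)) x)"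
        by (rule summable_ignore_initial_segment[OF summable_green])
      show "summable (\<lambda>k. (1/2::real) ^ x * \<rho> ^ k)"
        using \<rho> by (intro summable_mult summable_geometric) auto
      fix k
      have "conv_pow \<nu> (k + Suc (K * x)) x \<le> 2 ^ x * (\<rho> ^ K) ^ x * (\<rho> ^ k * \<rho>)"
        using \<rho>(3)[of "k + Suc (K * x)" x] by (simp add: power_add power_mult mult_ac)
      also have "\<dots> \<le> 2 ^ x * (1/4) ^ x * (\<rho> ^ k * 1)"
        using \<rho> K by (intro mult_mono power_mono) auto
      also have "2 ^ x * (1/4) ^ x = (1/2::real) ^ x" by (simp flip: power_mult_distrib)
      finally show "conv_pow \<nu> (k + Suc (K * x)) x \<le> (1/2) ^ x * \<rho> ^ k" by simp
    qed
    also have "\<dots> = (1/2) ^ x * (1 / (1 - \<rho>))"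
      using \<rho> by (simp add: suminf_mult suminf_geometric)
    finally have tl: "(\<Sum>k. conv_pow \<nu> (k + Suc (K * x)) x) < c/3" using elim(2) by linarith
    have "green x = (\<Sum>k. conv_pow \<nu> (k + Suc (K * x)) x) + (\<Sum>k<Suc (K * x). conv_pow \<nu> k x)"
      unfolding green_def by (rule suminf_split_initial_segment[OF summable_green])
    moreover have "(\<Sum>k<Suc (K * x). conv_pow \<nu> k x) \<le> (\<Sum>k\<in>{..<k0} \<union> {k0..K * x}. conv_pow \<nu> k x)"
      by (rule sum_mono2) (auto intro: conv_pow_nonneg)
    moreover have "\<dots> = (\<Sum>k<k0. conv_pow \<nu> k x) + (\<Sum>k=k0..K * x. conv_pow \<nu> k x)"
      by (rule sum.union_disjoint) auto
    ultimately show ?case using c(2)[of x] tl elim(1) by linarith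
  qed
  then show ?thesis using c(1) by (intro exI[of _ "c/3"]) auto
qed

end

section \<open>Finite plane trees and their Galton-Watson law\<close>

lemma integrable_pmf_bounded:
  fixes f :: "'a \<Rightarrow> real"
  assumes "\<And>x. \<bar>f x\<bar> \<le> B"
  shows "integrable (measure_pmf p) f"
  using assms by (intro measure_pmf.integrable_const_bound[where B = B]) auto

lemma integrable_pmf_prob: "integrable (measure_pmf p) (\<lambda>x. measure_pmf.prob (q x) (A x))"
  by (rule integrable_pmf_bounded[where B = 1]) auto

lemma prob_bind_pmf:
  "measure_pmf.prob (bind_pmf p f) A = measure_pmf.expectation p (\<lambda>x. measure_pmf.prob (f x) A)"
proof -
  have "ennreal (measure_pmf.prob (bind_pmf p f) A) = (\<integral>\<^sup>+x. ennreal (measure_pmf.prob (f x) A) \<partial>p)"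
    by (simp flip: measure_pmf.emeasure_eq_measure)
  also have "\<dots> = ennreal (measure_pmf.expectation p (\<lambda>x. measure_pmf.prob (f x) A))"
    by (rule nn_integral_eq_integral[OF integrable_pmf_prob]) simp
  finally show ?thesis by (simp add: integral_nonneg_AE)
qed

lemma prob_product_pair:
  "measure_pmf.prob (pair_pmf p q) (A \<times> B) = measure_pmf.prob p A * measure_pmf.prob q B"
proof -
  have "measure_pmf.prob (map_pmf (Pair x) q) (A \<times> B) = indicator A x * measure_pmf.prob q B" for x
    by (auto simp: indicator_def intro!: arg_cong[where f = "measure_pmf.prob q"])
  then show ?thesis
    by (simp add: pair_pmf_def prob_bind_pmf flip: map_pmf_def)
qed

lemma expectation_single:
  "measure_pmf.expectation p (\<lambda>k. if k = n then c else 0) = pmf p n * (c :: real)"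
proof -
  have "(\<lambda>k. if k = n then c else 0) = (\<lambda>k. indicator {n} k * c)" by (auto simp: indicator_def)
  then show ?thesis by (simp add: pmf.rep_eq)
qed

lemma expectation_nat_sums:
  fixes p :: "nat pmf" and g :: "nat \<Rightarrow> real"
  assumes "integrable (measure_pmf p) g"
  shows "(\<lambda>k. pmf p k * g k) sums measure_pmf.expectation p g"
proof -
  from assms have "integrable (density (count_space UNIV) (pmf p)) g"
    by (simp add: measure_pmf_eq_density)
  then have "integrable (count_space UNIV) (\<lambda>k. pmf p k * g k)"
    by (subst (asm) integrable_density) auto
  then have "(\<lambda>k. pmf p k * g k) sums (\<integral>k. pmf p k * g k \<partial>count_space UNIV)"
    by (rule sums_integral_count_space_nat)
  also have "(\<integral>k. pmf p k * g k \<partial>count_space UNIV) = measure_pmf.expectation p g"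
    unfolding measure_pmf_eq_density[of p] by (subst integral_density) auto
  finally show ?thesis .
qed

lemma replicate_pmf_Suc_pair:
  "replicate_pmf (Suc n) p = map_pmf (\<lambda>(x, xs). x # xs) (pair_pmf p (replicate_pmf n p))"
  by (simp add: pair_pmf_def map_bind_pmf)

lemma pmf_replicate_pmf:
  "pmf (replicate_pmf n p) xs = (if length xs = n then prod_list (map (pmf p) xs) else 0)"
proof (induction n arbitrary: xs)
  case (Suc n)
  have inj: "inj (\<lambda>(x, xs). x # xs :: 'a list)" by (auto simp: inj_def)
  show ?case
  proof (cases xs)
    case Nil
    then show ?thesis by (auto simp: pmf_eq_0_set_pmf set_replicate_pmf simp del: replicate_pmf.simps)
  next
    case (Cons y ys)
    have "pmf (replicate_pmf (Suc n) p) xs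
        = pmf (map_pmf (\<lambda>(x, xs). x # xs) (pair_pmf p (replicate_pmf n p))) ((\<lambda>(x, xs). x # xs) (y, ys))"
      unfolding replicate_pmf_Suc_pair Cons by simp
    also have "\<dots> = pmf (pair_pmf p (replicate_pmf n p)) (y, ys)" by (rule pmf_map_inj'[OF inj])
    finally show ?thesis using Cons Suc by (simp add: pmf_pair)
  qed
qed (auto simp: pmf_return)

lemma prob_replicate_all:
  "measure_pmf.prob (replicate_pmf k p) {xs. \<forall>x\<in>set xs. x \<in> A} = measure_pmf.prob p A ^ k"
proof (induction k)
  case (Suc k)
  have "measure_pmf.prob (replicate_pmf (Suc k) p) {xs. \<forall>x\<in>set xs. x \<in> A}
      = measure_pmf.prob (pair_pmf p (replicate_pmf k p)) (A \<times> {xs. \<forall>x\<in>set xs. x \<in> A})"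
    unfolding replicate_pmf_Suc_pair measure_map_pmf by (rule arg_cong[where f = "measure_pmf.prob _"]) auto
  then show ?case using Suc by (simp add: prob_product_pair del: replicate_pmf.simps)
qed simp

lemma prob_replicate_ex:
  "measure_pmf.prob (replicate_pmf k p) {xs. \<exists>x\<in>set xs. x \<in> A} = 1 - (1 - measure_pmf.prob p A) ^ k"
proof -
  have "{xs. \<exists>x\<in>set xs. x \<in> A} = UNIV - {xs. \<forall>x\<in>set xs. x \<in> UNIV - A}" by auto
  then show ?thesis
    using measure_pmf.prob_compl[of "{xs. \<forall>x\<in>set xs. x \<in> UNIV - A}" "replicate_pmf k p"]
      measure_pmf.prob_compl[of A p] by (simp add: prob_replicate_all del: replicate_pmf.simps Diff_iff)
qed

lemma one_minus_power_le: "0 \<le> q \<Longrightarrow> q \<le> 1 \<Longrightarrow> 1 - (1 - q) ^ k \<le> real k * (q::real)"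
  using Bernoulli_inequality[of "- q" k] by simp

text \<open>
  In a sample of independent copies, each entry is independent of the list of the others.
\<close>

lemma replicate_pmf_pick:
  "i < Suc k \<Longrightarrow> map_pmf (\<lambda>xs. (xs ! i, take i xs @ drop (Suc i) xs)) (replicate_pmf (Suc k) p)
     = pair_pmf p (replicate_pmf k p)"
proof (induction i arbitrary: k)
  case 0
  then show ?case by (simp add: pair_pmf_def map_bind_pmf)
next
  case (Suc i)
  then obtain k' where k: "k = Suc k'" by (cases k) auto
  let ?pick = "\<lambda>xs. (xs ! i, take i xs @ drop (Suc i) xs)"
  have "map_pmf (\<lambda>xs. (xs ! Suc i, take (Suc i) xs @ drop (Suc (Suc i)) xs)) (replicate_pmf (Suc k) p)
      = bind_pmf p (\<lambda>x. map_pmf (\<lambda>(t, r). (t, x # r)) (map_pmf ?pick (replicate_pmf k p)))"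
    by (simp add: map_bind_pmf map_pmf_comp bind_return_pmf' flip: map_pmf_def)
  also have "map_pmf ?pick (replicate_pmf k p) = pair_pmf p (replicate_pmf k' p)"
    unfolding k by (rule Suc.IH) (use Suc.prems k in auto)
  also have "bind_pmf p (\<lambda>x. map_pmf (\<lambda>(t, r). (t, x # r)) (pair_pmf p (replicate_pmf k' p)))
      = bind_pmf p (\<lambda>x. bind_pmf p (\<lambda>t. bind_pmf (replicate_pmf k' p) (\<lambda>r. return_pmf (t, x # r))))"
    by (simp add: pair_pmf_def map_bind_pmf)
  also have "\<dots> = bind_pmf p (\<lambda>t. bind_pmf p (\<lambda>x. bind_pmf (replicate_pmf k' p) (\<lambda>r. return_pmf (t, x # r))))"
    by (rule bind_commute_pmf)
  also have "\<dots> = pair_pmf p (replicate_pmf k p)"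
    unfolding k by (simp add: pair_pmf_def bind_assoc_pmf bind_return_pmf)
  finally show ?case .
qed

text \<open>
  The union bound over a distinguished position. Keeping the distinguished entry together with the rest
  of the list allows \<open>Q\<close> to involve a sum over the whole sample.
\<close>

lemma prob_replicate_pick_le:
  assumes Q: "\<And>xs. length xs = Suc k \<Longrightarrow> Q xs \<Longrightarrow> \<exists>i<Suc k. R (xs ! i) (take i xs @ drop (Suc i) xs)"
  shows "measure_pmf.prob (replicate_pmf (Suc k) p) {xs. Q xs}
     \<le> real (Suc k) * measure_pmf.prob (pair_pmf p (replicate_pmf k p)) {(t, r). R t r}"
proof -
  let ?r = "replicate_pmf (Suc k) p"
  let ?A = "\<lambda>i. (\<lambda>xs. (xs ! i, take i xs @ drop (Suc i) xs)) -` {(t, r). R t r}"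
  have "measure_pmf.prob ?r {xs. Q xs} = measure_pmf.prob ?r ({xs. Q xs} \<inter> set_pmf ?r)"
    by (rule measure_Int_set_pmf[symmetric])
  also have "\<dots> \<le> measure_pmf.prob ?r (\<Union>i\<in>{..<Suc k}. ?A i)"
    by (rule measure_pmf.finite_measure_mono) (auto simp: set_replicate_pmf simp del: replicate_pmf.simps dest!: Q)
  also have "\<dots> \<le> (\<Sum>i<Suc k. measure_pmf.prob ?r (?A i))"
    by (rule measure_pmf.finite_measure_subadditive_finite) auto
  also have "\<dots> = (\<Sum>i<Suc k. measure_pmf.prob (pair_pmf p (replicate_pmf k p)) {(t, r). R t r})"
  proof (rule sum.cong[OF refl])
    fix i assume "i \<in> {..<Suc k}"
    then have eq: "map_pmf (\<lambda>xs. (xs ! i, take i xs @ drop (Suc i) xs)) ?r = pair_pmf p (replicate_pmf k p)"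
      by (intro replicate_pmf_pick) auto
    show "measure_pmf.prob ?r (?A i) = measure_pmf.prob (pair_pmf p (replicate_pmf k p)) {(t, r). R t r}"
      unfolding eq[symmetric] measure_map_pmf ..
  qed
  finally show ?thesis by simp
qed

lemma sum_prob_fibres_le:
  assumes "finite J"
  shows "(\<Sum>j\<in>J. measure_pmf.prob q {b. B b \<and> g b = j}) \<le> measure_pmf.prob q {b. B b}"
proof -
  have "(\<Sum>j\<in>J. measure_pmf.prob q {b. B b \<and> g b = j}) = measure_pmf.prob q (\<Union>j\<in>J. {b. B b \<and> g b = j})"
    by (rule measure_pmf.finite_measure_finite_Union[symmetric])
       (use assms in \<open>auto simp: disjoint_family_on_def\<close>)
  also have "\<dots> \<le> measure_pmf.prob q {b. B b}" by (rule measure_pmf.finite_measure_mono) auto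
  finally show ?thesis .
qed

lemma prob_pair_add:
  fixes f :: "'a \<Rightarrow> nat" and g :: "'b \<Rightarrow> nat"
  shows "measure_pmf.prob (pair_pmf p q) {(a, b). A a \<and> B b \<and> f a + g b = x}
     = (\<Sum>j\<le>x. measure_pmf.prob p {a. A a \<and> f a = j} * measure_pmf.prob q {b. B b \<and> g b = x - j})"
proof -
  have "{(a, b). A a \<and> B b \<and> f a + g b = x} = (\<Union>j\<in>{..x}. {a. A a \<and> f a = j} \<times> {b. B b \<and> g b = x - j})"
    by auto
  then have "measure_pmf.prob (pair_pmf p q) {(a, b). A a \<and> B b \<and> f a + g b = x}
      = (\<Sum>j\<le>x. measure_pmf.prob (pair_pmf p q) ({a. A a \<and> f a = j} \<times> {b. B b \<and> g b = x - j}))"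
    by (simp only:) (rule measure_pmf.finite_measure_finite_Union, auto simp: disjoint_family_on_def)
  also have "\<dots> = (\<Sum>j\<le>x. measure_pmf.prob p {a. A a \<and> f a = j} * measure_pmf.prob q {b. B b \<and> g b = x - j})"
    by (intro sum.cong refl prob_product_pair)
  finally show ?thesis .
qed

text \<open>
  Finite plane trees as a datatype make induction and the decomposition at the root available; the
  vertex sets of the Ulam-Harris encoding are related to them further below.
\<close>

datatype ptree = Node (subtrees: "ptree list")

instance ptree :: countable by countable_datatype

fun ht :: "ptree \<Rightarrow> nat" where
  "ht (Node ts) = Max (insert 0 ((\<lambda>t. Suc (ht t)) ` set ts))"

fun cnt :: "nat set \<Rightarrow> ptree \<Rightarrow> nat" where
  "cnt \<Omega> (Node ts) = (if length ts \<in> \<Omega> then 1 else 0) + sum_list (map (cnt \<Omega>) ts)"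

fun heavy :: "nat \<Rightarrow> ptree \<Rightarrow> bool" where
  "heavy m (Node ts) \<longleftrightarrow> m \<le> length ts \<or> (\<exists>t\<in>set ts. heavy m t)"

fun weight :: "nat pmf \<Rightarrow> ptree \<Rightarrow> real" where
  "weight \<xi> (Node ts) = pmf \<xi> (length ts) * prod_list (map (weight \<xi>) ts)"

lemma Suc_le_ht_iff: "Suc h \<le> ht (Node ts) \<longleftrightarrow> (\<exists>t\<in>set ts. h \<le> ht t)"
  by (subst ht.simps, subst Max_ge_iff) auto

lemma ht_less_Suc_iff: "ht (Node ts) < Suc h \<longleftrightarrow> (\<forall>t\<in>set ts. ht t < h)"
  using Suc_le_ht_iff[of h ts] by (auto simp: not_le[symmetric])

lemma weight_nonneg: "weight \<xi> t \<ge> 0"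
  by (induction t) (auto intro!: mult_nonneg_nonneg prod_list_nonneg)

lemma cnt_le_cnt_UNIV: "cnt \<Omega> t \<le> cnt UNIV t"
  by (induction t) (auto intro!: add_mono sum_list_mono le_SucI)

text \<open>
  The tree cut off at height \<open>h\<close>, with \<open>None\<close> for trees that are too high. It is a probability
  distribution by construction, and so gives the total mass of \<open>weight\<close> in the limit.
\<close>

primrec truncated_tree :: "nat pmf \<Rightarrow> nat \<Rightarrow> ptree option pmf" where
  "truncated_tree \<xi> 0 = return_pmf None"
| "truncated_tree \<xi> (Suc h) = bind_pmf \<xi> (\<lambda>k.
     map_pmf (\<lambda>os. if None \<in> set os then None else Some (Node (map the os)))
       (replicate_pmf k (truncated_tree \<xi> h)))"

lemma pmf_truncated_tree:
  "pmf (truncated_tree \<xi> h) (Some t) = (if ht t < h then weight \<xi> t else 0)"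
proof (induction h arbitrary: t)
  case (Suc h)
  obtain ts where t: "t = Node ts" by (cases t)
  let ?F = "\<lambda>os. if None \<in> set os then None else Some (Node (map the os))"
  have F: "?F -` {Some (Node ts)} = {map Some ts}"
  proof (intro set_eqI iffI)
    fix os assume "os \<in> ?F -` {Some (Node ts)}"
    then have os: "None \<notin> set os" "map the os = ts" by (auto split: if_splits)
    then have "map Some ts = map (\<lambda>x. x) os" unfolding os(2)[symmetric] map_map
      by (intro map_cong refl) (auto, metis not_Some_eq option.sel)
    then show "os \<in> {map Some ts}" by simp
  qed (auto simp: comp_def)
  have pr: "prod_list (map (\<lambda>t. if ht t < h then weight \<xi> t else 0) ts)
      = (if \<forall>t\<in>set ts. ht t < h then prod_list (map (weight \<xi>) ts) else 0)" for ts
    by (induction ts) auto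
  have "pmf (map_pmf ?F (replicate_pmf k (truncated_tree \<xi> h))) (Some t)
     = (if k = length ts then (if ht t < Suc h then prod_list (map (weight \<xi>) ts) else 0) else 0)" for k
    unfolding pmf_map t F measure_pmf_single pmf_replicate_pmf
    by (auto simp: comp_def Suc pr ht_less_Suc_iff simp del: ht.simps)
  then show ?case by (simp add: pmf_bind expectation_single t del: ht.simps)
qed simp

text \<open>
  This is almost sure extinction: the mass that \<open>truncated_tree\<close> puts on \<open>None\<close> is at most \<open>\<mu> ^ h\<close>.
\<close>

lemma nn_integral_weight:
  assumes int: "integrable (measure_pmf \<xi>) real" and lt: "measure_pmf.expectation \<xi> real < 1"
  shows "(\<integral>\<^sup>+t. ennreal (weight \<xi> t) \<partial>count_space UNIV) = 1"
proof -
  let ?\<mu> = "measure_pmf.expectation \<xi> real"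
  have \<mu>: "?\<mu> \<ge> 0" by (rule integral_nonneg_AE) auto
  have None: "pmf (truncated_tree \<xi> h) None \<le> ?\<mu> ^ h" for h
  proof (induction h)
    case (Suc h)
    let ?q = "pmf (truncated_tree \<xi> h) None"
    have "pmf (truncated_tree \<xi> (Suc h)) None = measure_pmf.expectation \<xi> (\<lambda>k. 1 - (1 - ?q) ^ k)"
    proof -
      have "pmf (map_pmf (\<lambda>os. if None \<in> set os then None else Some (Node (map the os)))
          (replicate_pmf k (truncated_tree \<xi> h))) None
        = measure_pmf.prob (replicate_pmf k (truncated_tree \<xi> h)) {os. \<exists>x\<in>set os. x \<in> {None}}" for k
        unfolding pmf_map by (rule arg_cong[where f = "measure_pmf.prob _"]) (auto split: if_splits)
      then show ?thesis
        unfolding prob_replicate_ex measure_pmf_single by (simp add: pmf_bind)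
    qed
    also have "\<dots> \<le> measure_pmf.expectation \<xi> (\<lambda>k. real k * ?q)"
      by (intro integral_mono integrable_pmf_bounded[where B = 1] integrable_mult_left int one_minus_power_le)
         (auto simp: pmf_le_1 power_le_one)
    also have "\<dots> \<le> ?\<mu> * ?\<mu> ^ h" using Suc \<mu> by (simp add: mult_left_mono)
    finally show ?case by simp
  qed simp
  let ?f = "\<lambda>h t. ennreal (if ht t < h then weight \<xi> t else 0)"
  have mass: "(\<integral>\<^sup>+t. ?f h t \<partial>count_space UNIV) = ennreal (1 - pmf (truncated_tree \<xi> h) None)" for h
  proof -
    have "(\<integral>\<^sup>+t. ?f h t \<partial>count_space UNIV) = (\<integral>\<^sup>+t. ennreal (pmf (truncated_tree \<xi> h) (Some t)) \<partial>count_space UNIV)"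
      by (simp add: pmf_truncated_tree)
    also have "\<dots> = (\<integral>\<^sup>+x. ennreal (pmf (truncated_tree \<xi> h) x) \<partial>count_space (range Some))"
      by (rule nn_integral_bij_count_space) (auto simp: bij_betw_def)
    also have "\<dots> = emeasure (truncated_tree \<xi> h) (range Some)" by (rule nn_integral_pmf)
    also have "range Some = UNIV - {None :: ptree option}" by (auto simp: notin_range_Some)
    also have "emeasure (truncated_tree \<xi> h) \<dots> = ennreal (1 - pmf (truncated_tree \<xi> h) None)"
      using measure_pmf.prob_compl[of "{None}" "truncated_tree \<xi> h"]
      by (simp add: measure_pmf.emeasure_eq_measure measure_pmf_single)
    finally show ?thesis .
  qed
  have "(\<lambda>h. \<integral>\<^sup>+t. ?f h t \<partial>count_space UNIV) \<longlonglongrightarrow> (\<integral>\<^sup>+t. ennreal (weight \<xi> t) \<partial>count_space UNIV)"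
  proof (rule nn_integral_LIMSEQ)
    show "incseq ?f" by (auto simp: incseq_def le_fun_def weight_nonneg)
    show "(\<lambda>h. ?f h t) \<longlonglongrightarrow> ennreal (weight \<xi> t)" for t
      by (rule tendsto_eventually, rule eventually_mono[OF eventually_gt_at_top[of "ht t"]]) simp
  qed auto
  moreover have "(\<lambda>h. ennreal (1 - pmf (truncated_tree \<xi> h) None)) \<longlonglongrightarrow> ennreal (1 - 0)"
  proof (intro tendsto_ennrealI tendsto_diff tendsto_const)
    show "(\<lambda>h. pmf (truncated_tree \<xi> h) None) \<longlonglongrightarrow> 0"
      by (rule tendsto_sandwich[OF _ _ tendsto_const LIMSEQ_realpow_zero[OF \<mu> lt]])
         (auto intro: always_eventually None)
  qed
  ultimately show ?thesis unfolding mass by (simp add: LIMSEQ_unique)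
qed

definition gw_tree :: "nat pmf \<Rightarrow> ptree pmf" where "gw_tree \<xi> = embed_pmf (weight \<xi>)"

locale subcritical_gw =
  fixes \<xi> :: "nat pmf" and \<mu> :: real
  assumes integrable: "integrable (measure_pmf \<xi>) real"
    and mean: "measure_pmf.expectation \<xi> real = \<mu>" and mean_less: "\<mu> < 1"
begin

abbreviation "T \<equiv> gw_tree \<xi>"

abbreviation P :: "(ptree \<Rightarrow> bool) \<Rightarrow> real" where "P Q \<equiv> measure_pmf.prob T {t. Q t}"

lemma mean_nonneg: "\<mu> \<ge> 0"
  unfolding mean[symmetric] by (rule integral_nonneg_AE) auto

lemma pmf_gw_tree: "pmf T t = weight \<xi> t"
  unfolding gw_tree_def
  by (rule pmf_embed_pmf) (use weight_nonneg nn_integral_weight[OF integrable] mean mean_less in auto)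

text \<open>
  The branching property, in the form in which it is used throughout.
\<close>

lemma gw_tree_rec: "T = bind_pmf \<xi> (\<lambda>k. map_pmf Node (replicate_pmf k T))"
proof (rule pmf_eqI)
  fix t
  obtain ts where t: "t = Node ts" by (cases t)
  have "inj Node" by (simp add: inj_def)
  then have "pmf (map_pmf Node (replicate_pmf k T)) t
      = (if k = length ts then prod_list (map (weight \<xi>) ts) else 0)" for k
    unfolding t by (subst pmf_map_inj') (auto simp: pmf_replicate_pmf pmf_gw_tree[abs_def])
  then show "pmf T t = pmf (bind_pmf \<xi> (\<lambda>k. map_pmf Node (replicate_pmf k T))) t"
    by (simp add: pmf_bind expectation_single t pmf_gw_tree)
qed

lemma prob_tree:
  "P Q = measure_pmf.expectation \<xi> (\<lambda>k. measure_pmf.prob (replicate_pmf k T) {ts. Q (Node ts)})"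
  by (subst gw_tree_rec) (simp add: prob_bind_pmf vimage_def)

lemma nn_integral_tree:
  "(\<integral>\<^sup>+t. F t \<partial>T) = (\<integral>\<^sup>+k. (\<integral>\<^sup>+ts. F (Node ts) \<partial>replicate_pmf k T) \<partial>\<xi>)"
  by (subst gw_tree_rec) simp

lemma expectation_mono:
  assumes "\<And>k. f k \<le> g k" "\<And>k. \<bar>f k\<bar> \<le> (B::real)" "integrable (measure_pmf \<xi>) g"
  shows "measure_pmf.expectation \<xi> f \<le> measure_pmf.expectation \<xi> g"
  by (intro integral_mono integrable_pmf_bounded[OF assms(2)] assms)

lemma expectation_linear: "measure_pmf.expectation \<xi> (\<lambda>k. real k * c) = \<mu> * c"
  using mean by simp

lemma integrable_linear: "integrable (measure_pmf \<xi>) (\<lambda>k. real k * c)"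
  using integrable by simp

end

section \<open>From random offspring labels to the law on finite trees\<close>

text \<open>
  Extended by 0 outside the tree, so that \<open>tree_of (deg t)\<close> is the set of vertices of \<open>t\<close>.
\<close>

fun deg :: "ptree \<Rightarrow> nat list \<Rightarrow> nat" where
  "deg (Node ts) [] = length ts"
| "deg (Node ts) (i # u) = (if i < length ts then deg (ts ! i) u else 0)"

lemma Nil_in_tree_of: "[] \<in> tree_of c"
  by (rule tree_of.root)

lemma snoc_in_tree_of_iff: "u @ [j] \<in> tree_of c \<longleftrightarrow> u \<in> tree_of c \<and> j < c u"
  by (auto elim: tree_of.cases intro: tree_of.child)

lemma Cons_in_tree_of_iff: "i # u \<in> tree_of c \<longleftrightarrow> i < c [] \<and> u \<in> tree_of (\<lambda>v. c (i # v))"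
proof (induction u rule: rev_induct)
  case Nil
  show ?case using snoc_in_tree_of_iff[of "[]" i c] by (simp add: Nil_in_tree_of)
next
  case (snoc j u)
  then show ?case using snoc_in_tree_of_iff[of "i # u" j c] by (auto simp: snoc_in_tree_of_iff)
qed

lemma tree_of_unfold: "tree_of c = insert [] (\<Union>i<c []. (#) i ` tree_of (\<lambda>v. c (i # v)))"
proof (rule set_eqI)
  fix u show "u \<in> tree_of c \<longleftrightarrow> u \<in> insert [] (\<Union>i<c []. (#) i ` tree_of (\<lambda>v. c (i # v)))"
    by (cases u) (auto simp: Nil_in_tree_of Cons_in_tree_of_iff)
qed

lemma tree_of_deg_Node: "tree_of (deg (Node ts)) = insert [] (\<Union>i<length ts. (#) i ` tree_of (deg (ts ! i)))"
  by (subst tree_of_unfold) auto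

lemma tree_of_cong:
  assumes "\<And>u. u \<in> tree_of c \<Longrightarrow> c' u = c u"
  shows "tree_of c' = tree_of c"
proof (intro equalityI subsetI)
  fix u assume "u \<in> tree_of c'"
  then show "u \<in> tree_of c" by induction (use assms in \<open>auto intro: tree_of.intros\<close>)
next
  fix u assume "u \<in> tree_of c"
  then show "u \<in> tree_of c'" by induction (use assms in \<open>auto intro: tree_of.intros\<close>)
qed

lemma outdegree_tree_of: "u \<in> tree_of c \<Longrightarrow> outdegree (tree_of c) u = c u"
proof -
  assume "u \<in> tree_of c"
  then have "{i. u @ [i] \<in> tree_of c} = {..<c u}" by (auto simp: snoc_in_tree_of_iff)
  then show ?thesis by (simp add: outdegree_def)
qed

lemma finite_tree_of_deg: "finite (tree_of (deg t))"
  by (induction t) (auto simp: tree_of_deg_Node)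

lemma finite_tree_of_has_shape:
  assumes "finite (tree_of c)"
  shows "\<exists>t. \<forall>u\<in>tree_of (deg t). c u = deg t u"
  using assms
proof (induction "card (tree_of c)" arbitrary: c rule: less_induct)
  case less
  have "\<exists>t. \<forall>u\<in>tree_of (deg t). c (i # u) = deg t u" if i: "i < c []" for i
  proof -
    have sub: "(#) i ` tree_of (\<lambda>v. c (i # v)) \<subset> tree_of c"
      using i by (auto simp: Cons_in_tree_of_iff psubset_eq Nil_in_tree_of intro: Nil_in_tree_of)
    have "card ((#) i ` tree_of (\<lambda>v. c (i # v))) < card (tree_of c)"
      by (rule psubset_card_mono[OF less.prems sub])
    moreover have "finite (tree_of (\<lambda>v. c (i # v)))"
      using finite_subset[OF psubset_imp_subset[OF sub] less.prems] by (rule finite_imageD) simp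
    ultimately show ?thesis using less.hyps[of "\<lambda>v. c (i # v)"] by (simp add: card_image)
  qed
  then obtain t where t: "\<And>i u. i < c [] \<Longrightarrow> u \<in> tree_of (deg (t i)) \<Longrightarrow> c (i # u) = deg (t i) u"
    by metis
  show ?case
    by (rule exI[of _ "Node (map t [0..<c []])"]) (auto simp: tree_of_deg_Node t)
qed

lemma deg_eq_imp_eq:
  "(\<And>u. u \<in> tree_of (deg t) \<Longrightarrow> deg t' u = deg t u) \<Longrightarrow> t = t'"
proof (induction t arbitrary: t')
  case (Node ts)
  obtain ts' where t': "t' = Node ts'" by (cases t')
  have len: "length ts' = length ts" using Node.prems[of "[]"] by (simp add: t' Nil_in_tree_of)
  have "ts ! i = ts' ! i" if i: "i < length ts" for i
  proof (rule Node.IH)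
    show "ts ! i \<in> set ts" using i by simp
    fix u assume "u \<in> tree_of (deg (ts ! i))"
    then have "i # u \<in> tree_of (deg (Node ts))" using i by (auto simp: tree_of_deg_Node)
    from Node.prems[OF this] show "deg (ts' ! i) u = deg (ts ! i) u" using i len by (simp add: t')
  qed
  then show ?case using len by (simp add: t' list_eq_iff_nth_eq)
qed

lemma card_outdegree_tree_of_deg: "card {u \<in> tree_of (deg t). deg t u \<in> \<Omega>} = cnt \<Omega> t"
proof (induction t)
  case (Node ts)
  let ?S = "\<lambda>i. (#) i ` {u \<in> tree_of (deg (ts ! i)). deg (ts ! i) u \<in> \<Omega>}"
  have eq: "{u \<in> tree_of (deg (Node ts)). deg (Node ts) u \<in> \<Omega>}
      = (if length ts \<in> \<Omega> then {[]} else {}) \<union> (\<Union>i<length ts. ?S i)"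
    by (auto simp: tree_of_deg_Node)
  have fin: "finite (?S i)" for i using finite_tree_of_deg by auto
  have "card (\<Union>i<length ts. ?S i) = (\<Sum>i<length ts. card (?S i))"
    by (rule card_UN_disjoint) (use fin in auto)
  also have "\<dots> = (\<Sum>i<length ts. cnt \<Omega> (ts ! i))"
    by (intro sum.cong refl) (simp add: card_image Node)
  also have "\<dots> = sum_list (map (cnt \<Omega>) ts)"
    by (simp add: sum.list_conv_set_nth atLeast0LessThan)
  finally show ?case unfolding eq
    by (subst card_Un_disjoint) (use fin in auto)
qed

lemma le_ht_iff: "h \<le> ht t \<longleftrightarrow> (\<exists>u\<in>tree_of (deg t). h \<le> length u)"
proof (induction t arbitrary: h)
  case (Node ts)
  show ?case
  proof (cases h)
    case 0
    then show ?thesis using Nil_in_tree_of by auto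
  next
    case (Suc h')
    have "(\<exists>t\<in>set ts. h' \<le> ht t) \<longleftrightarrow> (\<exists>i<length ts. \<exists>u\<in>tree_of (deg (ts ! i)). h' \<le> length u)"
      using Node by (auto simp: in_set_conv_nth) (metis nth_mem)+
    then show ?thesis unfolding Suc Suc_le_ht_iff by (auto simp: tree_of_deg_Node)
  qed
qed

lemma tree_height_tree_of_deg: "tree_height (tree_of (deg t)) = ht t"
proof -
  have "h \<le> tree_height (tree_of (deg t)) \<longleftrightarrow> h \<le> ht t" for h
    unfolding le_ht_iff tree_height_def
    by (subst Max_ge_iff) (use finite_tree_of_deg Nil_in_tree_of in auto)
  then show ?thesis by (metis order_refl order_antisym)
qed

text \<open>
  The weight as a product over vertices is the measure of a cylinder in the space of labels.
\<close>

lemma weight_eq_prod: "weight \<xi> t = (\<Prod>u\<in>tree_of (deg t). pmf \<xi> (deg t u))"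
proof (induction t)
  case (Node ts)
  let ?S = "\<lambda>i. (#) i ` tree_of (deg (ts ! i))"
  have fin: "finite (?S i)" for i using finite_tree_of_deg by auto
  have "(\<Prod>u\<in>tree_of (deg (Node ts)). pmf \<xi> (deg (Node ts) u))
      = pmf \<xi> (length ts) * (\<Prod>u\<in>(\<Union>i<length ts. ?S i). pmf \<xi> (deg (Node ts) u))"
    unfolding tree_of_deg_Node by (subst prod.insert) (use fin in auto)
  also have "(\<Prod>u\<in>(\<Union>i<length ts. ?S i). pmf \<xi> (deg (Node ts) u))
     = (\<Prod>i<length ts. \<Prod>u\<in>?S i. pmf \<xi> (deg (Node ts) u))"
    by (rule prod.UNION_disjoint) (use fin in auto)
  also have "\<dots> = (\<Prod>i<length ts. weight \<xi> (ts ! i))"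
    by (intro prod.cong refl) (simp add: Node prod.reindex)
  also have "\<dots> = prod_list (map (weight \<xi>) ts)"
    by (simp add: prod.list_conv_set_nth atLeast0LessThan)
  finally show ?case by simp
qed

text \<open>
  The value on labels that generate an infinite tree is arbitrary.
\<close>

definition shape :: "(nat list \<Rightarrow> nat) \<Rightarrow> ptree" where
  "shape c = (if finite (tree_of c) then SOME t. \<forall>u\<in>tree_of (deg t). c u = deg t u else Node [])"

lemma shape_deg:
  assumes "finite (tree_of c)"
  shows "\<forall>u\<in>tree_of (deg (shape c)). c u = deg (shape c) u"
  using someI_ex[OF finite_tree_of_has_shape[OF assms]] assms by (simp add: shape_def)

lemma tree_of_shape: "finite (tree_of c) \<Longrightarrow> tree_of c = tree_of (deg (shape c))"
  using shape_deg by (intro tree_of_cong) auto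

text \<open>
  Having a given finite tree depends on finitely many labels only.
\<close>

lemma shape_eq_iff:
  "finite (tree_of c) \<and> shape c = t \<longleftrightarrow> (\<forall>u\<in>tree_of (deg t). c u = deg t u)"
proof
  assume *: "\<forall>u\<in>tree_of (deg t). c u = deg t u"
  then have "tree_of c = tree_of (deg t)" by (intro tree_of_cong) auto
  then have fin: "finite (tree_of c)" using finite_tree_of_deg by simp
  have "t = shape c"
    using * shape_deg[OF fin] tree_of_shape[OF fin] \<open>tree_of c = tree_of (deg t)\<close>
    by (intro deg_eq_imp_eq) auto
  then show "finite (tree_of c) \<and> shape c = t" using fin by simp
qed (use shape_deg in auto)

lemma outdegree_event_iff_cnt_shape:
  assumes "finite (tree_of c)"
  shows "c \<in> outdegree_event \<Omega> n \<longleftrightarrow> cnt \<Omega> (shape c) = n"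
proof -
  have "{u \<in> tree_of c. outdegree (tree_of c) u \<in> \<Omega>} = {u \<in> tree_of (deg (shape c)). deg (shape c) u \<in> \<Omega>}"
    using shape_deg[OF assms] tree_of_shape[OF assms] by (auto simp: outdegree_tree_of)
  then show ?thesis
    by (simp add: outdegree_event_def card_outdegree_tree_of_deg finite_tree_of_deg)
qed

lemma tree_height_shape: "finite (tree_of c) \<Longrightarrow> tree_height (tree_of c) = ht (shape c)"
  by (metis tree_of_shape tree_height_tree_of_deg)

lemma space_GW_space: "space (GW_space \<xi>) = UNIV"
  by (simp add: GW_space_def space_PiM PiE_UNIV_domain)

lemma prob_space_GW_space: "prob_space (GW_space \<xi>)"
  unfolding GW_space_def by (rule prob_space_PiM) (rule measure_pmf.prob_space_axioms)

lemma measurable_GW_component[measurable]: "(\<lambda>c. c u) \<in> measurable (GW_space \<xi>) (count_space UNIV)"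
proof -
  have "(\<lambda>c. c u) \<in> measurable (GW_space \<xi>) (measure_pmf \<xi>)"
    unfolding GW_space_def by (rule measurable_component_singleton) simp
  then show ?thesis by (simp cong: measurable_cong_sets)
qed

lemma emeasure_shape:
  "{c. \<forall>u\<in>tree_of (deg t). c u = deg t u} \<in> sets (GW_space \<xi>)"
  "emeasure (GW_space \<xi>) {c. \<forall>u\<in>tree_of (deg t). c u = deg t u} = ennreal (weight \<xi> t)"
proof -
  interpret product_prob_space "\<lambda>_. measure_pmf \<xi>" UNIV
    by unfold_locales
  have "Measurable.pred (GW_space \<xi>) (\<lambda>c. \<forall>u\<in>tree_of (deg t). c u = deg t u)"
    by (rule pred_intros_finite[OF finite_tree_of_deg]) measurable
  then show "{c. \<forall>u\<in>tree_of (deg t). c u = deg t u} \<in> sets (GW_space \<xi>)"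
    by (simp add: pred_def space_GW_space)
  have "emeasure (GW_space \<xi>) {c. \<forall>u\<in>tree_of (deg t). c u = deg t u}
      = emeasure (Pi\<^sub>M UNIV (\<lambda>_. measure_pmf \<xi>)) {c \<in> space (Pi\<^sub>M UNIV (\<lambda>_. measure_pmf \<xi>)). \<forall>u\<in>tree_of (deg t). c u \<in> {deg t u}}"
    using space_GW_space[of \<xi>] by (simp add: GW_space_def)
  also have "\<dots> = (\<Prod>u\<in>tree_of (deg t). emeasure (measure_pmf \<xi>) {deg t u})"
    by (rule emeasure_PiM_Collect) (auto simp: finite_tree_of_deg)
  also have "\<dots> = ennreal (weight \<xi> t)"
    by (simp add: emeasure_pmf_single weight_eq_prod prod_ennreal)
  finally show "emeasure (GW_space \<xi>) {c. \<forall>u\<in>tree_of (deg t). c u = deg t u} = ennreal (weight \<xi> t)" .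
qed

lemma measurable_mem_tree_of[measurable]: "Measurable.pred (GW_space \<xi>) (\<lambda>c. u \<in> tree_of c)"
proof (induction u rule: rev_induct)
  case (snoc j u)
  note [measurable] = snoc
  show ?case unfolding snoc_in_tree_of_iff by measurable
qed (simp add: Nil_in_tree_of)

lemma sets_outdegree_event[measurable]: "outdegree_event \<Omega> n \<in> sets (GW_space \<xi>)"
proof -
  let ?S = "\<lambda>c. {u \<in> tree_of c. outdegree (tree_of c) u \<in> \<Omega>}"
  have S: "?S c = {u. u \<in> tree_of c \<and> c u \<in> \<Omega>}" for c by (auto simp: outdegree_tree_of)
  have "{c. ?S c = F} \<in> sets (GW_space \<xi>)" for F
  proof -
    have "Measurable.pred (GW_space \<xi>) (\<lambda>c. \<forall>u. (u \<in> tree_of c \<and> c u \<in> \<Omega>) = (u \<in> F))"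
      by measurable
    then show ?thesis unfolding S by (simp add: pred_def space_GW_space set_eq_iff)
  qed
  moreover have "outdegree_event \<Omega> n = (\<Union>F\<in>{F. finite F \<and> card F = n}. {c. ?S c = F})"
    by (auto simp: outdegree_event_def)
  moreover have "countable {F :: nat list set. finite F \<and> card F = n}"
    by (rule countable_subset[OF _ countable_Collect_finite]) auto
  ultimately show ?thesis by (simp only:) (rule sets.countable_UN'', auto)
qed

lemma take_in_tree_of: "u \<in> tree_of c \<Longrightarrow> take l u \<in> tree_of c"
proof (induction u rule: rev_induct)
  case (snoc j u)
  then show ?case by (cases "l \<le> length u") (auto simp: snoc_in_tree_of_iff)
qed simp

text \<open>
  Measurability has to hold on infinite trees too, where \<open>Max\<close> has no meaning. The set of
  levels is an initial segment of the naturals, so \<open>tree_height\<close> is constant unless some level is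
  missing.
\<close>

lemma measurable_tree_height[measurable]:
  "(\<lambda>c. tree_height (tree_of c)) \<in> measurable (GW_space \<xi>) (count_space UNIV)"
proof -
  let ?R = "\<lambda>l c. \<exists>u. u \<in> tree_of c \<and> length u = l"
  have eq: "tree_height (tree_of c) = (if \<forall>l. ?R l c then Max UNIV else (LEAST l. \<not> ?R l c) - 1)" for c
  proof (cases "\<forall>l. ?R l c")
    case True
    then have "length ` tree_of c = UNIV" by (auto simp: image_iff) metis
    then show ?thesis using True by (simp add: tree_height_def)
  next
    case False
    define K where "K = (LEAST l. \<not> ?R l c)"
    have K: "\<not> ?R K c" unfolding K_def by (rule LeastI_ex) (use False in blast)
    have le: "?R l c" if "l < K" for l using not_less_Least[of l "\<lambda>l. \<not> ?R l c"] that K_def by blast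
    have K0: "K > 0" using K Nil_in_tree_of[of c] by (cases K) auto
    have "length ` tree_of c = {..K - 1}"
    proof (intro equalityI subsetI)
      fix l assume "l \<in> length ` tree_of c"
      then obtain u where u: "u \<in> tree_of c" "l = length u" by auto
      show "l \<in> {..K - 1}"
      proof (rule ccontr)
        assume "l \<notin> {..K - 1}"
        then have "length (take K u) = K" using u K0 by auto
        then show False using K take_in_tree_of[OF u(1), of K] by blast
      qed
    next
      fix l assume "l \<in> {..K - 1}"
      then have "l < K" using K0 by auto
      then show "l \<in> length ` tree_of c" using le by auto
    qed
    moreover have "Max {..K - 1} = K - 1" by (rule Max_eqI) auto
    ultimately show ?thesis unfolding if_not_P[OF False] by (simp add: tree_height_def K_def)
  qed
  have R: "Measurable.pred (GW_space \<xi>) (?R l)" for l by measurable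
  have all: "Measurable.pred (GW_space \<xi>) (\<lambda>c. \<forall>l. ?R l c)" by (intro pred_intros_countable R)
  have "(\<lambda>c. LEAST l. \<not> ?R l c) \<in> measurable (GW_space \<xi>) (count_space UNIV)"
    by (intro measurable_Least pred_intros_logic R)
  then have "(\<lambda>c. (LEAST l. \<not> ?R l c) - 1) \<in> measurable (GW_space \<xi>) (count_space UNIV)"
    by (rule measurable_compose) simp
  then show ?thesis unfolding eq using all by (intro measurable_If) (auto simp: pred_def)
qed

context subcritical_gw
begin

text \<open>
  The cylinders belonging to the different finite trees are disjoint and their measures sum to 1.
\<close>

lemma AE_finite_tree_of: "AE c in GW_space \<xi>. finite (tree_of c)"
proof -
  interpret prob_space "GW_space \<xi>" by (rule prob_space_GW_space)
  let ?A = "\<lambda>t. {c. \<forall>u\<in>tree_of (deg t). c u = deg t u}"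
  have A: "?A t = {c. finite (tree_of c) \<and> shape c = t}" for t using shape_eq_iff by auto
  have un: "(\<Union>t. ?A t) = {c. finite (tree_of c)}" unfolding A by auto
  have "emeasure (GW_space \<xi>) (\<Union>t. ?A t) = (\<integral>\<^sup>+t. emeasure (GW_space \<xi>) (?A t) \<partial>count_space UNIV)"
  proof (rule emeasure_UN_countable)
    show "disjoint_family ?A" unfolding A by (auto simp: disjoint_family_on_def)
  qed (auto simp: emeasure_shape)
  also have "\<dots> = 1" using nn_integral_weight[OF integrable] mean mean_less by (simp add: emeasure_shape)
  finally have one: "emeasure (GW_space \<xi>) {c. finite (tree_of c)} = 1" unfolding un .
  have "prob {c. finite (tree_of c)} = 1" using one by (simp add: emeasure_eq_measure)
  from AE_prob_1[OF this] show ?thesis by simp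
qed

lemma measurable_shape[measurable]: "shape \<in> measurable (GW_space \<xi>) (count_space UNIV)"
proof -
  have fin: "Measurable.pred (GW_space \<xi>) (\<lambda>c. finite (tree_of c))"
  proof -
    have "(\<lambda>c. finite (tree_of c)) = (\<lambda>c. \<exists>t. \<forall>u\<in>tree_of (deg t). c u = deg t u)"
      using shape_eq_iff by (metis (no_types, lifting))
    moreover have "Measurable.pred (GW_space \<xi>) (\<lambda>c. \<exists>t. \<forall>u\<in>tree_of (deg t). c u = deg t u)"
      by (intro pred_intros_countable) (use emeasure_shape(1) in \<open>simp add: pred_def space_GW_space\<close>)
    ultimately show ?thesis by simp
  qed
  have "Measurable.pred (GW_space \<xi>) (\<lambda>c. shape c = t)" for t
  proof -
    have "(\<lambda>c. shape c = t) = (\<lambda>c. (\<forall>u\<in>tree_of (deg t). c u = deg t u) \<or> (t = Node [] \<and> \<not> finite (tree_of c)))"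
    proof (rule ext)
      fix c
      show "(shape c = t) = ((\<forall>u\<in>tree_of (deg t). c u = deg t u) \<or> (t = Node [] \<and> \<not> finite (tree_of c)))"
      proof (cases "finite (tree_of c)")
        case True
        then show ?thesis using shape_eq_iff[of c t] by simp
      next
        case False
        then show ?thesis using shape_eq_iff[of c t] by (auto simp: shape_def[of c])
      qed
    qed
    moreover have "Measurable.pred (GW_space \<xi>) (\<lambda>c. (\<forall>u\<in>tree_of (deg t). c u = deg t u))"
      using emeasure_shape(1) by (simp add: pred_def space_GW_space)
    ultimately show ?thesis using fin by simp
  qed
  then have "{c. shape c = t} \<in> sets (GW_space \<xi>)" for t by (simp add: pred_def space_GW_space)
  then show ?thesis
    by (simp add: measurable_count_space_eq2_countable space_GW_space vimage_def)
qed

lemma distr_shape: "distr (GW_space \<xi>) (count_space UNIV) shape = measure_pmf T"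
proof (rule measure_eqI_countable[where A = UNIV])
  fix t
  have "emeasure (distr (GW_space \<xi>) (count_space UNIV) shape) {t} = emeasure (GW_space \<xi>) {c. shape c = t}"
    by (subst emeasure_distr) (auto simp: space_GW_space vimage_def)
  also have "\<dots> = emeasure (GW_space \<xi>) {c. \<forall>u\<in>tree_of (deg t). c u = deg t u}"
  proof (rule emeasure_eq_AE)
    show "AE c in GW_space \<xi>. c \<in> {c. shape c = t} \<longleftrightarrow> c \<in> {c. \<forall>u\<in>tree_of (deg t). c u = deg t u}"
      using AE_finite_tree_of by eventually_elim (use shape_eq_iff in blast)
    have "shape -` {t} \<inter> space (GW_space \<xi>) \<in> sets (GW_space \<xi>)"
      by (rule measurable_sets[OF measurable_shape]) simp
    then show "{c. shape c = t} \<in> sets (GW_space \<xi>)" by (simp add: vimage_def space_GW_space)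
  qed (rule emeasure_shape)
  also have "\<dots> = emeasure (measure_pmf T) {t}"
    by (simp add: emeasure_shape emeasure_pmf_single pmf_gw_tree)
  finally show "emeasure (distr (GW_space \<xi>) (count_space UNIV) shape) {t} = emeasure (measure_pmf T) {t}" .
qed auto

text \<open>
  The passage from random labels to the joint law of \<open>ht\<close> and \<open>cnt\<close> under \<open>gw_tree\<close>.
\<close>

lemma conditioned_integral:
  fixes F :: "nat \<Rightarrow> real"
  assumes pos: "P (\<lambda>t. cnt \<Omega> t = n) > 0"
  shows "(\<integral>c. F (tree_height (tree_of c)) \<partial>conditioned_GW_space \<xi> \<Omega> n)
     = measure_pmf.expectation T (\<lambda>t. if cnt \<Omega> t = n then F (ht t) else 0) / P (\<lambda>t. cnt \<Omega> t = n)"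
proof -
  interpret prob_space "GW_space \<xi>" by (rule prob_space_GW_space)
  let ?M = "GW_space \<xi>" and ?A = "outdegree_event \<Omega> n"
  have "measure ?M ?A = measure ?M (shape -` {t. cnt \<Omega> t = n} \<inter> space ?M)"
  proof (rule finite_measure_eq_AE)
    show "AE c in ?M. c \<in> ?A \<longleftrightarrow> c \<in> shape -` {t. cnt \<Omega> t = n} \<inter> space ?M"
      using AE_finite_tree_of by eventually_elim (simp add: outdegree_event_iff_cnt_shape space_GW_space)
    show "shape -` {t. cnt \<Omega> t = n} \<inter> space ?M \<in> sets ?M"
      by (rule measurable_sets[OF measurable_shape]) simp
  qed simp
  also have "\<dots> = P (\<lambda>t. cnt \<Omega> t = n)"
    unfolding distr_shape[symmetric] by (subst measure_distr) auto
  finally have mA: "measure ?M ?A = P (\<lambda>t. cnt \<Omega> t = n)" .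
  have d: "conditioned_GW_space \<xi> \<Omega> n = density ?M (\<lambda>c. ennreal (indicator ?A c / measure ?M ?A))"
    unfolding conditioned_GW_space_def uniform_measure_def emeasure_eq_measure
    using pos mA by (simp add: ennreal_indicator[symmetric] divide_ennreal del: ennreal_indicator)
  have "(\<integral>c. F (tree_height (tree_of c)) \<partial>conditioned_GW_space \<xi> \<Omega> n)
     = (\<integral>c. (indicator ?A c / measure ?M ?A) *\<^sub>R F (tree_height (tree_of c)) \<partial>?M)"
    unfolding d by (rule integral_density) auto
  also have "\<dots> = (\<integral>c. (if cnt \<Omega> (shape c) = n then F (ht (shape c)) else 0) / measure ?M ?A \<partial>?M)"
  proof (rule integral_cong_AE)
    show "AE c in ?M. (indicator ?A c / measure ?M ?A) *\<^sub>R F (tree_height (tree_of c))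
        = (if cnt \<Omega> (shape c) = n then F (ht (shape c)) else 0) / measure ?M ?A"
      using AE_finite_tree_of
      by eventually_elim (auto simp: outdegree_event_iff_cnt_shape tree_height_shape indicator_def)
  qed measurable
  also have "\<dots> = (\<integral>t. (if cnt \<Omega> t = n then F (ht t) else 0) / measure ?M ?A \<partial>distr ?M (count_space UNIV) shape)"
    by (rule integral_distr[symmetric]) auto
  finally show ?thesis unfolding distr_shape mA by simp
qed

end

section \<open>Heights, and trees without a vertex of large outdegree\<close>

lemma prob_replicate_mono:
  assumes "\<And>ts. length ts = k \<Longrightarrow> A ts \<Longrightarrow> B ts"
  shows "measure_pmf.prob (replicate_pmf k p) {ts. A ts} \<le> measure_pmf.prob (replicate_pmf k p) {ts. B ts}"
  by (rule measure_pmf.finite_measure_mono_AE) (auto simp: AE_measure_pmf_iff set_replicate_pmf assms)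

lemma prob_replicate_cong:
  assumes "\<And>ts. length ts = k \<Longrightarrow> A ts \<longleftrightarrow> B ts"
  shows "measure_pmf.prob (replicate_pmf k p) {ts. A ts} = measure_pmf.prob (replicate_pmf k p) {ts. B ts}"
  by (intro antisym prob_replicate_mono) (use assms in auto)

lemma prob_Un_le: "measure_pmf.prob p {x. A x \<or> B x} \<le> measure_pmf.prob p {x. A x} + measure_pmf.prob p {x. B x}"
proof -
  have "{x. A x \<or> B x} = {x. A x} \<union> {x. B x}" by auto
  then show ?thesis by (simp add: measure_Un_le)
qed

lemma prob_mono: "(\<And>x. A x \<Longrightarrow> B x) \<Longrightarrow> measure_pmf.prob p {x. A x} \<le> measure_pmf.prob p {x. B x}"
  by (rule measure_pmf.finite_measure_mono) auto

lemma one_minus_power_ge: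
  fixes q :: real
  assumes "0 \<le> q" "q \<le> 1"
  shows "1 - (1 - q) ^ k \<ge> real k * q - (real k)\<^sup>2 * q\<^sup>2"
proof (induction k)
  case (Suc k)
  have "(1 - q) ^ Suc k \<le> (1 - q) * (1 - real k * q + (real k)\<^sup>2 * q\<^sup>2)"
    using Suc assms by (simp add: mult_left_mono)
  also have "\<dots> = 1 - real (Suc k) * q + ((real k)\<^sup>2 + real k) * q\<^sup>2 - (real k)\<^sup>2 * q ^ 3"
    by (simp add: algebra_simps power2_eq_square power3_eq_cube)
  also have "\<dots> \<le> 1 - real (Suc k) * q + (real (Suc k))\<^sup>2 * q\<^sup>2 - 0"
    using assms by (intro diff_mono add_left_mono mult_right_mono) (auto simp: power2_eq_square algebra_simps)
  finally show ?case by simp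
qed simp

lemma nn_integral_replicate_prod:
  fixes G :: "'a \<Rightarrow> ennreal"
  shows "(\<integral>\<^sup>+xs. prod_list (map G xs) \<partial>replicate_pmf k p) = (\<integral>\<^sup>+x. G x \<partial>p) ^ k"
  by (induction k) (auto simp: nn_integral_cmult nn_integral_multc)

lemma nn_integral_replicate_sum:
  fixes G :: "'a \<Rightarrow> ennreal"
  shows "(\<integral>\<^sup>+xs. sum_list (map G xs) \<partial>replicate_pmf k p) = of_nat k * (\<integral>\<^sup>+x. G x \<partial>p)"
  by (induction k) (auto simp: nn_integral_add distrib_right)

lemma ht_child_less: "t \<in> set ts \<Longrightarrow> ht t < ht (Node ts)"
  using Suc_le_ht_iff[of "ht t" ts] by (auto simp del: ht.simps)

context subcritical_gw
begin

abbreviation height_tail :: "nat \<Rightarrow> real" where "height_tail h \<equiv> P (\<lambda>t. h \<le> ht t)"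

text \<open>
  A tree is higher than \<open>h\<close> iff one of the subtrees at the root has height at least \<open>h\<close>.
\<close>

lemma height_tail_Suc:
  "height_tail (Suc h) = measure_pmf.expectation \<xi> (\<lambda>k. 1 - (1 - height_tail h) ^ k)"
proof -
  have "{ts. Suc h \<le> ht (Node ts)} = {ts. \<exists>t\<in>set ts. t \<in> {t. h \<le> ht t}}" by (auto simp: Suc_le_ht_iff simp del: ht.simps)
  then show ?thesis by (subst prob_tree) (simp only: prob_replicate_ex)
qed

lemma height_tail_le: "height_tail h \<le> \<mu> ^ h"
proof (induction h)
  case (Suc h)
  have "height_tail (Suc h) \<le> measure_pmf.expectation \<xi> (\<lambda>k. real k * height_tail h)"
    unfolding height_tail_Suc
    by (intro expectation_mono[where B = 1] integrable_linear one_minus_power_le) (auto simp: power_le_one)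
  also have "\<dots> \<le> \<mu> * \<mu> ^ h" unfolding expectation_linear using Suc mean_nonneg by (rule mult_left_mono)
  finally show ?case by simp
qed simp

lemma height_tail_antimono: "h \<le> h' \<Longrightarrow> height_tail h' \<le> height_tail h"
  by (rule prob_mono) auto

text \<open>
  To first order the recursion for the height tail is multiplication by \<open>\<mu>\<close>. Restricting to outdegrees
  below \<open>L\<close> makes the quadratic error term finite, at the price of replacing \<open>\<mu>\<close> by some smaller
  \<open>S > \<nu>\<close>; the error is then absorbed once the height tail is small enough.
\<close>

lemma height_tail_ge:
  assumes \<nu>: "0 < \<nu>" "\<nu> < \<mu>"
  shows "\<exists>c>0. \<forall>h. height_tail h \<ge> c * \<nu> ^ h"
proof -
  let ?q = height_tail
  have ms: "(\<lambda>k. pmf \<xi> k * real k) sums \<mu>" using expectation_nat_sums[OF integrable] mean by simp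
  then have "(\<lambda>L. \<Sum>k<L. pmf \<xi> k * real k) \<longlonglongrightarrow> \<mu>" by (simp add: sums_def)
  from eventually_happens'[OF sequentially_bot order_tendstoD(1)[OF this \<nu>(2)]]
  obtain L where L: "\<nu> < (\<Sum>k<L. pmf \<xi> k * real k)" by (elim exE)
  define S where "S = (\<Sum>k<L. pmf \<xi> k * real k)"
  have part: "(\<Sum>k<L. pmf \<xi> k * g k) \<le> measure_pmf.expectation \<xi> g" if "\<And>k. 0 \<le> g k" "\<And>k. g k \<le> 1" for g
  proof -
    have s: "(\<lambda>k. pmf \<xi> k * g k) sums measure_pmf.expectation \<xi> g"
      by (intro expectation_nat_sums integrable_pmf_bounded[where B = 1]) (use that in auto)
    then show ?thesis using sum_le_suminf[of "\<lambda>k. pmf \<xi> k * g k" "{..<L}"] that by (auto simp: sums_iff)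
  qed
  have qstep: "?q (Suc h) \<ge> ?q h * (S - (real L)\<^sup>2 * ?q h)" for h
  proof -
    have q: "0 \<le> ?q h" "?q h \<le> 1" by auto
    have "(\<Sum>k<L. pmf \<xi> k * (real k)\<^sup>2) \<le> (\<Sum>k<L. pmf \<xi> k * (real L)\<^sup>2)"
      by (intro sum_mono mult_left_mono power_mono) auto
    also have "\<dots> = (\<Sum>k<L. pmf \<xi> k * 1) * (real L)\<^sup>2" by (simp add: sum_distrib_right)
    also have "\<dots> \<le> 1 * (real L)\<^sup>2" by (intro mult_right_mono order_trans[OF part]) auto
    finally have "?q h * (?q h * (\<Sum>k<L. pmf \<xi> k * (real k)\<^sup>2)) \<le> ?q h * (?q h * (real L)\<^sup>2)"
      by (intro mult_left_mono) auto
    then have "?q h * (S - (real L)\<^sup>2 * ?q h) \<le> ?q h * S - (?q h)\<^sup>2 * (\<Sum>k<L. pmf \<xi> k * (real k)\<^sup>2)"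
      by (simp add: algebra_simps power2_eq_square)
    also have "\<dots> = (\<Sum>k<L. pmf \<xi> k * (real k * ?q h - (real k)\<^sup>2 * (?q h)\<^sup>2))"
      by (simp add: S_def right_diff_distrib sum_subtractf sum_distrib_left sum_distrib_right mult_ac)
    also have "\<dots> \<le> (\<Sum>k<L. pmf \<xi> k * (1 - (1 - ?q h) ^ k))"
      by (intro sum_mono mult_left_mono one_minus_power_ge q) auto
    also have "\<dots> \<le> ?q (Suc h)"
      unfolding height_tail_Suc by (rule part) (auto simp: power_le_one)
    finally show ?thesis .
  qed
  have pos: "?q h > 0" for h
  proof (induction h)
    case (Suc h)
    have "S > 0" using \<nu> L by (simp add: S_def)
    then obtain k where k: "k < L" "pmf \<xi> k * real k > 0"
      unfolding S_def by (metis (no_types, lifting) lessThan_iff not_le sum_nonpos)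
    then have "k > 0" "pmf \<xi> k > 0" by (cases k; auto simp: zero_less_mult_iff)+
    moreover have "(1 - ?q h) ^ k < 1" using Suc \<open>k > 0\<close> by (intro power_less_one_iff[THEN iffD2]) auto
    ultimately have "0 < pmf \<xi> k * (1 - (1 - ?q h) ^ k)" by simp
    also have "\<dots> \<le> (\<Sum>k<L. pmf \<xi> k * (1 - (1 - ?q h) ^ k))"
      by (rule member_le_sum) (use k in \<open>auto simp: power_le_one\<close>)
    also have "\<dots> \<le> ?q (Suc h)"
      unfolding height_tail_Suc by (rule part) (auto simp: power_le_one)
    finally show ?case .
  qed simp
  have "(\<lambda>h. (real L)\<^sup>2 * \<mu> ^ h) \<longlonglongrightarrow> (real L)\<^sup>2 * 0"
    by (intro tendsto_intros LIMSEQ_realpow_zero mean_nonneg mean_less)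
  then have "\<forall>\<^sub>F h in sequentially. (real L)\<^sup>2 * \<mu> ^ h < S - \<nu>"
    using L by (intro order_tendstoD(2)) (auto simp: S_def)
  then obtain h0 where h0: "\<And>h. h \<ge> h0 \<Longrightarrow> (real L)\<^sup>2 * \<mu> ^ h < S - \<nu>"
    by (auto simp: eventually_sequentially)
  have up: "?q (h0 + i) \<ge> ?q h0 * \<nu> ^ i" for i
  proof (induction i)
    case (Suc i)
    have "(real L)\<^sup>2 * ?q (h0 + i) \<le> (real L)\<^sup>2 * \<mu> ^ (h0 + i)"
      by (intro mult_left_mono height_tail_le) auto
    also have "\<dots> < S - \<nu>" by (rule h0) simp
    finally have "?q (h0 + i) * \<nu> \<le> ?q (h0 + i) * (S - (real L)\<^sup>2 * ?q (h0 + i))"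
      by (intro mult_left_mono) auto
    also have "\<dots> \<le> ?q (h0 + Suc i)" using qstep[of "h0 + i"] by simp
    finally have "?q (h0 + i) * \<nu> \<le> ?q (h0 + Suc i)" .
    moreover have "?q h0 * \<nu> ^ i * \<nu> \<le> ?q (h0 + i) * \<nu>"
      using Suc \<nu> by (intro mult_right_mono) auto
    ultimately show ?case by (simp add: mult_ac)
  qed simp
  have "?q h \<ge> ?q h0 * \<nu> ^ h" for h
  proof (cases "h0 \<le> h")
    case True
    then obtain i where h: "h = h0 + i" using le_Suc_ex by blast
    have "?q h0 * \<nu> ^ h \<le> ?q h0 * \<nu> ^ i"
      using \<nu> mean_less h by (intro mult_left_mono power_decreasing) auto
    then show ?thesis using up[of i] h by simp
  next
    case False
    have "?q h0 * \<nu> ^ h \<le> ?q h0 * 1" using \<nu> mean_less by (intro mult_left_mono power_le_one) auto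
    then show ?thesis using height_tail_antimono[of h h0] False by simp
  qed
  then show ?thesis using pos[of h0] by blast
qed

text \<open>
  Either the root is heavy and all its subtrees are low, or some subtree is heavy and low. With \<open>V\<close>
  for the left-hand side this reads \<open>V \<le> (1 - height_tail h) ^ m + \<mu> * V\<close>.
\<close>

lemma prob_heavy_low:
  "P (\<lambda>t. heavy m t \<and> ht t < h) \<le> (1 - height_tail h) ^ m / (1 - \<mu>)"
proof -
  let ?V = "P (\<lambda>t. heavy m t \<and> ht t < h)" and ?q = "height_tail h"
  have low: "measure_pmf.prob T {t. ht t < h} = 1 - ?q"
    using measure_pmf.prob_compl[of "{t. h \<le> ht t}" T] by (simp add: not_le[symmetric] Collect_neg_eq Compl_eq_Diff_UNIV)
  have "?V \<le> measure_pmf.expectation \<xi> (\<lambda>k. (1 - ?q) ^ m + real k * ?V)"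
  proof (subst prob_tree, rule expectation_mono[where B = 1])
    fix k
    have "measure_pmf.prob (replicate_pmf k T) {ts. heavy m (Node ts) \<and> ht (Node ts) < h}
       \<le> measure_pmf.prob (replicate_pmf k T) {ts. (m \<le> k \<and> (\<forall>t\<in>set ts. t \<in> {t. ht t < h}))
            \<or> (\<exists>t\<in>set ts. t \<in> {t. heavy m t \<and> ht t < h})}"
    proof (rule prob_replicate_mono)
      fix ts assume "length ts = k" and *: "heavy m (Node ts) \<and> ht (Node ts) < h"
      moreover have "\<forall>t\<in>set ts. ht t < h" using * ht_child_less less_trans by blast
      ultimately show "(m \<le> k \<and> (\<forall>t\<in>set ts. t \<in> {t. ht t < h})) \<or> (\<exists>t\<in>set ts. t \<in> {t. heavy m t \<and> ht t < h})"
        by auto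
    qed
    also have "\<dots> \<le> measure_pmf.prob (replicate_pmf k T) {ts. m \<le> k \<and> (\<forall>t\<in>set ts. t \<in> {t. ht t < h})}
        + measure_pmf.prob (replicate_pmf k T) {ts. \<exists>t\<in>set ts. t \<in> {t. heavy m t \<and> ht t < h}}"
      by (rule prob_Un_le)
    also have "\<dots> \<le> (1 - ?q) ^ m + real k * ?V"
    proof (intro add_mono)
      show "measure_pmf.prob (replicate_pmf k T) {ts. m \<le> k \<and> (\<forall>t\<in>set ts. t \<in> {t. ht t < h})} \<le> (1 - ?q) ^ m"
        by (cases "m \<le> k") (auto simp: prob_replicate_all[of k T "{t. ht t < h}", simplified] low intro!: power_decreasing)
      show "measure_pmf.prob (replicate_pmf k T) {ts. \<exists>t\<in>set ts. t \<in> {t. heavy m t \<and> ht t < h}} \<le> real k * ?V"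
        unfolding prob_replicate_ex by (rule one_minus_power_le) auto
    qed
    finally show "measure_pmf.prob (replicate_pmf k T) {ts. heavy m (Node ts) \<and> ht (Node ts) < h} \<le> (1 - ?q) ^ m + real k * ?V" .
  qed (use integrable_linear in auto)
  also have "\<dots> = (1 - ?q) ^ m + \<mu> * ?V"
    using integrable_linear mean by (subst Bochner_Integration.integral_add) auto
  finally show ?thesis using mean_less by (simp add: field_simps)
qed

text \<open>
  Expand \<open>exp x \<le> 1 + x + x\<^sup>2\<close> on \<open>{0..1}\<close>. The quadratic term is \<open>o(1 / m)\<close> by dominated
  convergence, so the linear term \<open>\<mu> / m\<close> decides, and \<open>\<mu> < 1\<close> leaves some room.
\<close>

lemma truncated_exponential_moment:
  "\<forall>\<^sub>F m in sequentially. measure_pmf.expectation \<xi> (\<lambda>k. if k < m then exp (real k / real m) else 0) \<le> exp ((1 + \<mu>) / 2 / real m)"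
proof -
  have "(\<lambda>m. measure_pmf.expectation \<xi> (\<lambda>k. if k < m then (real k)\<^sup>2 / real m else 0)) \<longlonglongrightarrow> measure_pmf.expectation \<xi> (\<lambda>k. 0)"
  proof (rule integral_dominated_convergence[where w = real])
    show "AE k in \<xi>. (\<lambda>m. if k < m then (real k)\<^sup>2 / real m else 0) \<longlonglongrightarrow> 0"
    proof (intro always_eventually allI)
      fix k
      have "(\<lambda>m. (real k)\<^sup>2 / real m) \<longlonglongrightarrow> 0" by (rule lim_const_over_n)
      moreover have "\<forall>\<^sub>F m in sequentially. (real k)\<^sup>2 / real m = (if k < m then (real k)\<^sup>2 / real m else 0)"
        using eventually_gt_at_top[of k] by eventually_elim simp
      ultimately show "(\<lambda>m. if k < m then (real k)\<^sup>2 / real m else 0) \<longlonglongrightarrow> 0"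
        by (rule Lim_transform_eventually)
    qed
    show "AE k in \<xi>. norm (if k < m then (real k)\<^sup>2 / real m else 0) \<le> real k" for m
    proof (intro always_eventually allI)
      fix k show "norm (if k < m then (real k)\<^sup>2 / real m else 0) \<le> real k"
        using mult_left_mono[of "real k" "real m" "real k"] by (auto simp: power2_eq_square field_simps)
    qed
  qed (auto simp: integrable)
  then have "\<forall>\<^sub>F m in sequentially. measure_pmf.expectation \<xi> (\<lambda>k. if k < m then (real k)\<^sup>2 / real m else 0) < (1 - \<mu>) / 2"
    by (rule order_tendstoD(2)) (use mean_less in simp)
  then show ?thesis using eventually_gt_at_top[of 0]
  proof eventually_elim
    case (elim m)
    let ?g = "\<lambda>k. if k < m then (real k)\<^sup>2 / real m else 0"
    have gi: "integrable (measure_pmf \<xi>) ?g"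
      by (rule integrable_pmf_bounded[where B = "(real m)\<^sup>2 / real m"]) (auto intro!: divide_right_mono power_mono)
    have "measure_pmf.expectation \<xi> (\<lambda>k. if k < m then exp (real k / real m) else 0)
       \<le> measure_pmf.expectation \<xi> (\<lambda>k. 1 + real k * (1 / real m) + ?g k * (1 / real m))"
    proof (rule expectation_mono[where B = "exp 1"])
      show "\<bar>if k < m then exp (real k / real m) else 0\<bar> \<le> exp 1" for k by auto
      show "(if k < m then exp (real k / real m) else 0) \<le> 1 + real k * (1 / real m) + ?g k * (1 / real m)" for k
        using exp_bound[of "real k / real m"] by (auto simp: power2_eq_square power_divide)
    qed (intro Bochner_Integration.integrable_add integrable_mult_left gi integrable, simp)
    also have "\<dots> = 1 + \<mu> * (1 / real m) + measure_pmf.expectation \<xi> ?g * (1 / real m)"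
      using gi integrable mean by (subst Bochner_Integration.integral_add) auto
    also have "\<dots> \<le> 1 + \<mu> * (1 / real m) + (1 - \<mu>) / 2 * (1 / real m)"
      using elim by (intro add_left_mono mult_right_mono) auto
    also have "\<dots> = 1 + (1 + \<mu>) / 2 / real m" using elim by (simp add: field_simps)
    also have "\<dots> \<le> exp ((1 + \<mu>) / 2 / real m)" by (rule exp_ge_add_one_self)
    finally show ?case .
  qed
qed

text \<open>
  Chernoff's bound. Let \<open>J h\<close> be the expectation of \<open>exp (s * size)\<close> over trees lower than \<open>h\<close> without
  heavy vertex. The decomposition at the root bounds \<open>J (Suc h)\<close> by \<open>exp s\<close> times the expectation of
  \<open>J h ^ \<xi>\<close> on \<open>\<xi> < m\<close>, which preserves \<open>J h \<le> exp (1 / m)\<close> by the previous lemma. The restriction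
  to height below \<open>h\<close> is there to start the induction and is removed at the end.
\<close>

lemma prob_light_large:
  "\<forall>\<^sub>F m in sequentially. \<forall>n. P (\<lambda>t. \<not> heavy m t \<and> n \<le> cnt UNIV t) \<le> exp ((1 - (1 - \<mu>) / 2 * real n) / real m)"
  using truncated_exponential_moment eventually_gt_at_top[of 0]
proof eventually_elim
  case (elim m)
  \<comment> \<open>\<open>s + (1 + \<mu>) / 2 / m = 1 / m\<close> closes the induction below\<close>
  define s where "s = (1 - \<mu>) / 2 / real m"
  have s: "s > 0" using elim mean_less by (simp add: s_def)
  define G where "G h t = ennreal (if \<not> heavy m t \<and> ht t < h then exp (s * real (cnt UNIV t)) else 0)" for h t
  have G_Node: "G (Suc h) (Node ts) = (if length ts < m then ennreal (exp s) * prod_list (map (G h) ts) else 0)" for h ts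
  proof -
    have pr: "prod_list (map (G h) ts) = ennreal (if \<forall>t\<in>set ts. \<not> heavy m t \<and> ht t < h
        then exp (s * real (sum_list (map (cnt UNIV) ts))) else 0)"
      by (induction ts) (auto simp: G_def ennreal_mult[symmetric] exp_add[symmetric] distrib_left)
    show ?thesis unfolding pr unfolding G_def ht_less_Suc_iff
      by (auto simp: ennreal_mult[symmetric] exp_add[symmetric] distrib_left not_le simp del: ht.simps)
  qed
  have J: "(\<integral>\<^sup>+t. G h t \<partial>T) \<le> ennreal (exp (1 / real m))" for h
  proof (induction h)
    case 0
    have "G 0 t = 0" for t by (simp add: G_def)
    then show ?case by simp
  next
    case (Suc h)
    have "(\<integral>\<^sup>+t. G (Suc h) t \<partial>T) = (\<integral>\<^sup>+k. (if k < m then ennreal (exp s) * (\<integral>\<^sup>+t. G h t \<partial>T) ^ k else 0) \<partial>\<xi>)"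
    proof (subst nn_integral_tree, rule nn_integral_cong)
      fix k
      have "(\<integral>\<^sup>+ts. G (Suc h) (Node ts) \<partial>replicate_pmf k T)
          = (\<integral>\<^sup>+ts. (if k < m then ennreal (exp s) * prod_list (map (G h) ts) else 0) \<partial>replicate_pmf k T)"
        by (rule nn_integral_cong_AE) (auto simp: AE_measure_pmf_iff set_replicate_pmf G_Node)
      also have "\<dots> = (if k < m then ennreal (exp s) * (\<integral>\<^sup>+t. G h t \<partial>T) ^ k else 0)"
        by (auto simp: nn_integral_cmult nn_integral_replicate_prod)
      finally show "(\<integral>\<^sup>+ts. G (Suc h) (Node ts) \<partial>replicate_pmf k T)
          = (if k < m then ennreal (exp s) * (\<integral>\<^sup>+t. G h t \<partial>T) ^ k else 0)" .
    qed
    also have "\<dots> \<le> (\<integral>\<^sup>+k. ennreal (exp s) * ennreal (if k < m then exp (real k / real m) else 0) \<partial>\<xi>)"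
    proof (rule nn_integral_mono)
      fix k
      have "(\<integral>\<^sup>+t. G h t \<partial>T) ^ k \<le> ennreal (exp (1 / real m)) ^ k" by (rule power_mono[OF Suc]) simp
      also have "\<dots> = ennreal (exp (real k / real m))"
        by (simp add: ennreal_power exp_of_nat_mult[symmetric])
      finally show "(if k < m then ennreal (exp s) * (\<integral>\<^sup>+t. G h t \<partial>T) ^ k else 0)
         \<le> ennreal (exp s) * ennreal (if k < m then exp (real k / real m) else 0)"
        by (auto intro: mult_left_mono)
    qed
    also have "\<dots> = ennreal (exp s) * (\<integral>\<^sup>+k. ennreal (if k < m then exp (real k / real m) else 0) \<partial>\<xi>)"
      by (rule nn_integral_cmult) simp
    also have "(\<integral>\<^sup>+k. ennreal (if k < m then exp (real k / real m) else 0) \<partial>\<xi>)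
        = ennreal (measure_pmf.expectation \<xi> (\<lambda>k. if k < m then exp (real k / real m) else 0))"
      by (intro nn_integral_eq_integral integrable_pmf_bounded[where B = "exp 1"]) auto
    also have "\<dots> \<le> ennreal (exp ((1 + \<mu>) / 2 / real m))" by (rule ennreal_leI[OF elim(1)])
    also have "ennreal (exp s) * ennreal (exp ((1 + \<mu>) / 2 / real m)) = ennreal (exp (1 / real m))"
    proof -
      have "s + (1 + \<mu>) / 2 / real m = 1 / real m" using elim by (simp add: s_def field_simps)
      then show ?thesis by (simp add: ennreal_mult[symmetric] exp_add[symmetric])
    qed
    finally show ?case by (simp add: mult_left_mono)
  qed
  show ?case
  proof
    fix n
    let ?A = "\<lambda>t. \<not> heavy m t \<and> n \<le> cnt UNIV t"
    have bnd: "P ?A \<le> exp (1 / real m - s * real n) + \<mu> ^ h" for h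
    proof -
      have "ennreal (exp (s * real n) * P (\<lambda>t. ?A t \<and> ht t < h))
         = (\<integral>\<^sup>+t. ennreal (exp (s * real n)) * indicator {t. ?A t \<and> ht t < h} t \<partial>T)"
        by (simp add: nn_integral_cmult_indicator measure_pmf.emeasure_eq_measure ennreal_mult)
      also have "\<dots> \<le> (\<integral>\<^sup>+t. G h t \<partial>T)"
        by (rule nn_integral_mono) (use s in \<open>auto simp: G_def indicator_def intro!: ennreal_leI\<close>)
      also have "\<dots> \<le> ennreal (exp (1 / real m))" by (rule J)
      finally have "exp (s * real n) * P (\<lambda>t. ?A t \<and> ht t < h) \<le> exp (1 / real m)" by simp
      then have "P (\<lambda>t. ?A t \<and> ht t < h) \<le> exp (1 / real m - s * real n)"
        by (simp add: exp_diff field_simps)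
      moreover have "P ?A \<le> P (\<lambda>t. (?A t \<and> ht t < h) \<or> h \<le> ht t)" by (rule prob_mono) auto
      moreover have "\<dots> \<le> P (\<lambda>t. ?A t \<and> ht t < h) + height_tail h" by (rule prob_Un_le)
      ultimately show ?thesis using height_tail_le[of h] by linarith
    qed
    have "(\<lambda>h. exp (1 / real m - s * real n) + \<mu> ^ h) \<longlonglongrightarrow> exp (1 / real m - s * real n) + 0"
      by (intro tendsto_intros LIMSEQ_realpow_zero mean_nonneg mean_less)
    then have "P ?A \<le> exp (1 / real m - s * real n) + 0"
      by (rule LIMSEQ_le_const) (use bnd in blast)
    also have "1 / real m - s * real n = (1 - (1 - \<mu>) / 2 * real n) / real m" by (simp add: s_def diff_divide_distrib left_diff_distrib)
    finally show "P ?A \<le> exp ((1 - (1 - \<mu>) / 2 * real n) / real m)" by simp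
  qed
qed

end

section \<open>Counting vertices by outdegree\<close>

lemma sum_list_pick:
  "i < length xs \<Longrightarrow> sum_list (map f xs) = f (xs ! i) + sum_list (map f (take i xs @ drop (Suc i) xs))"
  for f :: "'a \<Rightarrow> nat"
  by (subst id_take_nth_drop[of i xs]) (simp_all del: append_take_drop_id)

lemma set_pick: "i < length xs \<Longrightarrow> set xs = insert (xs ! i) (set (take i xs @ drop (Suc i) xs))"
  by (subst id_take_nth_drop[of i xs]) (simp_all del: append_take_drop_id)

locale subcritical_gw_count = subcritical_gw +
  fixes \<Omega> :: "nat set"
  assumes leaf_pos: "pmf \<xi> 0 > 0" and target_pos: "measure_pmf.prob \<xi> \<Omega> > 0"
begin

abbreviation total :: "ptree list \<Rightarrow> nat" where "total ts \<equiv> sum_list (map (cnt \<Omega>) ts)"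

definition root_cnt :: "nat \<Rightarrow> nat" where "root_cnt k = (if k \<in> \<Omega> then 1 else 0)"

definition cnt_law :: "nat \<Rightarrow> real" where "cnt_law j = P (\<lambda>t. cnt \<Omega> t = j)"

text \<open>
  The mean size \<open>A\<close> of the tree, cut off at \<open>X\<close> to make it finite, satisfies \<open>A \<le> 1 + \<mu> * A\<close>.
\<close>

lemma sum_size_tail_le: "(\<Sum>x<X. P (\<lambda>t. x < cnt UNIV t)) \<le> 1 / (1 - \<mu>)"
proof -
  let ?c = "\<lambda>t. of_nat (min (cnt UNIV t) X) :: ennreal"
  define A where "A = (\<integral>\<^sup>+t. ?c t \<partial>T)"
  have A_le: "A \<le> of_nat X"
  proof -
    have "A \<le> (\<integral>\<^sup>+t. of_nat X \<partial>T)" unfolding A_def by (rule nn_integral_mono) simp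
    then show ?thesis by simp
  qed
  then obtain a where a: "A = ennreal a" "a \<ge> 0"
    by (metis ennreal_cases ennreal_of_nat_eq_real_of_nat ennreal_less_top top.extremum_unique top.not_eq_extremum)
  have "A \<le> (\<integral>\<^sup>+k. \<integral>\<^sup>+ts. 1 + sum_list (map ?c ts) \<partial>replicate_pmf k T \<partial>\<xi>)"
    unfolding A_def nn_integral_tree[of ?c]
  proof (intro nn_integral_mono)
    fix ts
    have "min (1 + sum_list (map (cnt UNIV) ts)) X \<le> 1 + sum_list (map (\<lambda>t. min (cnt UNIV t) X) ts)"
      by (induction ts) auto
    then have "(of_nat (min (cnt UNIV (Node ts)) X) :: ennreal) \<le> of_nat (1 + sum_list (map (\<lambda>t. min (cnt UNIV t) X) ts))"
      by (intro of_nat_mono) simp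
    also have "(of_nat (sum_list (map (\<lambda>t. min (cnt UNIV t) X) ts)) :: ennreal) = sum_list (map ?c ts)"
      by (induction ts) auto
    then have "(of_nat (1 + sum_list (map (\<lambda>t. min (cnt UNIV t) X) ts)) :: ennreal) = 1 + sum_list (map ?c ts)"
      by simp
    finally show "?c (Node ts) \<le> 1 + sum_list (map ?c ts)" .
  qed
  also have "\<dots> = (\<integral>\<^sup>+k. 1 + of_nat k * A \<partial>\<xi>)"
    by (simp add: nn_integral_add nn_integral_replicate_sum A_def)
  also have "\<dots> = (\<integral>\<^sup>+k. 1 + ennreal (real k) * A \<partial>\<xi>)"
    by (simp only: ennreal_of_nat_eq_real_of_nat)
  also have "\<dots> = 1 + (\<integral>\<^sup>+k. ennreal (real k) \<partial>\<xi>) * A"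
    by (simp add: nn_integral_add nn_integral_multc)
  also have "(\<integral>\<^sup>+k. ennreal (real k) \<partial>\<xi>) = ennreal \<mu>"
    using nn_integral_eq_integral[OF integrable] mean by simp
  finally have "ennreal a \<le> 1 + ennreal \<mu> * ennreal a" using a by simp
  also have "\<dots> = ennreal (1 + \<mu> * a)"
    using mean_nonneg a by (simp add: ennreal_mult ennreal_plus)
  finally have "ennreal a \<le> ennreal (1 + \<mu> * a)" .
  moreover have "0 \<le> 1 + \<mu> * a" using mean_nonneg a by simp
  ultimately have "a \<le> 1 + \<mu> * a" using ennreal_le_iff by blast
  then have a_le: "a \<le> 1 / (1 - \<mu>)" using mean_less by (simp add: field_simps)
  have ind: "(\<Sum>x<X. indicator {t. x < cnt UNIV t} t) = ?c t" for t
  proof -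
    have "{x. x < X \<and> x < cnt UNIV t} = {..<min (cnt UNIV t) X}" by auto
    then show ?thesis by (simp add: indicator_def sum.If_cases Int_def)
  qed
  have "ennreal (\<Sum>x<X. P (\<lambda>t. x < cnt UNIV t)) = (\<Sum>x<X. \<integral>\<^sup>+t. indicator {t. x < cnt UNIV t} t \<partial>T)"
    by (simp add: measure_pmf.emeasure_eq_measure)
  also have "\<dots> = (\<integral>\<^sup>+t. (\<Sum>x<X. indicator {t. x < cnt UNIV t} t) \<partial>T)"
    by (rule nn_integral_sum[symmetric]) simp
  also have "\<dots> = ennreal a" unfolding ind using a by (simp add: A_def)
  finally have "(\<Sum>x<X. P (\<lambda>t. x < cnt UNIV t)) = a" using a by (simp add: sum_nonneg)
  then show ?thesis using a_le by simp
qed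

lemma cnt_law_sums: "cnt_law sums 1"
proof -
  have "pmf (map_pmf (cnt \<Omega>) T) j = cnt_law j" for j
    by (simp add: pmf_map cnt_law_def vimage_def)
  moreover have "(\<lambda>k. pmf (map_pmf (cnt \<Omega>) T) k * 1) sums measure_pmf.expectation (map_pmf (cnt \<Omega>) T) (\<lambda>_. 1)"
    by (rule expectation_nat_sums) simp
  ultimately show ?thesis by simp
qed

lemma one_minus_sum_cnt_law: "1 - (\<Sum>j\<le>x. cnt_law j) = P (\<lambda>t. x < cnt \<Omega> t)"
proof -
  have "(\<Sum>j\<le>x. cnt_law j) = measure_pmf.prob T (\<Union>j\<in>{..x}. {t. cnt \<Omega> t = j})"
    unfolding cnt_law_def by (rule measure_pmf.finite_measure_finite_Union[symmetric]) (auto simp: disjoint_family_on_def)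
  also have "(\<Union>j\<in>{..x}. {t. cnt \<Omega> t = j}) = UNIV - {t. x < cnt \<Omega> t}" by auto
  also have "measure_pmf.prob T \<dots> = 1 - P (\<lambda>t. x < cnt \<Omega> t)"
    using measure_pmf.prob_compl[of "{t. x < cnt \<Omega> t}" T] by simp
  finally show ?thesis by simp
qed

text \<open>
  A single vertex if leaves are counted; otherwise a root with outdegree in \<open>\<Omega>\<close> and only leaves below.
\<close>

lemma cnt_law_one_pos: "cnt_law 1 > 0"
proof -
  have "\<exists>t. cnt \<Omega> t = 1 \<and> weight \<xi> t > 0"
  proof (cases "0 \<in> \<Omega>")
    case True
    then show ?thesis using leaf_pos by (intro exI[of _ "Node []"]) simp
  next
    case False
    have "\<exists>k. k \<in> \<Omega> \<and> pmf \<xi> k > 0"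
    proof (rule ccontr)
      assume "\<not> ?thesis"
      then have "\<Omega> \<inter> set_pmf \<xi> = {}" by (auto simp: pmf_positive_iff)
      then have "measure_pmf.prob \<xi> \<Omega> = 0" by (simp add: measure_pmf_zero_iff Int_commute)
      then show False using target_pos by simp
    qed
    then obtain k where k: "k \<in> \<Omega>" "pmf \<xi> k > 0" by blast
    then show ?thesis using leaf_pos False
      by (intro exI[of _ "Node (replicate k (Node []))"]) (simp add: sum_list_replicate prod_list_replicate)
  qed
  then obtain t where t: "cnt \<Omega> t = 1" "weight \<xi> t > 0" by blast
  have "weight \<xi> t = measure_pmf.prob T {t}" by (simp add: measure_pmf_single pmf_gw_tree)
  also have "\<dots> \<le> cnt_law 1" unfolding cnt_law_def by (rule measure_pmf.finite_measure_mono) (use t in auto)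
  finally show ?thesis using t by simp
qed

sublocale renewal cnt_law
proof
  show "summable (\<lambda>x. 1 - (\<Sum>j\<le>x. cnt_law j))" unfolding one_minus_sum_cnt_law
  proof (rule summableI_nonneg_bounded[where x = "1 / (1 - \<mu>)"])
    fix X
    have "(\<Sum>x<X. P (\<lambda>t. x < cnt \<Omega> t)) \<le> (\<Sum>x<X. P (\<lambda>t. x < cnt UNIV t))"
      by (intro sum_mono prob_mono) (use cnt_le_cnt_UNIV less_le_trans in blast)
    also note sum_size_tail_le
    finally show "(\<Sum>x<X. P (\<lambda>t. x < cnt \<Omega> t)) \<le> 1 / (1 - \<mu>)" .
  qed simp
qed (use cnt_law_sums cnt_law_one_pos in \<open>auto simp: cnt_law_def\<close>)

lemma tail_0_pos: "tail 0 > 0"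
  using mass_zero_less_one by (simp add: tail_def)

lemma prob_total: "measure_pmf.prob (replicate_pmf k T) {ts. total ts = y} = conv_pow cnt_law k y"
proof (induction k arbitrary: y)
  case (Suc k)
  have "measure_pmf.prob (replicate_pmf (Suc k) T) {ts. total ts = y}
      = measure_pmf.prob (pair_pmf T (replicate_pmf k T)) {(t, ts). True \<and> True \<and> cnt \<Omega> t + total ts = y}"
    unfolding replicate_pmf_Suc_pair measure_map_pmf by (rule arg_cong[where f = "measure_pmf.prob _"]) auto
  also have "\<dots> = (\<Sum>j\<le>y. cnt_law j * conv_pow cnt_law k (y - j))"
    by (subst prob_pair_add) (simp add: Suc flip: cnt_law_def)
  finally show ?case by simp
qed (simp add: indicator_def eq_commute[of 0])

lemma prob_cnt_Node:
  "measure_pmf.prob (replicate_pmf k T) {ts. Q ts \<and> cnt \<Omega> (Node ts) = x}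
   = (if root_cnt k \<le> x then measure_pmf.prob (replicate_pmf k T) {ts. Q ts \<and> total ts = x - root_cnt k} else 0)"
proof (cases "root_cnt k \<le> x")
  case True
  then show ?thesis
    by (simp only: if_True) (rule prob_replicate_cong, auto simp: root_cnt_def split: if_splits)
next
  case False
  have "measure_pmf.prob (replicate_pmf k T) {ts. Q ts \<and> cnt \<Omega> (Node ts) = x} \<le> measure_pmf.prob (replicate_pmf k T) {ts. False}"
    by (rule prob_replicate_mono) (use False in \<open>auto simp: root_cnt_def split: if_splits\<close>)
  then show ?thesis using False by (simp add: measure_le_0_iff)
qed

text \<open>
  Condition on all subtrees but one: the last one must have a prescribed count, so a uniform
  bound \<open>M\<close> on its joint law with \<open>A\<close> factors out.
\<close>

lemma prob_replicate_child_le: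
  assumes M: "\<And>j. j \<le> y \<Longrightarrow> P (\<lambda>t. A t \<and> cnt \<Omega> t = j) \<le> M"
    and Q: "\<And>ts. length ts = Suc k \<Longrightarrow> Q ts \<Longrightarrow> total ts = y \<and>
        (\<exists>i<Suc k. A (ts ! i) \<and> B (take i ts @ drop (Suc i) ts))"
  shows "measure_pmf.prob (replicate_pmf (Suc k) T) {ts. Q ts}
     \<le> real (Suc k) * (M * measure_pmf.prob (replicate_pmf k T) {ts. B ts})"
proof -
  have M0: "M \<ge> 0" using order_trans[OF measure_nonneg M[OF le0]] .
  have "measure_pmf.prob (replicate_pmf (Suc k) T) {ts. Q ts}
     \<le> real (Suc k) * measure_pmf.prob (pair_pmf T (replicate_pmf k T)) {(t, r). A t \<and> B r \<and> cnt \<Omega> t + total r = y}"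
  proof (rule prob_replicate_pick_le)
    fix ts assume ts: "length ts = Suc k" "Q ts"
    from Q[OF this] obtain i where i: "i < Suc k" "A (ts ! i)" "B (take i ts @ drop (Suc i) ts)" "total ts = y" by blast
    then show "\<exists>i<Suc k. A (ts ! i) \<and> B (take i ts @ drop (Suc i) ts) \<and> cnt \<Omega> (ts ! i) + total (take i ts @ drop (Suc i) ts) = y"
      using sum_list_pick[of i ts "cnt \<Omega>"] ts(1) by auto
  qed
  also have "measure_pmf.prob (pair_pmf T (replicate_pmf k T)) {(t, r). A t \<and> B r \<and> cnt \<Omega> t + total r = y}
     = (\<Sum>j\<le>y. P (\<lambda>t. A t \<and> cnt \<Omega> t = j) * measure_pmf.prob (replicate_pmf k T) {r. B r \<and> total r = y - j})"
    by (rule prob_pair_add)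
  also have "\<dots> \<le> (\<Sum>j\<le>y. M * measure_pmf.prob (replicate_pmf k T) {r. B r \<and> total r = y - j})"
    by (intro sum_mono mult_right_mono M) auto
  also have "\<dots> = M * (\<Sum>j\<le>y. measure_pmf.prob (replicate_pmf k T) {r. B r \<and> total r = j})"
    unfolding sum_distrib_left
    by (rule sum.reindex_bij_witness[of _ "\<lambda>j. y - j" "\<lambda>j. y - j"]) auto
  also have "\<dots> \<le> M * measure_pmf.prob (replicate_pmf k T) {r. B r}"
    by (intro mult_left_mono sum_prob_fibres_le M0) auto
  finally show ?thesis by simp
qed

text \<open>
  The price of a heavy root: each admissible outdegree \<open>k\<close> has probability at most \<open>b\<close>, and what
  remains is the expected number of \<open>k\<close> at which the partial sums of the counts hit the right level.
  The factor 2 is there because the root may or may not be counted, so that the level is \<open>x\<close> or \<open>x - 1\<close>.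
\<close>

lemma prob_root_heavy_le:
  assumes b: "\<And>k. m \<le> k \<Longrightarrow> pmf \<xi> k \<le> b"
    and c: "\<And>K y. y \<le> x \<Longrightarrow> (\<Sum>k<K. measure_pmf.prob (replicate_pmf k T) {ts. B ts \<and> total ts = y}) \<le> c"
  shows "P (\<lambda>t. m \<le> length (subtrees t) \<and> B (subtrees t) \<and> cnt \<Omega> t = x) \<le> 2 * b * c"
proof -
  have b0: "b \<ge> 0" using order_trans[OF pmf_nonneg b[OF order_refl]] .
  let ?g = "\<lambda>k y. measure_pmf.prob (replicate_pmf k T) {ts. B ts \<and> total ts = y}"
  let ?f = "\<lambda>k. measure_pmf.prob (replicate_pmf k T) {ts. m \<le> length ts \<and> B ts \<and> cnt \<Omega> (Node ts) = x}"
  have f_le: "pmf \<xi> k * ?f k \<le> b * (?g k x + ?g k (x - 1))" for k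
  proof (cases "m \<le> k")
    case True
    have "?f k \<le> measure_pmf.prob (replicate_pmf k T) {ts. B ts \<and> cnt \<Omega> (Node ts) = x}"
      by (rule prob_mono) auto
    also have "\<dots> \<le> ?g k x + ?g k (x - 1)"
      unfolding prob_cnt_Node by (auto simp: root_cnt_def)
    finally show ?thesis using b[OF True] b0 by (intro mult_mono) auto
  next
    case False
    have "?f k \<le> measure_pmf.prob (replicate_pmf k T) {ts. False}"
      by (rule prob_replicate_mono) (use False in auto)
    then have "?f k = 0" by (simp add: measure_le_0_iff)
    then show ?thesis using b0 by simp
  qed
  have "(\<lambda>k. pmf \<xi> k * ?f k) sums measure_pmf.expectation \<xi> ?f"
    by (intro expectation_nat_sums integrable_pmf_prob)
  then have "(\<lambda>K. \<Sum>k<K. pmf \<xi> k * ?f k) \<longlonglongrightarrow> measure_pmf.expectation \<xi> ?f" by (simp add: sums_def)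
  moreover have "(\<Sum>k<K. pmf \<xi> k * ?f k) \<le> 2 * b * c" for K
  proof -
    have "(\<Sum>k<K. pmf \<xi> k * ?f k) \<le> (\<Sum>k<K. b * (?g k x + ?g k (x - 1)))" by (intro sum_mono f_le)
    also have "\<dots> = b * ((\<Sum>k<K. ?g k x) + (\<Sum>k<K. ?g k (x - 1)))"
      by (simp add: sum_distrib_left sum.distrib distrib_left)
    also have "\<dots> \<le> b * (c + c)" by (intro mult_left_mono add_mono c b0) auto
    finally show ?thesis by simp
  qed
  ultimately have "measure_pmf.expectation \<xi> ?f \<le> 2 * b * c" by (intro LIMSEQ_le_const2) auto
  then show ?thesis by (subst prob_tree) simp
qed

lemma sum_prob_total_le: "(\<Sum>k<K. measure_pmf.prob (replicate_pmf k T) {ts. True \<and> total ts = y}) \<le> 1 / tail 0"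
proof -
  have "(\<Sum>k<K. conv_pow cnt_law k y) \<le> green y"
    unfolding green_def by (rule sum_le_suminf[OF summable_green]) (auto simp: conv_pow_nonneg)
  also note green_bounded
  finally show ?thesis by (simp add: prob_total)
qed

text \<open>
  One of the \<open>k\<close> subtrees is high; the remaining \<open>k - 1\<close> perform the walk. Summing over the choice of
  that subtree produces the weighted Green function.
\<close>

lemma sum_prob_total_high_le:
  "(\<Sum>k<K. measure_pmf.prob (replicate_pmf k T) {ts. (\<exists>t\<in>set ts. h \<le> ht t) \<and> total ts = y})
    \<le> height_tail h * (real (Suc y) / (tail 0)\<^sup>2)"
proof -
  let ?g = "\<lambda>k. measure_pmf.prob (replicate_pmf k T) {ts. (\<exists>t\<in>set ts. h \<le> ht t) \<and> total ts = y}"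
  let ?a = "\<lambda>j. P (\<lambda>t. h \<le> ht t \<and> cnt \<Omega> t = j)"
  have g: "?g (Suc k) \<le> (\<Sum>j\<le>y. ?a j * (real (Suc k) * conv_pow cnt_law k (y - j)))" for k
  proof -
    have "?g (Suc k) \<le> real (Suc k) * measure_pmf.prob (pair_pmf T (replicate_pmf k T)) {(t, r). h \<le> ht t \<and> True \<and> cnt \<Omega> t + total r = y}"
    proof (rule prob_replicate_pick_le)
      fix ts assume ts: "length ts = Suc k" "(\<exists>t\<in>set ts. h \<le> ht t) \<and> total ts = y"
      then obtain i where "i < Suc k" "h \<le> ht (ts ! i)" by (auto simp: in_set_conv_nth)
      then show "\<exists>i<Suc k. h \<le> ht (ts ! i) \<and> True \<and> cnt \<Omega> (ts ! i) + total (take i ts @ drop (Suc i) ts) = y"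
        using sum_list_pick[of i ts "cnt \<Omega>"] ts by auto
    qed
    also have "\<dots> = (\<Sum>j\<le>y. ?a j * (real (Suc k) * conv_pow cnt_law k (y - j)))"
      by (subst prob_pair_add) (simp add: prob_total sum_distrib_left mult_ac)
    finally show ?thesis .
  qed
  have "(\<Sum>k<K. ?g k) \<le> (\<Sum>k<Suc K. ?g k)" by simp
  also have "\<dots> = (\<Sum>k<K. ?g (Suc k))" by (subst sum.lessThan_Suc_shift) simp
  also have "\<dots> \<le> (\<Sum>k<K. \<Sum>j\<le>y. ?a j * (real (Suc k) * conv_pow cnt_law k (y - j)))" by (intro sum_mono g)
  also have "\<dots> = (\<Sum>j\<le>y. ?a j * (\<Sum>k<K. real (Suc k) * conv_pow cnt_law k (y - j)))"
    by (subst sum.swap) (simp add: sum_distrib_left)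
  also have "\<dots> \<le> (\<Sum>j\<le>y. ?a j * (real (Suc y) / (tail 0)\<^sup>2))"
  proof (intro sum_mono mult_left_mono)
    fix j
    have "(\<Sum>k<K. real (Suc k) * conv_pow cnt_law k (y - j)) \<le> weighted_green (y - j)"
      unfolding weighted_green_def by (rule sum_le_suminf[OF summable_weighted_green]) (auto intro!: mult_nonneg_nonneg conv_pow_nonneg)
    also have "\<dots> \<le> real (Suc (y - j)) / (tail 0)\<^sup>2" by (rule weighted_green_bounded)
    also have "\<dots> \<le> real (Suc y) / (tail 0)\<^sup>2" by (intro divide_right_mono) auto
    finally show "(\<Sum>k<K. real (Suc k) * conv_pow cnt_law k (y - j)) \<le> real (Suc y) / (tail 0)\<^sup>2" .
  qed simp
  also have "\<dots> = (\<Sum>j\<le>y. ?a j) * (real (Suc y) / (tail 0)\<^sup>2)" by (rule sum_distrib_right[symmetric])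
  also have "\<dots> \<le> height_tail h * (real (Suc y) / (tail 0)\<^sup>2)"
    by (intro mult_right_mono sum_prob_fibres_le) auto
  finally show ?thesis .
qed

text \<open>
  Let \<open>M\<close> be the maximum of the left-hand side over arguments up to \<open>x\<close>. Either the root is heavy or one
  of its subtrees is, whence \<open>M \<le> 2 * b / tail 0 + \<mu> * M\<close>.
\<close>

lemma prob_heavy_cnt_le:
  assumes b: "\<And>k. m \<le> k \<Longrightarrow> pmf \<xi> k \<le> b"
  shows "P (\<lambda>t. heavy m t \<and> cnt \<Omega> t = x) \<le> 2 * b / (tail 0 * (1 - \<mu>))"
proof -
  let ?u = "\<lambda>x. P (\<lambda>t. heavy m t \<and> cnt \<Omega> t = x)"
  define M where "M = Max (?u ` {..x})"
  have M: "?u j \<le> M" if "j \<le> x" for j unfolding M_def by (rule Max_ge) (use that in auto)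
  have "M \<in> ?u ` {..x}" unfolding M_def by (rule Max_in) auto
  then obtain y where y: "y \<le> x" "M = ?u y" by auto
  have "?u y \<le> P (\<lambda>t. (m \<le> length (subtrees t) \<and> True \<and> cnt \<Omega> t = y)
      \<or> ((\<exists>t\<in>set (subtrees t). heavy m t) \<and> cnt \<Omega> t = y))"
    by (rule prob_mono) (metis heavy.simps ptree.collapse)
  also have "\<dots> \<le> P (\<lambda>t. m \<le> length (subtrees t) \<and> True \<and> cnt \<Omega> t = y)
     + P (\<lambda>t. (\<exists>t\<in>set (subtrees t). heavy m t) \<and> cnt \<Omega> t = y)" by (rule prob_Un_le)
  also have "\<dots> \<le> 2 * b * (1 / tail 0) + \<mu> * M"
  proof (intro add_mono)
    show "P (\<lambda>t. m \<le> length (subtrees t) \<and> True \<and> cnt \<Omega> t = y) \<le> 2 * b * (1 / tail 0)"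
      by (rule prob_root_heavy_le[OF b sum_prob_total_le])
    have "P (\<lambda>t. (\<exists>t\<in>set (subtrees t). heavy m t) \<and> cnt \<Omega> t = y) \<le> measure_pmf.expectation \<xi> (\<lambda>k. real k * M)"
    proof (subst prob_tree, rule expectation_mono[where B = 1])
      fix k
      show "measure_pmf.prob (replicate_pmf k T) {ts. (\<exists>t\<in>set (subtrees (Node ts)). heavy m t) \<and> cnt \<Omega> (Node ts) = y} \<le> real k * M"
      proof (cases "k > 0 \<and> root_cnt k \<le> y")
        case True
        then obtain k' where k: "k = Suc k'" by (cases k) auto
        have "measure_pmf.prob (replicate_pmf k T) {ts. (\<exists>t\<in>set ts. heavy m t) \<and> total ts = y - root_cnt k}
            \<le> real (Suc k') * (M * measure_pmf.prob (replicate_pmf k' T) {ts. True})"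
          unfolding k
        proof (rule prob_replicate_child_le[where A = "heavy m" and y = "y - root_cnt (Suc k')"])
          show "?u j \<le> M" if "j \<le> y - root_cnt (Suc k')" for j using that y by (intro M) auto
        qed (auto simp: in_set_conv_nth)
        then show ?thesis using True by (simp only: ptree.sel prob_cnt_Node if_True) (simp add: k)
      next
        case False
        have M0: "M \<ge> 0" using y by simp
        show ?thesis
        proof (cases "k = 0")
          case True
          then show ?thesis using M0 by simp
        next
          case nz: False
          then have "\<not> root_cnt k \<le> y" using False by simp
          then show ?thesis using M0 by (simp only: ptree.sel prob_cnt_Node if_False) simp
        qed
      qed
    qed (use integrable_linear in auto)
    then show "P (\<lambda>t. (\<exists>t\<in>set (subtrees t). heavy m t) \<and> cnt \<Omega> t = y) \<le> \<mu> * M"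
      unfolding expectation_linear .
  qed
  finally have "M \<le> 2 * b / (tail 0 * (1 - \<mu>))" using y mean_less tail_0_pos by (simp add: field_simps)
  then show ?thesis using M[of x] by simp
qed

text \<open>
  A heavy vertex and a high branch are located either with the root as the heavy vertex,
  or both in the same subtree, or in two different subtrees. The three terms of the bound correspond to
  these cases. In the last one, the probability that one of \<open>k\<close> subtrees is high is at most
  \<open>min 1 (k * height_tail h)\<close>, hence at most \<open>(k * height_tail h) powr \<theta>\<close>; this requires a moment
  of the offspring law of order only \<open>1 + \<theta>\<close>, while the second moment may be infinite.
\<close>

lemma prob_heavy_high_step:
  assumes b: "\<And>k. m \<le> k \<Longrightarrow> pmf \<xi> k \<le> b"
    and a: "\<And>y. y \<le> x \<Longrightarrow> P (\<lambda>t. heavy m t \<and> h \<le> ht t \<and> cnt \<Omega> t = y) \<le> a"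
    and \<theta>: "0 < \<theta>" "\<theta> \<le> 1"
    and D: "integrable (measure_pmf \<xi>) (\<lambda>k. real k powr (1 + \<theta>))"
  shows "P (\<lambda>t. heavy m t \<and> Suc h \<le> ht t \<and> cnt \<Omega> t = x)
     \<le> 2 * b * (height_tail h * (real (Suc x) / (tail 0)\<^sup>2)) + \<mu> * a
       + 2 * b / (tail 0 * (1 - \<mu>)) * measure_pmf.expectation \<xi> (\<lambda>k. real k powr (1 + \<theta>)) * height_tail h powr \<theta>"
proof -
  let ?q = "height_tail h" and ?U = "2 * b / (tail 0 * (1 - \<mu>))"
  have b0: "b \<ge> 0" using order_trans[OF pmf_nonneg b[OF order_refl]] .
  have a0: "a \<ge> 0" using order_trans[OF measure_nonneg a[OF order_refl]] .
  have U0: "?U \<ge> 0" using b0 mean_less tail_0_pos by simp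
  let ?high = "\<lambda>ts. \<exists>t\<in>set ts. h \<le> ht t" and ?hv = "\<lambda>ts. \<exists>t\<in>set ts. heavy m t"
  have "P (\<lambda>t. heavy m t \<and> Suc h \<le> ht t \<and> cnt \<Omega> t = x)
    \<le> P (\<lambda>t. (m \<le> length (subtrees t) \<and> ?high (subtrees t) \<and> cnt \<Omega> t = x)
         \<or> ((?hv (subtrees t) \<and> ?high (subtrees t)) \<and> cnt \<Omega> t = x))"
    by (rule prob_mono) (metis heavy.simps ptree.collapse Suc_le_ht_iff)
  also have "\<dots> \<le> P (\<lambda>t. m \<le> length (subtrees t) \<and> ?high (subtrees t) \<and> cnt \<Omega> t = x)
     + P (\<lambda>t. (?hv (subtrees t) \<and> ?high (subtrees t)) \<and> cnt \<Omega> t = x)" by (rule prob_Un_le)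
  also have "\<dots> \<le> 2 * b * (?q * (real (Suc x) / (tail 0)\<^sup>2))
     + (\<mu> * a + measure_pmf.expectation \<xi> (\<lambda>k. real k powr (1 + \<theta>)) * (?U * ?q powr \<theta>))"
  proof (intro add_mono)
    show "P (\<lambda>t. m \<le> length (subtrees t) \<and> ?high (subtrees t) \<and> cnt \<Omega> t = x) \<le> 2 * b * (?q * (real (Suc x) / (tail 0)\<^sup>2))"
    proof (rule prob_root_heavy_le[OF b])
      fix K y assume "y \<le> x"
      have "(\<Sum>k<K. measure_pmf.prob (replicate_pmf k T) {ts. ?high ts \<and> total ts = y}) \<le> ?q * (real (Suc y) / (tail 0)\<^sup>2)"
        by (rule sum_prob_total_high_le)
      also have "\<dots> \<le> ?q * (real (Suc x) / (tail 0)\<^sup>2)"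
        using \<open>y \<le> x\<close> by (intro mult_left_mono divide_right_mono) auto
      finally show "(\<Sum>k<K. measure_pmf.prob (replicate_pmf k T) {ts. ?high ts \<and> total ts = y}) \<le> ?q * (real (Suc x) / (tail 0)\<^sup>2)" .
    qed
    have "P (\<lambda>t. (?hv (subtrees t) \<and> ?high (subtrees t)) \<and> cnt \<Omega> t = x)
       \<le> measure_pmf.expectation \<xi> (\<lambda>k. real k * a + real k powr (1 + \<theta>) * (?U * ?q powr \<theta>))"
    proof (subst prob_tree, rule expectation_mono[where B = 1])
      fix k
      have nonneg: "real k * a + real k powr (1 + \<theta>) * (?U * ?q powr \<theta>) \<ge> 0"
        by (intro add_nonneg_nonneg mult_nonneg_nonneg a0 U0 powr_ge_zero of_nat_0_le_iff)
      show "measure_pmf.prob (replicate_pmf k T) {ts. (?hv (subtrees (Node ts)) \<and> ?high (subtrees (Node ts))) \<and> cnt \<Omega> (Node ts) = x}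
         \<le> real k * a + real k powr (1 + \<theta>) * (?U * ?q powr \<theta>)"
      proof (cases k)
        case 0
        then show ?thesis using nonneg by simp
      next
        case (Suc k')
        let ?y = "x - root_cnt k"
        let ?r = "replicate_pmf k T"
        let ?pk = "\<lambda>i ts. take i ts @ drop (Suc i) ts"
        let ?E1 = "\<lambda>ts. (\<exists>i<Suc k'. (heavy m (ts ! i) \<and> h \<le> ht (ts ! i)) \<and> True) \<and> total ts = ?y"
        let ?E2 = "\<lambda>ts. (\<exists>i<Suc k'. heavy m (ts ! i) \<and> ?high (?pk i ts)) \<and> total ts = ?y"
        have high: "measure_pmf.prob (replicate_pmf k' T) {ts. ?high ts} \<le> (real k * ?q) powr \<theta>"
        proof -
          have eq: "measure_pmf.prob (replicate_pmf k' T) {ts. ?high ts} = 1 - (1 - ?q) ^ k'"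
            using prob_replicate_ex[of k' T "{t. h \<le> ht t}"] by simp
          show ?thesis
          proof (cases "real k * ?q \<le> 1")
            case True
            have "1 - (1 - ?q) ^ k' \<le> real k' * ?q" by (rule one_minus_power_le) auto
            also have "\<dots> \<le> real k * ?q" using Suc by (intro mult_right_mono) auto
            also have "\<dots> \<le> (real k * ?q) powr \<theta>"
              using True \<theta> powr_mono'[of \<theta> 1 "real k * ?q"] by (cases "real k * ?q = 0") auto
            finally show ?thesis unfolding eq .
          next
            case False
            then have "1 \<le> (real k * ?q) powr \<theta>" using \<theta> by (intro ge_one_powr_ge_zero) auto
            then show ?thesis by (rule order_trans[OF measure_pmf.prob_le_1])
          qed
        qed
        have "measure_pmf.prob ?r {ts. (?hv ts \<and> ?high ts) \<and> total ts = ?y} \<le> measure_pmf.prob ?r {ts. ?E1 ts \<or> ?E2 ts}"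
        proof (rule prob_replicate_mono)
          fix ts assume ts: "length ts = k" "(?hv ts \<and> ?high ts) \<and> total ts = ?y"
          then obtain i where i: "i < Suc k'" "heavy m (ts ! i)" using Suc by (auto simp: in_set_conv_nth)
          have "h \<le> ht (ts ! i) \<or> ?high (?pk i ts)" using ts set_pick[of i ts] i(1) Suc by auto
          then show "?E1 ts \<or> ?E2 ts" using i ts by blast
        qed
        also have "\<dots> \<le> measure_pmf.prob ?r {ts. ?E1 ts} + measure_pmf.prob ?r {ts. ?E2 ts}" by (rule prob_Un_le)
        also have "\<dots> \<le> real (Suc k') * (a * measure_pmf.prob (replicate_pmf k' T) {ts. True})
            + real (Suc k') * (?U * measure_pmf.prob (replicate_pmf k' T) {ts. ?high ts})"
          unfolding Suc
        proof (intro add_mono)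
          show "measure_pmf.prob (replicate_pmf (Suc k') T) {ts. (\<exists>i<Suc k'. (heavy m (ts ! i) \<and> h \<le> ht (ts ! i)) \<and> True) \<and> total ts = x - root_cnt (Suc k')}
             \<le> real (Suc k') * (a * measure_pmf.prob (replicate_pmf k' T) {ts. True})"
            by (rule prob_replicate_child_le[where y = "x - root_cnt (Suc k')" and A = "\<lambda>t. heavy m t \<and> h \<le> ht t"])
               (use a in auto)
          show "measure_pmf.prob (replicate_pmf (Suc k') T) {ts. (\<exists>i<Suc k'. heavy m (ts ! i) \<and> ?high (?pk i ts)) \<and> total ts = x - root_cnt (Suc k')}
             \<le> real (Suc k') * (?U * measure_pmf.prob (replicate_pmf k' T) {ts. ?high ts})"
            by (rule prob_replicate_child_le[where y = "x - root_cnt (Suc k')", OF prob_heavy_cnt_le[OF b]]) auto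
        qed
        also have "\<dots> \<le> real (Suc k') * (a * measure_pmf.prob (replicate_pmf k' T) {ts. True})
            + real (Suc k') * (?U * (real k * ?q) powr \<theta>)"
          by (intro add_left_mono mult_left_mono high U0) simp
        also have "real (Suc k') * (a * measure_pmf.prob (replicate_pmf k' T) {ts. True}) + real (Suc k') * (?U * (real k * ?q) powr \<theta>)
            = real k * a + real k powr (1 + \<theta>) * (?U * ?q powr \<theta>)"
        proof -
          have "real (Suc k') = real k" using Suc by simp
          moreover have "(real k * ?q) powr \<theta> = real k powr \<theta> * ?q powr \<theta>" by (rule powr_mult)
          moreover have "real k powr (1 + \<theta>) = real k * real k powr \<theta>" using Suc by (simp add: powr_add)
          ultimately show ?thesis by (simp only:) (simp add: mult_ac)
        qed
        finally have "measure_pmf.prob ?r {ts. (?hv ts \<and> ?high ts) \<and> total ts = ?y} \<le> real k * a + real k powr (1 + \<theta>) * (?U * ?q powr \<theta>)" .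
        then show ?thesis using nonneg unfolding ptree.sel prob_cnt_Node by (cases "root_cnt k \<le> x") simp_all
      qed
    qed (auto intro!: Bochner_Integration.integrable_add integrable_mult_left integrable D)
    also have "\<dots> = \<mu> * a + measure_pmf.expectation \<xi> (\<lambda>k. real k powr (1 + \<theta>)) * (?U * ?q powr \<theta>)"
      using integrable_linear D mean by (subst Bochner_Integration.integral_add) auto
    finally show "P (\<lambda>t. (?hv (subtrees t) \<and> ?high (subtrees t)) \<and> cnt \<Omega> t = x)
       \<le> \<mu> * a + measure_pmf.expectation \<xi> (\<lambda>k. real k powr (1 + \<theta>)) * (?U * ?q powr \<theta>)" .
  qed
  finally show ?thesis by (simp add: mult_ac add.assoc)
qed

text \<open>
  Iterating the previous step \<open>h\<close> times; the factor \<open>Suc h\<close> counts the contributions of the \<open>h\<close> steps.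
\<close>

lemma prob_heavy_high:
  assumes \<theta>: "0 < \<theta>" "\<theta> \<le> 1" and \<mu>: "\<mu> > 0"
    and D: "integrable (measure_pmf \<xi>) (\<lambda>k. real k powr (1 + \<theta>))"
  shows "\<exists>C\<ge>0. \<forall>m b n h x. (\<forall>k\<ge>m. pmf \<xi> k \<le> b) \<longrightarrow> x \<le> n \<longrightarrow>
     P (\<lambda>t. heavy m t \<and> h \<le> ht t \<and> cnt \<Omega> t = x)
       \<le> b * C * real (Suc h) * (real (Suc n) * \<mu> ^ h + (\<mu> powr \<theta>) ^ h)"
proof -
  define d where "d = measure_pmf.expectation \<xi> (\<lambda>k. real k powr (1 + \<theta>))"
  define w where "w = \<mu> powr \<theta>"
  define \<tau> where "\<tau> = tail 0"
  have d: "d \<ge> 0" unfolding d_def by (rule integral_nonneg_AE) auto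
  have w: "w > 0" "\<mu> \<le> w"
    using \<mu> mean_less \<theta> powr_mono'[of \<theta> 1 \<mu>] by (auto simp: w_def)
  have \<tau>: "\<tau> > 0" using tail_0_pos by (simp add: \<tau>_def)
  define C where "C = 2 / (\<tau> * (1 - \<mu>)) + 2 / (\<tau>\<^sup>2 * \<mu>) + 2 / (\<tau> * (1 - \<mu>)) * d / w"
  have parts: "0 \<le> 2 / (\<tau> * (1 - \<mu>))" "0 \<le> 2 / (\<tau>\<^sup>2 * \<mu>)" "0 \<le> 2 / (\<tau> * (1 - \<mu>)) * d / w"
    using \<tau> d w \<mu> mean_less by auto
  have C: "C \<ge> 0" "2 / (\<tau> * (1 - \<mu>)) \<le> C" "2 / (\<tau>\<^sup>2 * \<mu>) \<le> C" "2 / (\<tau> * (1 - \<mu>)) * d / w \<le> C"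
    using parts unfolding C_def by linarith+
  have C2: "2 / \<tau>\<^sup>2 \<le> C * \<mu>" using C(3) \<mu> \<tau> by (simp add: field_simps)
  have C3: "2 / (\<tau> * (1 - \<mu>)) * d \<le> C * w" using C(4) unfolding pos_divide_le_eq[OF w(1)] .
  have "P (\<lambda>t. heavy m t \<and> h \<le> ht t \<and> cnt \<Omega> t = x)
       \<le> b * C * real (Suc h) * (real (Suc n) * \<mu> ^ h + w ^ h)"
    if b: "\<And>k. m \<le> k \<Longrightarrow> pmf \<xi> k \<le> b" and x: "x \<le> n" for m b n h x
    using x
  proof (induction h arbitrary: x)
    case 0
    have b0: "b \<ge> 0" using order_trans[OF pmf_nonneg b[OF order_refl]] .
    have "P (\<lambda>t. heavy m t \<and> cnt \<Omega> t = x) \<le> b * (2 / (\<tau> * (1 - \<mu>)))"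
      using prob_heavy_cnt_le[of m b x, OF b] by (simp add: \<tau>_def mult_ac)
    also have "\<dots> \<le> b * C" using C b0 by (intro mult_left_mono) auto
    also have "\<dots> * 1 \<le> b * C * (real (Suc n) + 1)" using C b0 by (intro mult_left_mono) auto
    finally show ?case by simp
  next
    case (Suc h)
    have b0: "b \<ge> 0" using order_trans[OF pmf_nonneg b[OF order_refl]] .
    define Y where "Y = real (Suc n) * \<mu> ^ h"
    define W where "W = w ^ h"
    have YW: "Y \<ge> 0" "W \<ge> 0" using \<mu> w by (auto simp: Y_def W_def)
    have q: "height_tail h \<le> \<mu> ^ h" by (rule height_tail_le)
    have qW: "height_tail h powr \<theta> \<le> W"
    proof -
      have "height_tail h powr \<theta> \<le> (\<mu> ^ h) powr \<theta>" using q \<theta> by (intro powr_mono2) auto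
      also have "\<dots> = W" using \<mu> by (simp add: W_def w_def powr_power powr_powr mult.commute flip: powr_realpow)
      finally show ?thesis .
    qed
    have qY: "height_tail h * (real (Suc x) / \<tau>\<^sup>2) \<le> Y / \<tau>\<^sup>2"
    proof -
      have "height_tail h * real (Suc x) \<le> \<mu> ^ h * real (Suc n)"
        using q Suc.prems \<mu> by (intro mult_mono) auto
      then show ?thesis using \<tau> by (simp add: Y_def divide_right_mono mult.commute)
    qed
    have "P (\<lambda>t. heavy m t \<and> Suc h \<le> ht t \<and> cnt \<Omega> t = x)
       \<le> 2 * b * (height_tail h * (real (Suc x) / \<tau>\<^sup>2)) + \<mu> * (b * C * real (Suc h) * (Y + W))
         + 2 * b / (\<tau> * (1 - \<mu>)) * d * height_tail h powr \<theta>"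
      unfolding \<tau>_def d_def Y_def W_def
      by (rule prob_heavy_high_step[OF b _ \<theta> D]) (use Suc in auto)
    also have "\<dots> \<le> 2 * b * (Y / \<tau>\<^sup>2) + \<mu> * (b * C * real (Suc h) * (Y + W)) + 2 * b / (\<tau> * (1 - \<mu>)) * d * W"
      using b0 d \<tau> mean_less qW qY by (intro add_mono mult_left_mono order_refl) auto
    also have "\<dots> = b * (2 / \<tau>\<^sup>2) * Y + b * C * real (Suc h) * (\<mu> * Y + \<mu> * W) + b * (2 / (\<tau> * (1 - \<mu>)) * d) * W"
      by (simp add: algebra_simps)
    also have "\<dots> \<le> b * (C * \<mu>) * Y + b * C * real (Suc h) * (\<mu> * Y + w * W) + b * (C * w) * W"
      using C2 C3 b0 C(1) YW w by (intro add_mono mult_right_mono mult_left_mono order_refl) auto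
    also have "\<dots> = b * C * real (Suc (Suc h)) * (real (Suc n) * \<mu> ^ Suc h + w ^ Suc h)"
      by (simp add: Y_def W_def algebra_simps)
    finally show ?case .
  qed
  then show ?thesis unfolding w_def using C(1) by blast
qed

text \<open>
  Realise \<open>cnt = n\<close> by \<open>k\<close> subtrees at the root whose counts add up to \<open>n\<close>, minus the contribution
  of the root. That contribution is the same for all large \<open>k\<close>, since \<open>\<Omega>\<close> is finite or cofinite,
  so the window bound for the Green function applies at a single level.
\<close>

lemma prob_cnt_ge:
  assumes \<Omega>: "finite \<Omega> \<or> finite (UNIV - \<Omega>)"
  shows "\<exists>c>0. \<exists>K. \<forall>\<^sub>F n in sequentially. \<forall>\<beta>\<ge>0.
     (\<forall>k\<in>{k1..K * n}. \<beta> \<le> pmf \<xi> k) \<longrightarrow> c * \<beta> \<le> P (\<lambda>t. cnt \<Omega> t = n)"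
proof -
  have "\<exists>k0 e. \<forall>k\<ge>k0. root_cnt k = e"
  proof -
    have "\<exists>k0. \<forall>k\<ge>k0. k \<notin> A" if "finite A" for A :: "nat set"
      using that by (auto simp: finite_nat_set_iff_bounded) (meson not_less)
    then show ?thesis using \<Omega> unfolding root_cnt_def by (metis DiffI UNIV_I)
  qed
  then obtain k0 e where e: "\<And>k. k \<ge> k0 \<Longrightarrow> root_cnt k = e" by blast
  obtain c K where c: "c > 0" and ev: "\<forall>\<^sub>F x in sequentially. c \<le> (\<Sum>k=max k0 k1..K * x. conv_pow cnt_law k x)"
    using green_window_bounded_below by blast
  from ev obtain x0 where x0: "\<And>x. x \<ge> x0 \<Longrightarrow> c \<le> (\<Sum>k=max k0 k1..K * x. conv_pow cnt_law k x)"
    by (auto simp: eventually_sequentially)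
  have "\<forall>\<^sub>F n in sequentially. \<forall>\<beta>\<ge>0. (\<forall>k\<in>{k1..K * n}. \<beta> \<le> pmf \<xi> k) \<longrightarrow> c * \<beta> \<le> P (\<lambda>t. cnt \<Omega> t = n)"
    using eventually_ge_at_top[of "x0 + e"]
  proof eventually_elim
    case (elim n)
    show ?case
    proof (intro allI impI)
      fix \<beta> :: real assume \<beta>: "\<beta> \<ge> 0" "\<forall>k\<in>{k1..K * n}. \<beta> \<le> pmf \<xi> k"
      let ?g = "\<lambda>k. measure_pmf.prob (replicate_pmf k T) {ts. True \<and> cnt \<Omega> (Node ts) = n}"
      let ?W = "{max k0 k1..K * (n - e)}"
      have sums: "(\<lambda>k. pmf \<xi> k * ?g k) sums measure_pmf.expectation \<xi> ?g"
        by (intro expectation_nat_sums integrable_pmf_prob)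
      have "c * \<beta> \<le> (\<Sum>k\<in>?W. conv_pow cnt_law k (n - e)) * \<beta>"
        using \<beta> elim by (intro mult_right_mono x0) auto
      also have "\<dots> = (\<Sum>k\<in>?W. \<beta> * conv_pow cnt_law k (n - e))" by (simp add: sum_distrib_left mult.commute)
      also have "\<dots> \<le> (\<Sum>k\<in>?W. pmf \<xi> k * ?g k)"
      proof (rule sum_mono)
        fix k assume k: "k \<in> ?W"
        have "K * (n - e) \<le> K * n" by simp
        then have "k \<le> K * n" using k le_trans[of k "K * (n - e)" "K * n"] by auto
        then have "\<beta> \<le> pmf \<xi> k" using \<beta>(2) k by auto
        moreover have "?g k = conv_pow cnt_law k (n - e)"
          using e[of k] k elim unfolding prob_cnt_Node by (simp add: prob_total)
        ultimately show "\<beta> * conv_pow cnt_law k (n - e) \<le> pmf \<xi> k * ?g k"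
          by (simp add: mult_right_mono conv_pow_nonneg)
      qed
      also have "\<dots> \<le> measure_pmf.expectation \<xi> ?g"
        using sum_le_suminf[of "\<lambda>k. pmf \<xi> k * ?g k" ?W] sums by (auto simp: sums_iff)
      also have "\<dots> = P (\<lambda>t. cnt \<Omega> t = n)" by (subst prob_tree) simp
      finally show "c * \<beta> \<le> P (\<lambda>t. cnt \<Omega> t = n)" .
    qed
  qed
  then show ?thesis using c by blast
qed

end

section \<open>Concentration and convergence of moments\<close>

lemma integrable_nat_pmf:
  fixes p :: "nat pmf" and g :: "nat \<Rightarrow> real"
  assumes "summable (\<lambda>k. pmf p k * \<bar>g k\<bar>)"
  shows "integrable (measure_pmf p) g"
proof -
  have "integrable (count_space UNIV) (\<lambda>k. pmf p k * g k)"
    using assms by (simp add: integrable_count_space_nat_iff abs_mult)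
  then have "integrable (density (count_space UNIV) (pmf p)) g"
    by (subst integrable_density) auto
  then show ?thesis by (simp add: measure_pmf_eq_density)
qed

locale condensation_gw = subcritical_gw_count +
  fixes f :: "real \<Rightarrow> real" and \<alpha> :: real
  assumes mean_pos: "\<mu> > 0" and \<alpha>: "\<alpha> > 1" and sv: "slowly_varying f"
    and pmf_eq: "\<forall>\<^sub>F n in sequentially. pmf \<xi> n = f (real n) * real n powr (-1 - \<alpha>)"
    and \<Omega>: "finite \<Omega> \<or> finite (UNIV - \<Omega>)"
begin

definition decay :: real where "decay = ln (1 / \<mu>)"

lemma decay_pos: "decay > 0"
  using mean_pos mean_less by (simp add: decay_def)

lemma mean_eq_exp: "\<mu> = exp (- decay)"
  using mean_pos by (simp add: decay_def ln_div)

abbreviation Pn :: "nat \<Rightarrow> real" where "Pn n \<equiv> P (\<lambda>t. cnt \<Omega> t = n)"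

lemma pmf_powr_bounds:
  assumes "\<delta> > 0"
  shows "\<forall>\<^sub>F k in sequentially. real k powr (-1 - \<alpha> - \<delta>) \<le> pmf \<xi> k \<and> pmf \<xi> k \<le> real k powr (-1 - \<alpha> + \<delta>)"
  using pmf_eq eventually_compose_filterlim[OF slowly_varying_powr_bounds[OF sv assms] filterlim_real_sequentially]
proof eventually_elim
  case (elim k)
  have "real k powr (-\<delta>) * real k powr (-1 - \<alpha>) \<le> pmf \<xi> k"
       "pmf \<xi> k \<le> real k powr \<delta> * real k powr (-1 - \<alpha>)"
    using elim by (auto intro: mult_right_mono)
  then show ?case by (simp add: powr_add[symmetric] algebra_simps)
qed

text \<open>
  Every positive \<open>\<theta> \<le> 1\<close> below \<open>\<alpha> - 1\<close> has this property.
\<close>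

lemma moment_finite:
  "\<exists>\<theta>. 0 < \<theta> \<and> \<theta> \<le> 1 \<and> integrable (measure_pmf \<xi>) (\<lambda>k. real k powr (1 + \<theta>))"
proof -
  define \<theta> where "\<theta> = min 1 ((\<alpha> - 1) / 4)"
  have \<theta>4: "\<theta> \<le> (\<alpha> - 1) / 4" unfolding \<theta>_def by (rule min.cobounded2)
  have \<theta>: "0 < \<theta>" "\<theta> \<le> 1" using \<alpha> by (auto simp: \<theta>_def)
  have "summable (\<lambda>k. pmf \<xi> k * \<bar>real k powr (1 + \<theta>)\<bar>)"
  proof (rule summable_comparison_test_ev)
    show "summable (\<lambda>k. real k powr (- (1 + \<alpha>) / 2))"
      using \<alpha> by (subst summable_real_powr_iff) simp
    have "(\<alpha> - 1) / 4 > 0" using \<alpha> by simp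
    from pmf_powr_bounds[OF this] eventually_gt_at_top[of 0]
    show "\<forall>\<^sub>F k in sequentially. norm (pmf \<xi> k * \<bar>real k powr (1 + \<theta>)\<bar>) \<le> real k powr (- (1 + \<alpha>) / 2)"
    proof eventually_elim
      case (elim k)
      have "pmf \<xi> k * real k powr (1 + \<theta>) \<le> real k powr (-1 - \<alpha> + (\<alpha> - 1) / 4) * real k powr (1 + \<theta>)"
        using elim by (intro mult_right_mono) auto
      also have "\<dots> = real k powr (-1 - \<alpha> + (\<alpha> - 1) / 4 + (1 + \<theta>))" by (rule powr_add[symmetric])
      also have "\<dots> \<le> real k powr (- (1 + \<alpha>) / 2)"
        using elim \<theta>4 by (intro powr_mono) (auto simp: field_simps)
      finally show ?case by (simp add: abs_mult)
    qed
  qed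
  from integrable_nat_pmf[OF this] show ?thesis using \<theta> by blast
qed

text \<open>
  For all but finitely many \<open>k\<close> up to a multiple of \<open>n\<close>, the probability of outdegree \<open>k\<close> is at least
  of order \<open>n powr (-1 - \<alpha> - \<delta> / 2)\<close>; the other half of \<open>\<delta>\<close> absorbs the constants.
\<close>

lemma prob_cnt_powr_ge:
  assumes "\<delta> > 0"
  shows "\<forall>\<^sub>F n in sequentially. real n powr (-1 - \<alpha> - \<delta>) \<le> Pn n"
proof -
  define s where "s = -1 - \<alpha> - \<delta> / 2"
  have s: "s < 0" using assms \<alpha> by (simp add: s_def)
  have "\<delta> / 2 > 0" using assms by simp
  from pmf_powr_bounds[OF this] obtain k1 where k1: "\<And>k. k \<ge> k1 \<Longrightarrow> real k powr s \<le> pmf \<xi> k"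
    by (auto simp: eventually_sequentially s_def)
  obtain c K where c: "c > 0" and ev: "\<forall>\<^sub>F n in sequentially. \<forall>\<beta>\<ge>0.
     (\<forall>k\<in>{Suc k1..K * n}. \<beta> \<le> pmf \<xi> k) \<longrightarrow> c * \<beta> \<le> Pn n"
    using prob_cnt_ge[OF \<Omega>] by blast
  have "((\<lambda>n. real n powr (- \<delta> / 2)) \<longlongrightarrow> 0) sequentially"
    using assms by real_asymp
  then have "\<forall>\<^sub>F n in sequentially. real n powr (- \<delta> / 2) < c * real (Suc K) powr s"
    using c by (intro order_tendstoD(2)) auto
  then show ?thesis using ev eventually_gt_at_top[of 0]
  proof eventually_elim
    case (elim n)
    define \<beta> where "\<beta> = (real (Suc K) * real n) powr s"
    have "\<beta> \<le> pmf \<xi> k" if k: "k \<in> {Suc k1..K * n}" for k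
    proof -
      have "k \<le> Suc K * n" using k by simp
      then have "real k \<le> real (Suc K) * real n" unfolding of_nat_mult[symmetric] of_nat_le_iff .
      then have "\<beta> \<le> real k powr s" unfolding \<beta>_def
        using k s by (intro powr_mono2') (auto simp del: of_nat_Suc)
      also have "\<dots> \<le> pmf \<xi> k" using k by (intro k1) auto
      finally show ?thesis .
    qed
    then have "c * \<beta> \<le> Pn n" using elim(2) by (simp add: \<beta>_def)
    have "real n powr (-1 - \<alpha> - \<delta>) = real n powr (- \<delta> / 2) * real n powr s"
      by (simp add: s_def powr_add[symmetric])
    also have "\<dots> \<le> c * real (Suc K) powr s * real n powr s"
      using elim by (intro mult_right_mono) auto
    also have "\<dots> = c * \<beta>" by (simp add: \<beta>_def powr_mult del: of_nat_Suc)
    finally show ?case using \<open>c * \<beta> \<le> Pn n\<close> by simp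
  qed
qed

lemma prob_cnt_pos_eventually: "\<forall>\<^sub>F n in sequentially. Pn n > 0"
proof -
  have "(1::real) > 0" by simp
  from prob_cnt_powr_ge[OF this] eventually_gt_at_top[of 0] show ?thesis
  proof eventually_elim
    case (elim n)
    have "0 < real n powr (-1 - \<alpha> - 1)" using elim(2) by simp
    from less_le_trans[OF this elim(1)] show ?case .
  qed
qed

text \<open>
  An error term need only be small compared with \<open>n powr (-1 - \<alpha> - \<delta>)\<close> to vanish after conditioning.
\<close>

lemma conditional_tendsto_0:
  assumes \<delta>: "\<delta> > 0"
    and num: "\<forall>\<^sub>F n in sequentially. 0 \<le> num n \<and> num n \<le> g n"
    and lim: "(\<lambda>n. g n * real n powr (1 + \<alpha> + \<delta>)) \<longlonglongrightarrow> 0"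
  shows "(\<lambda>n. num n / Pn n) \<longlonglongrightarrow> 0"
proof (rule tendsto_sandwich[OF _ _ tendsto_const lim])
  show "\<forall>\<^sub>F n in sequentially. 0 \<le> num n / Pn n"
    using num prob_cnt_pos_eventually by eventually_elim simp
  show "\<forall>\<^sub>F n in sequentially. num n / Pn n \<le> g n * real n powr (1 + \<alpha> + \<delta>)"
    using num prob_cnt_powr_ge[OF \<delta>] eventually_gt_at_top[of 0]
  proof eventually_elim
    case (elim n)
    have "num n / Pn n \<le> g n / real n powr (-1 - \<alpha> - \<delta>)"
      using elim by (intro frac_le) auto
    also have "\<dots> = g n * real n powr (1 + \<alpha> + \<delta>)"
      using powr_minus[of "real n" "1 + \<alpha> + \<delta>"] by (simp add: field_simps)
    finally show ?case .
  qed
qed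

text \<open>
  The outdegree from which a vertex counts as heavy.
\<close>

definition cutoff :: "real \<Rightarrow> nat \<Rightarrow> nat" where "cutoff \<eta> n = nat \<lceil>real n powr (1 - \<eta>)\<rceil>"

lemma cutoff_ge: "real n powr (1 - \<eta>) \<le> real (cutoff \<eta> n)"
  unfolding cutoff_def by linarith

lemma cutoff_le: "real (cutoff \<eta> n) \<le> real n powr (1 - \<eta>) + 1"
  unfolding cutoff_def using powr_ge_zero[of "real n" "1 - \<eta>"] by linarith

lemma cutoff_at_top: "\<eta> < 1 \<Longrightarrow> filterlim (cutoff \<eta>) at_top sequentially"
proof -
  assume \<eta>: "\<eta> < 1"
  have "filterlim (\<lambda>n. real n powr (1 - \<eta>)) at_top sequentially" using \<eta> by real_asymp
  then have "filterlim (\<lambda>n. real (cutoff \<eta> n)) at_top sequentially"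
    by (rule filterlim_at_top_mono) (simp add: cutoff_ge)
  then show ?thesis by (simp add: filterlim_sequentially_iff_filterlim_real)
qed

lemma prob_light_cutoff:
  assumes \<eta>: "0 < \<eta>" "\<eta> < 1"
  shows "\<forall>\<^sub>F n in sequentially. P (\<lambda>t. \<not> heavy (cutoff \<eta> n) t \<and> cnt \<Omega> t = n)
     \<le> exp (1 - (1 - \<mu>) / 4 * real n powr \<eta>)"
  using eventually_compose_filterlim[OF prob_light_large cutoff_at_top[OF \<eta>(2)]] eventually_gt_at_top[of 0]
proof eventually_elim
  case (elim n)
  let ?m = "real (cutoff \<eta> n)"
  have x1: "real n powr (1 - \<eta>) \<ge> 1" using elim \<eta> by (intro ge_one_powr_ge_zero) auto
  have m: "?m \<ge> 1" "?m \<le> 2 * real n powr (1 - \<eta>)"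
    using cutoff_ge[of n \<eta>] cutoff_le[of \<eta> n] x1 by linarith+
  have "P (\<lambda>t. \<not> heavy (cutoff \<eta> n) t \<and> cnt \<Omega> t = n) \<le> P (\<lambda>t. \<not> heavy (cutoff \<eta> n) t \<and> n \<le> cnt UNIV t)"
    by (rule prob_mono) (use cnt_le_cnt_UNIV in auto)
  also have "\<dots> \<le> exp ((1 - (1 - \<mu>) / 2 * real n) / ?m)" using elim by blast
  also have "(1 - (1 - \<mu>) / 2 * real n) / ?m \<le> 1 - (1 - \<mu>) / 4 * real n powr \<eta>"
  proof -
    have "real n powr \<eta> * ?m \<le> real n powr \<eta> * (2 * real n powr (1 - \<eta>))"
      using m by (intro mult_left_mono) auto
    also have "\<dots> = 2 * real n" using elim by (simp add: powr_add[symmetric])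
    finally have *: "(1 - \<mu>) / 4 * (real n powr \<eta> * ?m) \<le> (1 - \<mu>) / 4 * (2 * real n)"
      using mean_less by (intro mult_left_mono) auto
    have "1 - (1 - \<mu>) / 2 * real n \<le> (1 - (1 - \<mu>) / 4 * real n powr \<eta>) * ?m"
    proof -
      have "(1 - (1 - \<mu>) / 4 * real n powr \<eta>) * ?m = ?m - (1 - \<mu>) / 4 * (real n powr \<eta> * ?m)"
        by (simp add: algebra_simps)
      moreover have "(1 - \<mu>) / 4 * (2 * real n) = (1 - \<mu>) / 2 * real n" by simp
      ultimately show ?thesis using * m(1) by linarith
    qed
    then show ?thesis using m by (simp add: pos_divide_le_eq)
  qed
  finally show ?case by simp
qed

lemma prob_height_below_ratio:
  assumes \<epsilon>: "0 < \<epsilon>" "\<epsilon> < 1"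
  shows "(\<lambda>n. P (\<lambda>t. cnt \<Omega> t = n \<and> real (ht t) < (1 - \<epsilon>) * (ln (real n) / decay)) / Pn n) \<longlonglongrightarrow> 0"
proof -
  \<comment> \<open>chosen so that \<open>\<nu> ^ h\<close> is about \<open>n powr (- (1 - \<epsilon> / 2))\<close>, still larger than \<open>1 / cutoff \<eta> n\<close>\<close>
  define r where "r = (1 - \<epsilon> / 2) / (1 - \<epsilon>)"
  define \<nu> where "\<nu> = exp (- decay * r)"
  define \<eta> where "\<eta> = \<epsilon> / 4"
  have r: "r > 1" "r * (1 - \<epsilon>) = 1 - \<epsilon> / 2" using \<epsilon> by (auto simp: r_def field_simps)
  have \<eta>: "0 < \<eta>" "\<eta> < 1" using \<epsilon> by (auto simp: \<eta>_def)
  have "exp (- decay * r) < exp (- decay)" using decay_pos r by simp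
  then have \<nu>: "0 < \<nu>" "\<nu> < \<mu>" unfolding mean_eq_exp[symmetric] by (auto simp: \<nu>_def)
  obtain c where c: "c > 0" "\<And>h. height_tail h \<ge> c * \<nu> ^ h" using height_tail_ge[OF \<nu>] by blast
  define a where "a = c * \<nu>"
  define d where "d = (1 - \<mu>) / 4"
  have a: "a > 0" and d: "d > 0" using c \<nu> mean_less by (auto simp: a_def d_def)
  show ?thesis
  proof (rule conditional_tendsto_0[where \<delta> = 1])
    show "\<forall>\<^sub>F n in sequentially. 0 \<le> P (\<lambda>t. cnt \<Omega> t = n \<and> real (ht t) < (1 - \<epsilon>) * (ln (real n) / decay))
       \<and> P (\<lambda>t. cnt \<Omega> t = n \<and> real (ht t) < (1 - \<epsilon>) * (ln (real n) / decay))
         \<le> exp (1 - d * real n powr \<eta>) + exp (- a * real n powr \<eta>) / (1 - \<mu>)"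
      using prob_light_cutoff[OF \<eta>] eventually_gt_at_top[of 1]
    proof eventually_elim
      case (elim n)
      let ?y = "(1 - \<epsilon>) * (ln (real n) / decay)" and ?m = "cutoff \<eta> n"
      define h where "h = nat \<lceil>?y\<rceil>"
      have y: "?y \<ge> 0" using \<epsilon> decay_pos elim by simp
      then have h: "?y \<le> real h" "real h \<le> ?y + 1" unfolding h_def by linarith+
      let ?q = "height_tail h"
      have "a * real n powr (- (1 - \<epsilon> / 2)) \<le> ?q"
      proof -
        have "real h * (decay * r) \<le> (?y + 1) * (decay * r)" using h decay_pos r by (intro mult_right_mono) auto
        also have "\<dots> = ln (real n) * (r * (1 - \<epsilon>)) + decay * r" using decay_pos by (simp add: field_simps)
        finally have "exp (- (ln (real n) * (1 - \<epsilon> / 2)) - decay * r) \<le> exp (- (real h * (decay * r)))"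
          unfolding r(2) by simp
        also have "\<dots> = \<nu> ^ h" by (simp add: \<nu>_def exp_of_nat_mult[symmetric])
        also have "exp (- (ln (real n) * (1 - \<epsilon> / 2)) - decay * r) = \<nu> * real n powr (- (1 - \<epsilon> / 2))"
          using elim by (simp add: \<nu>_def powr_def exp_add[symmetric] exp_diff exp_minus algebra_simps)
             (simp add: exp_add exp_diff exp_minus field_simps)
        finally have "c * (\<nu> * real n powr (- (1 - \<epsilon> / 2))) \<le> c * \<nu> ^ h" using c by (intro mult_left_mono) auto
        then show ?thesis using c(2)[of h] by (simp add: a_def mult_ac)
      qed
      then have "a * real n powr (- (1 - \<epsilon> / 2)) * real n powr (1 - \<eta>) \<le> ?q * real ?m"
        using cutoff_ge[of n \<eta>] by (intro mult_mono) auto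
      moreover have "real n powr (- (1 - \<epsilon> / 2)) * real n powr (1 - \<eta>) = real n powr \<eta>"
        by (simp add: powr_add[symmetric] \<eta>_def)
      ultimately have qm: "a * real n powr \<eta> \<le> ?q * real ?m" by (simp add: mult.assoc)
      have "(1 - ?q) ^ ?m \<le> exp (- ?q) ^ ?m" using exp_ge_add_one_self[of "- ?q"] by (intro power_mono) auto
      also have "\<dots> = exp (- (?q * real ?m))" by (simp add: exp_of_nat_mult[symmetric] mult.commute)
      also have "\<dots> \<le> exp (- a * real n powr \<eta>)" using qm by simp
      finally have pw: "(1 - ?q) ^ ?m \<le> exp (- a * real n powr \<eta>)" .
      have "P (\<lambda>t. cnt \<Omega> t = n \<and> real (ht t) < ?y)
          \<le> P (\<lambda>t. (\<not> heavy ?m t \<and> cnt \<Omega> t = n) \<or> (heavy ?m t \<and> ht t < h))"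
        by (rule prob_mono) (use h in auto)
      also have "\<dots> \<le> P (\<lambda>t. \<not> heavy ?m t \<and> cnt \<Omega> t = n) + P (\<lambda>t. heavy ?m t \<and> ht t < h)"
        by (rule prob_Un_le)
      also have "\<dots> \<le> exp (1 - d * real n powr \<eta>) + exp (- a * real n powr \<eta>) / (1 - \<mu>)"
      proof (rule add_mono)
        show "P (\<lambda>t. \<not> heavy ?m t \<and> cnt \<Omega> t = n) \<le> exp (1 - d * real n powr \<eta>)"
          using elim by (simp add: d_def)
        have "P (\<lambda>t. heavy ?m t \<and> ht t < h) \<le> (1 - ?q) ^ ?m / (1 - \<mu>)" by (rule prob_heavy_low)
        also have "\<dots> \<le> exp (- a * real n powr \<eta>) / (1 - \<mu>)" using pw mean_less by (intro divide_right_mono) auto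
        finally show "P (\<lambda>t. heavy ?m t \<and> ht t < h) \<le> exp (- a * real n powr \<eta>) / (1 - \<mu>)" .
      qed
      finally show ?case by simp
    qed
    have "(\<lambda>n. exp (1 - d * real n powr \<eta>) * real n powr (1 + \<alpha> + 1)) \<longlonglongrightarrow> 0"
      using d \<eta>(1) by real_asymp
    moreover have "(\<lambda>n. exp (- a * real n powr \<eta>) * real n powr (1 + \<alpha> + 1)) \<longlonglongrightarrow> 0"
      using a \<eta>(1) by real_asymp
    ultimately have "(\<lambda>n. exp (1 - d * real n powr \<eta>) * real n powr (1 + \<alpha> + 1)
        + exp (- a * real n powr \<eta>) * real n powr (1 + \<alpha> + 1) * (1 / (1 - \<mu>))) \<longlonglongrightarrow> 0 + 0 * (1 / (1 - \<mu>))"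
      by (intro tendsto_add tendsto_mult tendsto_const)
    then show "(\<lambda>n. (exp (1 - d * real n powr \<eta>) + exp (- a * real n powr \<eta>) / (1 - \<mu>)) * real n powr (1 + \<alpha> + 1)) \<longlonglongrightarrow> 0"
      by (simp add: distrib_right)
  qed simp
qed

text \<open>
  The heavy part is of order \<open>ln n * n powr (- \<kappa>)\<close> relative to \<open>n powr (-1 - \<alpha>)\<close>, up to a loss of
  \<open>n powr (\<eta> * (3 + \<alpha>))\<close>: the cutoff exponent \<open>1 - \<eta>\<close> and the slowly varying factor cost together
  \<open>\<eta> * (2 + \<alpha>)\<close>, and the lower bound for \<open>P (cnt = n)\<close> costs \<open>\<eta>\<close>. This fixes the choice of \<open>\<eta>\<close>.
\<close>

lemma prob_height_above_ratio:
  assumes \<epsilon>: "0 < \<epsilon>" "\<epsilon> < 1"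
  shows "(\<lambda>n. P (\<lambda>t. cnt \<Omega> t = n \<and> real (ht t) > (1 + \<epsilon>) * (ln (real n) / decay)) / Pn n) \<longlonglongrightarrow> 0"
proof -
  obtain \<theta> where \<theta>: "0 < \<theta>" "\<theta> \<le> 1" "integrable (measure_pmf \<xi>) (\<lambda>k. real k powr (1 + \<theta>))"
    using moment_finite by blast
  obtain C where C: "C \<ge> 0" and bound: "\<And>m b n h x. (\<And>k. k \<ge> m \<Longrightarrow> pmf \<xi> k \<le> b) \<Longrightarrow> x \<le> n \<Longrightarrow>
     P (\<lambda>t. heavy m t \<and> h \<le> ht t \<and> cnt \<Omega> t = x)
       \<le> b * C * real (Suc h) * (real (Suc n) * \<mu> ^ h + (\<mu> powr \<theta>) ^ h)"
    using prob_heavy_high[OF \<theta>(1,2) mean_pos \<theta>(3)] by blast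
  define \<kappa> where "\<kappa> = min \<epsilon> \<theta>"
  have \<kappa>: "0 < \<kappa>" "\<kappa> < 1" "\<kappa> \<le> \<epsilon>" "\<kappa> \<le> \<theta>" using \<epsilon> \<theta> by (auto simp: \<kappa>_def)
  define \<eta> where "\<eta> = \<kappa> / (2 * (3 + \<alpha>))"
  have \<eta>: "0 < \<eta>" "\<eta> < 1" "\<eta> * (3 + \<alpha>) = \<kappa> / 2" using \<kappa> \<alpha> by (auto simp: \<eta>_def field_simps)
  define d where "d = (1 - \<mu>) / 4"
  have d: "d > 0" using mean_less by (simp add: d_def)
  define A where "A = (1 + \<epsilon>) / decay"
  have A: "A > 0" using decay_pos \<epsilon> by (simp add: A_def)
  define s where "s = -1 - \<alpha> + \<eta>"
  have s: "s < 0" using \<eta> \<alpha> by (simp add: s_def)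
  obtain k1 where k1: "\<And>k. k \<ge> k1 \<Longrightarrow> pmf \<xi> k \<le> real k powr s"
    using pmf_powr_bounds[OF \<eta>(1)] by (auto simp: eventually_sequentially s_def)
  let ?g = "\<lambda>n. exp (1 - d * real n powr \<eta>)
     + real n powr ((1 - \<eta>) * s) * C * (A * ln (real n) + 2) * (3 * real n powr (- \<kappa>))"
  show ?thesis
  proof (rule conditional_tendsto_0[where \<delta> = \<eta> and g = ?g])
    show "\<forall>\<^sub>F n in sequentially. 0 \<le> P (\<lambda>t. cnt \<Omega> t = n \<and> real (ht t) > (1 + \<epsilon>) * (ln (real n) / decay))
       \<and> P (\<lambda>t. cnt \<Omega> t = n \<and> real (ht t) > (1 + \<epsilon>) * (ln (real n) / decay)) \<le> ?g n"
      using prob_light_cutoff[OF \<eta>(1,2)] eventually_gt_at_top[of 1]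
        eventually_compose_filterlim[OF eventually_ge_at_top[of k1] cutoff_at_top[OF \<eta>(2)]]
    proof eventually_elim
      case (elim n)
      let ?y = "(1 + \<epsilon>) * (ln (real n) / decay)" and ?m = "cutoff \<eta> n"
      define h where "h = nat \<lceil>?y\<rceil>"
      have n: "real n \<ge> 1" using elim by simp
      have y: "?y \<ge> 0" using \<epsilon> decay_pos elim by simp
      then have h: "?y \<le> real h" "real h \<le> ?y + 1" unfolding h_def by linarith+
      have hA: "real (Suc h) \<le> A * ln (real n) + 2" using h by (simp add: A_def)
      have muh: "\<mu> ^ h \<le> real n powr (- (1 + \<epsilon>))"
      proof -
        have "decay * ?y \<le> decay * real h" using h decay_pos by (intro mult_left_mono) auto
        also have "decay * ?y = (1 + \<epsilon>) * ln (real n)" using decay_pos by simp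
        finally have "- (decay * real h) \<le> - (1 + \<epsilon>) * ln (real n)" unfolding mult_minus_left by linarith
        then have "exp (- (decay * real h)) \<le> exp (- (1 + \<epsilon>) * ln (real n))" unfolding exp_le_cancel_iff .
        moreover have "exp (- decay) ^ h = exp (- (decay * real h))"
          by (simp add: exp_of_nat_mult[symmetric] mult.commute)
        then have "\<mu> ^ h = exp (- (decay * real h))" unfolding mean_eq_exp[symmetric] .
        ultimately show ?thesis using elim by (simp add: powr_def)
      qed
      have wh: "(\<mu> powr \<theta>) ^ h \<le> real n powr (- \<kappa>)"
      proof -
        have "(\<mu> powr \<theta>) ^ h = (\<mu> ^ h) powr \<theta>"
          using mean_pos by (simp add: powr_power powr_powr mult.commute flip: powr_realpow)
        also have "\<dots> \<le> (real n powr (- (1 + \<epsilon>))) powr \<theta>" using muh \<theta> mean_pos by (intro powr_mono2) auto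
        also have "\<dots> = real n powr (- (1 + \<epsilon>) * \<theta>)" by (simp add: powr_powr)
        also have "\<dots> \<le> real n powr (- \<kappa>)"
        proof (rule powr_mono[OF _ n])
          have "1 * \<theta> \<le> (1 + \<epsilon>) * \<theta>" using \<epsilon> \<theta> by (intro mult_right_mono) auto
          then show "- (1 + \<epsilon>) * \<theta> \<le> - \<kappa>" using \<kappa>(4) unfolding mult_minus_left by linarith
        qed
        finally show ?thesis .
      qed
      have nmu: "real (Suc n) * \<mu> ^ h \<le> 2 * real n powr (- \<kappa>)"
      proof -
        have "real (Suc n) * \<mu> ^ h \<le> (2 * real n) * real n powr (- (1 + \<epsilon>))"
          using muh n mean_pos by (intro mult_mono) auto
        also have "\<dots> = 2 * real n powr (- \<epsilon>)"
          using n powr_add[of "real n" 1 "- (1 + \<epsilon>)"] by simp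
        also have "\<dots> \<le> 2 * real n powr (- \<kappa>)" using n \<kappa> by (intro mult_left_mono powr_mono) auto
        finally show ?thesis .
      qed
      define b where "b = real n powr ((1 - \<eta>) * s)"
      have b: "pmf \<xi> k \<le> b" if "k \<ge> ?m" for k
      proof -
        have "real n powr (1 - \<eta>) \<le> real k" using that cutoff_ge[of n \<eta>] by linarith
        then have "real k powr s \<le> (real n powr (1 - \<eta>)) powr s"
          using n s by (intro powr_mono2') auto
        then show ?thesis using k1[of k] that elim by (simp add: b_def powr_powr)
      qed
      have b0: "b \<ge> 0" by (simp add: b_def)
      have "P (\<lambda>t. cnt \<Omega> t = n \<and> real (ht t) > ?y)
          \<le> P (\<lambda>t. (\<not> heavy ?m t \<and> cnt \<Omega> t = n) \<or> (heavy ?m t \<and> h \<le> ht t \<and> cnt \<Omega> t = n))"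
      proof (rule prob_mono)
        fix t assume t: "cnt \<Omega> t = n \<and> real (ht t) > ?y"
        then have "h \<le> ht t" unfolding h_def by linarith
        then show "(\<not> heavy ?m t \<and> cnt \<Omega> t = n) \<or> (heavy ?m t \<and> h \<le> ht t \<and> cnt \<Omega> t = n)"
          using t by auto
      qed
      also have "\<dots> \<le> P (\<lambda>t. \<not> heavy ?m t \<and> cnt \<Omega> t = n) + P (\<lambda>t. heavy ?m t \<and> h \<le> ht t \<and> cnt \<Omega> t = n)"
        by (rule prob_Un_le)
      also have "\<dots> \<le> exp (1 - d * real n powr \<eta>) + b * C * real (Suc h) * (real (Suc n) * \<mu> ^ h + (\<mu> powr \<theta>) ^ h)"
        using elim(1) bound[OF b order_refl] by (intro add_mono) (auto simp: d_def)
      also have "\<dots> \<le> exp (1 - d * real n powr \<eta>) + b * C * (A * ln (real n) + 2) * (2 * real n powr (- \<kappa>) + real n powr (- \<kappa>))"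
      proof -
        have "0 \<le> A * ln (real n) + 2" using A n by (intro add_nonneg_nonneg mult_nonneg_nonneg) auto
        then show ?thesis
          using mean_pos b0 C
          by (intro add_left_mono mult_mono[OF mult_left_mono[OF hA] add_mono[OF nmu wh]]) auto
      qed
      finally show ?case by (simp add: b_def)
    qed
    have e1: "(\<lambda>n. exp (1 - d * real n powr \<eta>) * real n powr (1 + \<alpha> + \<eta>)) \<longlonglongrightarrow> 0"
      using d \<eta>(1) by real_asymp
    have e2: "(\<lambda>n. C * (A * ln (real n) + 2) * (3 * real n powr (- \<kappa> / 2))) \<longlonglongrightarrow> 0"
      using \<kappa>(1) by real_asymp
    have "(\<lambda>n. real n powr ((1 - \<eta>) * s) * C * (A * ln (real n) + 2) * (3 * real n powr (- \<kappa>)) * real n powr (1 + \<alpha> + \<eta>)) \<longlonglongrightarrow> 0"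
    proof (rule tendsto_sandwich[OF _ _ tendsto_const e2])
      show "\<forall>\<^sub>F n in sequentially. 0 \<le> real n powr ((1 - \<eta>) * s) * C * (A * ln (real n) + 2) * (3 * real n powr (- \<kappa>)) * real n powr (1 + \<alpha> + \<eta>)"
        using eventually_gt_at_top[of 0]
        by eventually_elim (use C A in \<open>intro mult_nonneg_nonneg add_nonneg_nonneg, auto\<close>)
      show "\<forall>\<^sub>F n in sequentially. real n powr ((1 - \<eta>) * s) * C * (A * ln (real n) + 2) * (3 * real n powr (- \<kappa>)) * real n powr (1 + \<alpha> + \<eta>)
         \<le> C * (A * ln (real n) + 2) * (3 * real n powr (- \<kappa> / 2))"
        using eventually_gt_at_top[of 0]
      proof eventually_elim
        case (elim n)
        have n: "real n \<ge> 1" using elim by simp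
        have "(1 - \<eta>) * s + (- \<kappa>) + (1 + \<alpha> + \<eta>) \<le> - \<kappa> / 2"
        proof -
          have "(1 - \<eta>) * s + (1 + \<alpha> + \<eta>) = \<eta> * (3 + \<alpha>) - \<eta> * \<eta>" by (simp add: s_def algebra_simps)
          then show ?thesis unfolding \<eta>(3) using mult_nonneg_nonneg[of \<eta> \<eta>] \<eta>(1) by linarith
        qed
        then have "real n powr ((1 - \<eta>) * s + (- \<kappa>) + (1 + \<alpha> + \<eta>)) \<le> real n powr (- \<kappa> / 2)" using n by (rule powr_mono)
        then have "real n powr ((1 - \<eta>) * s) * real n powr (- \<kappa>) * real n powr (1 + \<alpha> + \<eta>) \<le> real n powr (- \<kappa> / 2)"
          by (simp only: powr_add)
        then have "(C * (A * ln (real n) + 2) * 3) * (real n powr ((1 - \<eta>) * s) * real n powr (- \<kappa>) * real n powr (1 + \<alpha> + \<eta>))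
            \<le> (C * (A * ln (real n) + 2) * 3) * real n powr (- \<kappa> / 2)"
          using C A n by (intro mult_left_mono mult_nonneg_nonneg add_nonneg_nonneg) auto
        then show ?case by (simp only: mult_ac)
      qed
    qed
    from tendsto_add[OF e1 this]
    show "(\<lambda>n. ?g n * real n powr (1 + \<alpha> + \<eta>)) \<longlonglongrightarrow> 0" by (simp add: distrib_right)
  qed (use \<eta> in simp)
qed

text \<open>
  The tail \<open>exp (- decay * h)\<close> of the height beats \<open>exp (decay / 2 * h)\<close> with any power of \<open>h\<close>.
\<close>

lemma exponential_moment_height:
  "integrable (measure_pmf T) (\<lambda>t. real (ht t) powr p * exp (decay / 2 * real (ht t)))"
proof -
  have "summable (\<lambda>h. pmf (map_pmf ht T) h * \<bar>real h powr p * exp (decay / 2 * real h)\<bar>)"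
  proof (rule summable_comparison_test_bigo)
    show "summable (\<lambda>h. norm (real h powr (-2)))" by (simp add: summable_real_powr_iff)
    have "(\<lambda>h. pmf (map_pmf ht T) h * \<bar>real h powr p * exp (decay / 2 * real h)\<bar>) \<in> O(\<lambda>h. real h powr p * exp (- (decay / 2) * real h))"
    proof (rule bigoI[where c = 1], intro always_eventually allI)
      fix h
      have "pmf (map_pmf ht T) h \<le> height_tail h"
        unfolding pmf_map by (rule measure_pmf.finite_measure_mono) auto
      also have "\<dots> \<le> \<mu> ^ h" by (rule height_tail_le)
      also have "\<dots> = exp (- decay * real h)"
      proof -
        have "exp (- decay) ^ h = exp (- decay * real h)" by (simp add: exp_of_nat_mult[symmetric] mult.commute)
        then show ?thesis unfolding mean_eq_exp[symmetric] .
      qed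
      finally have "pmf (map_pmf ht T) h * (real h powr p * exp (decay / 2 * real h)) \<le> exp (- decay * real h) * (real h powr p * exp (decay / 2 * real h))"
        by (intro mult_right_mono) auto
      also have "\<dots> = real h powr p * (exp (- decay * real h) * exp (decay / 2 * real h))" by (simp only: mult_ac)
      also have "exp (- decay * real h) * exp (decay / 2 * real h) = exp (- (decay / 2) * real h)"
        unfolding exp_add[symmetric] by (rule arg_cong[where f = exp]) (simp add: field_simps)
      finally show "norm (pmf (map_pmf ht T) h * \<bar>real h powr p * exp (decay / 2 * real h)\<bar>) \<le> 1 * norm (real h powr p * exp (- (decay / 2) * real h))"
        by (simp add: abs_mult)
    qed
    also have "(\<lambda>h. real h powr p * exp (- (decay / 2) * real h)) \<in> O(\<lambda>h. real h powr (-2))"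
    proof -
      define l where "l = decay / 2"
      have "l > 0" using decay_pos by (simp add: l_def)
      then have "(\<lambda>h. real h powr p * exp (- l * real h)) \<in> O(\<lambda>h. real h powr (-2))" by real_asymp
      then show ?thesis by (simp add: l_def)
    qed
    finally show "(\<lambda>h. pmf (map_pmf ht T) h * \<bar>real h powr p * exp (decay / 2 * real h)\<bar>) \<in> O(\<lambda>h. real h powr (-2))" .
  qed
  from integrable_nat_pmf[OF this] show ?thesis by (simp add: integrable_map_pmf_eq)
qed

lemma integrable_height_powr:
  "integrable (measure_pmf T) (\<lambda>t. if Q t then (real (ht t) / c) powr p else 0)"
proof (rule Bochner_Integration.integrable_bound)
  show "integrable (measure_pmf T) (\<lambda>t. real (ht t) powr p * exp (decay / 2 * real (ht t)) * (1 / c) powr p)"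
    by (intro integrable_mult_left exponential_moment_height)
  show "AE t in T. norm (if Q t then (real (ht t) / c) powr p else 0)
     \<le> norm (real (ht t) powr p * exp (decay / 2 * real (ht t)) * (1 / c) powr p)"
  proof (intro always_eventually allI)
    fix t
    have "exp (decay / 2 * real (ht t)) \<ge> 1" using decay_pos by simp
    then have "real (ht t) powr p * 1 * (1 / c) powr p \<le> real (ht t) powr p * exp (decay / 2 * real (ht t)) * (1 / c) powr p"
      by (intro mult_right_mono mult_left_mono) auto
    moreover have "(real (ht t) / c) powr p = real (ht t) powr p * (1 / c) powr p"
      using powr_mult[of "real (ht t)" "1 / c" p] by simp
    ultimately show "norm (if Q t then (real (ht t) / c) powr p else 0)
     \<le> norm (real (ht t) powr p * exp (decay / 2 * real (ht t)) * (1 / c) powr p)" by simp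
  qed
qed simp

text \<open>
  Uniform integrability. On \<open>ht > M * ln n\<close> the exponential moment gains the factor
  \<open>exp (- decay / 2 * M * ln n)\<close>, which is smaller than \<open>P (cnt = n)\<close> when \<open>M\<close> is large.
\<close>

lemma moment_large_height_ratio:
  assumes p: "p \<ge> 0"
  shows "\<exists>M>0. (\<lambda>n. measure_pmf.expectation T (\<lambda>t. if cnt \<Omega> t = n \<and> real (ht t) > M * ln (real n)
      then (real (ht t) / ln (real n)) powr p else 0) / Pn n) \<longlonglongrightarrow> 0"
proof -
  \<comment> \<open>makes \<open>exp (- decay / 2 * M * ln n) = n powr (- (\<alpha> + 3))\<close>\<close>
  define M where "M = 2 * (\<alpha> + 3) / decay"
  have M: "M > 0" using decay_pos \<alpha> by (simp add: M_def)
  define B where "B = measure_pmf.expectation T (\<lambda>t. real (ht t) powr p * exp (decay / 2 * real (ht t)))"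
  have "(\<lambda>n. measure_pmf.expectation T (\<lambda>t. if cnt \<Omega> t = n \<and> real (ht t) > M * ln (real n)
      then (real (ht t) / ln (real n)) powr p else 0) / Pn n) \<longlonglongrightarrow> 0"
  proof (rule conditional_tendsto_0[where \<delta> = 1])
    show "\<forall>\<^sub>F n in sequentially. 0 \<le> measure_pmf.expectation T (\<lambda>t. if cnt \<Omega> t = n \<and> real (ht t) > M * ln (real n)
        then (real (ht t) / ln (real n)) powr p else 0)
      \<and> measure_pmf.expectation T (\<lambda>t. if cnt \<Omega> t = n \<and> real (ht t) > M * ln (real n)
        then (real (ht t) / ln (real n)) powr p else 0) \<le> B * real n powr (- (\<alpha> + 3))"
      using eventually_ge_at_top[of 3]
    proof eventually_elim
      case (elim n)
      have ln1: "ln (real n) \<ge> 1"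
      proof -
        have "exp 1 \<le> real n" using elim exp_le by linarith
        then show ?thesis using elim by (simp add: ln_ge_iff)
      qed
      have pw: "real n powr (- (\<alpha> + 3)) = exp (- (decay / 2 * (M * ln (real n))))"
      proof -
        have "decay / 2 * (M * ln (real n)) = (\<alpha> + 3) * ln (real n)"
          using decay_pos by (simp add: M_def field_simps)
        then show ?thesis using elim by (simp add: powr_def algebra_simps)
      qed
      let ?F = "\<lambda>t. if cnt \<Omega> t = n \<and> real (ht t) > M * ln (real n) then (real (ht t) / ln (real n)) powr p else 0"
      have "measure_pmf.expectation T ?F
        \<le> measure_pmf.expectation T (\<lambda>t. real (ht t) powr p * exp (decay / 2 * real (ht t)) * real n powr (- (\<alpha> + 3)))"
      proof (intro integral_mono integrable_height_powr integrable_mult_left exponential_moment_height)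
        fix t
        show "?F t \<le> real (ht t) powr p * exp (decay / 2 * real (ht t)) * real n powr (- (\<alpha> + 3))"
        proof (cases "cnt \<Omega> t = n \<and> real (ht t) > M * ln (real n)")
          case True
          have "decay / 2 * (M * ln (real n)) \<le> decay / 2 * real (ht t)"
            using True decay_pos by (intro mult_left_mono) auto
          then have e: "1 \<le> exp (decay / 2 * real (ht t)) * real n powr (- (\<alpha> + 3))"
            unfolding pw by (simp add: exp_add[symmetric])
          have "real (ht t) / ln (real n) \<le> real (ht t) / 1"
            using ln1 by (intro divide_left_mono) auto
          then have "(real (ht t) / ln (real n)) powr p \<le> real (ht t) powr p"
            using ln1 p by (intro powr_mono2) auto
          also have "\<dots> * 1 \<le> real (ht t) powr p * (exp (decay / 2 * real (ht t)) * real n powr (- (\<alpha> + 3)))"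
            using e by (intro mult_left_mono) auto
          finally show ?thesis using True by (simp add: mult.assoc)
        next
          case False
          then have "?F t = 0" by (simp only: if_False)
          then show ?thesis by simp
        qed
      qed
      also have "\<dots> = B * real n powr (- (\<alpha> + 3))" by (simp add: B_def)
      finally show ?case by (auto intro!: integral_nonneg_AE)
    qed
    show "(\<lambda>n. B * real n powr (- (\<alpha> + 3)) * real n powr (1 + \<alpha> + 1)) \<longlonglongrightarrow> 0"
      by real_asymp
  qed simp
  then show ?thesis using M by blast
qed

text \<open>
  The conditioned value of \<open>ht / ln n\<close> lies within the factors \<open>1 - \<epsilon>\<close> and \<open>1 + \<epsilon>\<close> of the limit
  with high probability. The exceptional values contribute at most \<open>M powr p\<close> times a small probability
  up to \<open>M\<close>, and what lies beyond \<open>M\<close> is negligible by the previous lemma.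
\<close>

lemma conditioned_height_moment:
  assumes p: "p > 0"
  shows "(\<lambda>n. measure_pmf.expectation T (\<lambda>t. if cnt \<Omega> t = n then (real (ht t) / ln (real n)) powr p else 0) / Pn n)
     \<longlonglongrightarrow> (1 / decay) powr p"
proof -
  obtain M where M: "M > 0" and tail: "(\<lambda>n. measure_pmf.expectation T (\<lambda>t. if cnt \<Omega> t = n \<and> real (ht t) > M * ln (real n)
      then (real (ht t) / ln (real n)) powr p else 0) / Pn n) \<longlonglongrightarrow> 0"
    using moment_large_height_ratio[of p] p by auto
  let ?l = "(1 / decay) powr p"
  let ?X = "\<lambda>n t. (real (ht t) / ln (real n)) powr p"
  show ?thesis
  proof (rule LIMSEQ_I)
    fix e0 :: real assume e0: "e0 > 0"
    define e where "e = e0 / 4"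
    have e: "e > 0" using e0 by (simp add: e_def)
    have "((\<lambda>x. ((1 + x) / decay) powr p) \<longlongrightarrow> ((1 + 0) / decay) powr p) (at_right 0)"
      by (intro tendsto_intros) (use decay_pos in auto)
    then have "\<forall>\<^sub>F x in at_right 0. ((1 + x) / decay) powr p < ?l + e"
      using e by (intro order_tendstoD(2)) auto
    moreover have "((\<lambda>x. ((1 - x) / decay) powr p) \<longlongrightarrow> ((1 - 0) / decay) powr p) (at_right 0)"
      by (intro tendsto_intros) (use decay_pos in auto)
    then have "\<forall>\<^sub>F x in at_right 0. ((1 - x) / decay) powr p > ?l - e"
      using e by (intro order_tendstoD(1)) auto
    moreover have "\<forall>\<^sub>F x in at_right (0::real). 0 < x \<and> x < 1"
      using eventually_at_right_real[of 0 1] by (auto elim: eventually_mono)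
    ultimately have "\<forall>\<^sub>F x in at_right 0. ((1 + x) / decay) powr p < ?l + e \<and> ((1 - x) / decay) powr p > ?l - e \<and> 0 < x \<and> x < 1"
      by eventually_elim auto
    from eventually_happens'[OF trivial_limit_at_right_real this] obtain \<epsilon>
      where \<epsilon>: "((1 + \<epsilon>) / decay) powr p < ?l + e" "((1 - \<epsilon>) / decay) powr p > ?l - e" "0 < \<epsilon>" "\<epsilon> < 1" by blast
    have M0: "M powr p > 0" and l0: "?l > 0" using M decay_pos by auto
    have "\<forall>\<^sub>F n in sequentially. P (\<lambda>t. cnt \<Omega> t = n \<and> real (ht t) > (1 + \<epsilon>) * (ln (real n) / decay)) / Pn n < e / M powr p"
      using order_tendstoD(2)[OF prob_height_above_ratio[OF \<epsilon>(3,4)]] e M0 by simp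
    moreover have "\<forall>\<^sub>F n in sequentially. P (\<lambda>t. cnt \<Omega> t = n \<and> real (ht t) < (1 - \<epsilon>) * (ln (real n) / decay)) / Pn n < e / ?l"
      using order_tendstoD(2)[OF prob_height_below_ratio[OF \<epsilon>(3,4)]] e l0 by simp
    moreover note order_tendstoD(2)[OF tail e]
    ultimately have "\<forall>\<^sub>F n in sequentially. norm (measure_pmf.expectation T (\<lambda>t. if cnt \<Omega> t = n then ?X n t else 0) / Pn n - ?l) < e0"
      using prob_cnt_pos_eventually eventually_gt_at_top[of 1]
    proof eventually_elim
      case (elim n)
      let ?hi = "\<lambda>t. cnt \<Omega> t = n \<and> real (ht t) > (1 + \<epsilon>) * (ln (real n) / decay)"
      let ?lo = "\<lambda>t. cnt \<Omega> t = n \<and> real (ht t) < (1 - \<epsilon>) * (ln (real n) / decay)"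
      let ?tl = "\<lambda>t. cnt \<Omega> t = n \<and> real (ht t) > M * ln (real n)"
      let ?c = "\<lambda>t. cnt \<Omega> t = n"
      let ?E = "measure_pmf.expectation T"
      have ln: "ln (real n) > 0" using elim by simp
      have int: "integrable (measure_pmf T) (\<lambda>t. if Q t then ?X n t else 0)" for Q by (rule integrable_height_powr)
      have ind: "integrable (measure_pmf T) (\<lambda>t. indicator {t. Q t} t * (a :: real))" for Q a
        by (rule integrable_pmf_bounded[where B = "\<bar>a\<bar>"]) (simp add: indicator_def)
      have up: "(if ?c t then ?X n t else 0)
         \<le> indicator {t. ?c t} t * (?l + e) + indicator {t. ?hi t} t * M powr p + (if ?tl t then ?X n t else 0)" for t
      proof (cases "?c t")
        case c: True
        consider "?tl t" | "\<not> ?tl t" "?hi t" | "\<not> ?tl t" "\<not> ?hi t" by blast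
        then show ?thesis
        proof cases
          case 1
          then show ?thesis using c e l0 M0 by (auto simp: indicator_def)
        next
          case 2
          then have "real (ht t) / ln (real n) \<le> M" using c ln by (simp add: pos_divide_le_eq)
          then have "?X n t \<le> M powr p" using p ln by (intro powr_mono2) auto
          then have "?X n t \<le> (?l + e) + M powr p" using e l0 by linarith
          then show ?thesis using 2 c by (simp add: indicator_def)
        next
          case 3
          then have "real (ht t) / ln (real n) \<le> (1 + \<epsilon>) / decay" using c ln decay_pos by (simp add: field_simps)
          then have "?X n t \<le> ((1 + \<epsilon>) / decay) powr p" using p ln by (intro powr_mono2) auto
          then show ?thesis using 3 c \<epsilon>(1) by (auto simp: indicator_def)
        qed
      qed auto
      have low: "indicator {t. ?c t} t * (?l - e) \<le> (if ?c t then ?X n t else 0) + indicator {t. ?lo t} t * ?l" for t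
      proof (cases "?c t")
        case c: True
        show ?thesis
        proof (cases "?lo t")
          case True
          have X: "- e \<le> ?X n t" using e powr_ge_zero[of "real (ht t) / ln (real n)" p] by linarith
          have ind1: "indicator {t. ?c t} t = (1 :: real)" "indicator {t. ?lo t} t = (1 :: real)"
            using True by (simp_all only: indicator_simps mem_Collect_eq)
          show ?thesis unfolding ind1 if_P[OF c] mult_1
            using add_right_mono[OF X, of ?l] by (simp only: uminus_add_conv_diff)
        next
          case False
          then have "(1 - \<epsilon>) / decay \<le> real (ht t) / ln (real n)" using c ln decay_pos by (simp add: field_simps)
          then have "((1 - \<epsilon>) / decay) powr p \<le> ?X n t" using p \<epsilon> decay_pos by (intro powr_mono2) auto
          then show ?thesis using False c \<epsilon>(2) by (auto simp: indicator_def)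
        qed
      qed auto
      have "?E (\<lambda>t. if ?c t then ?X n t else 0) \<le> ?E (\<lambda>t. indicator {t. ?c t} t * (?l + e) + indicator {t. ?hi t} t * M powr p + (if ?tl t then ?X n t else 0))"
        by (intro integral_mono Bochner_Integration.integrable_add int ind up)
      also have "\<dots> = Pn n * (?l + e) + P ?hi * M powr p + ?E (\<lambda>t. if ?tl t then ?X n t else 0)"
        using int ind by simp
      finally have "?E (\<lambda>t. if ?c t then ?X n t else 0) / Pn n \<le> (?l + e) + P ?hi / Pn n * M powr p + ?E (\<lambda>t. if ?tl t then ?X n t else 0) / Pn n"
        using elim(4) by (simp add: field_simps)
      moreover have "P ?hi / Pn n * M powr p < e" using elim(1) M0 by (simp add: pos_less_divide_eq)
      ultimately have u: "?E (\<lambda>t. if ?c t then ?X n t else 0) / Pn n < ?l + 3 * e" using elim(3) by linarith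
      have "?E (\<lambda>t. indicator {t. ?c t} t * (?l - e)) = Pn n * (?l - e)" by simp
      then have "Pn n * (?l - e) = ?E (\<lambda>t. indicator {t. ?c t} t * (?l - e))" ..
      also have "\<dots> \<le> ?E (\<lambda>t. (if ?c t then ?X n t else 0) + indicator {t. ?lo t} t * ?l)"
        by (intro integral_mono Bochner_Integration.integrable_add int ind low)
      also have "\<dots> = ?E (\<lambda>t. if ?c t then ?X n t else 0) + P ?lo * ?l"
        using int ind by simp
      finally have "?l - e \<le> (?E (\<lambda>t. if ?c t then ?X n t else 0) + P ?lo * ?l) / Pn n"
        unfolding pos_le_divide_eq[OF elim(4)] by (simp only: mult.commute)
      then have "?l - e \<le> ?E (\<lambda>t. if ?c t then ?X n t else 0) / Pn n + P ?lo / Pn n * ?l"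
        by (simp only: add_divide_distrib times_divide_eq_left)
      moreover have "P ?lo / Pn n * ?l < e" using elim(2) l0 by (simp add: pos_less_divide_eq)
      ultimately have "?E (\<lambda>t. if ?c t then ?X n t else 0) / Pn n > ?l - 2 * e" by linarith
      with u show ?case unfolding real_norm_def e_def using e0 by linarith
    qed
    then show "\<exists>N. \<forall>n\<ge>N. norm (measure_pmf.expectation T (\<lambda>t. if cnt \<Omega> t = n then ?X n t else 0) / Pn n - ?l) < e0"
      by (simp add: eventually_sequentially)
  qed
qed

end

theorem proposition1p7:
  fixes \<xi> :: "nat pmf" and f :: "real \<Rightarrow> real" and \<alpha> p :: real and \<Omega> :: "nat set"
  assumes "measure_pmf.prob \<xi> {0} > 0"
    and "measure_pmf.prob \<xi> {..1} < 1"
    and "integrable (measure_pmf \<xi>) real"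
    and "measure_pmf.expectation \<xi> real < 1"
    and "slowly_varying f"
    and "\<alpha> > 1"
    and "\<forall>\<^sub>F n in sequentially. measure_pmf.prob \<xi> {n} = f (real n) * real n powr (-1 - \<alpha>)"
    and "\<Omega> \<noteq> {}"
    and "measure_pmf.prob \<xi> \<Omega> > 0"
    and "finite \<Omega> \<or> finite (UNIV - \<Omega>)"
    and "p \<ge> 1"
  shows "(\<lambda>n. \<integral>c. (real (tree_height (tree_of c)) / ln (real n)) powr p \<partial>conditioned_GW_space \<xi> \<Omega> n)
           \<longlonglongrightarrow> ln (1 / measure_pmf.expectation \<xi> real) powr (-p)"
proof -
  define \<mu> where "\<mu> = measure_pmf.expectation \<xi> real"
  have \<mu>: "\<mu> > 0"
  proof (rule ccontr)
    assume "\<not> \<mu> > 0"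
    moreover have "\<mu> \<ge> 0" unfolding \<mu>_def by (rule integral_nonneg_AE) auto
    ultimately have "\<mu> = 0" by simp
    then have "AE k in \<xi>. real k = 0"
      using integral_nonneg_eq_0_iff_AE[OF assms(3)] by (simp add: \<mu>_def)
    then have "measure_pmf.prob \<xi> {..1} = 1"
      by (intro measure_pmf.prob_eq_1[THEN iffD2]) (auto elim: eventually_mono)
    then show False using assms(2) by simp
  qed
  interpret condensation_gw \<xi> \<mu> \<Omega> f \<alpha>
    by unfold_locales (use assms \<mu> in \<open>auto simp: \<mu>_def measure_pmf_single\<close>)
  have "\<forall>\<^sub>F n in sequentially.
      measure_pmf.expectation T (\<lambda>t. if cnt \<Omega> t = n then (real (ht t) / ln (real n)) powr p else 0) / Pn n
      = (\<integral>c. (real (tree_height (tree_of c)) / ln (real n)) powr p \<partial>conditioned_GW_space \<xi> \<Omega> n)"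
    using prob_cnt_pos_eventually
  proof eventually_elim
    case (elim n)
    show ?case using conditioned_integral[OF elim, of "\<lambda>h. (real h / ln (real n)) powr p"] by simp
  qed
  moreover have "(1 / decay) powr p = ln (1 / \<mu>) powr (- p)"
    using decay_pos by (simp add: powr_minus_divide powr_divide decay_def)
  ultimately show ?thesis
    using Lim_transform_eventually[OF conditioned_height_moment[of p]] assms(11) by (simp add: \<mu>_def)
qed

end
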